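(* Let $\bm{A}\in\mathbb{R}^{d\times n}$ have integer entries of absolute value at most $\gamma$, $k$ a positive integer and $\varepsilon\in(0,1)$. There is an algorithm that computes $\bm{U}\in\mathbb{R}^{d\times k}_{\ge 0}$ with $\bm{U}^T\bm{U}=\bm{I}_k$ such that $\|\bm{A}-\bm{U}\bm{U}^T\bm{A}\|_F^2\le(1+\varepsilon)\mathrm{OPT}$ in time $(nd\gamma/\varepsilon)^{O(k^3/\varepsilon)}$.
   Context: $\mathbb{R}^{d\times k}_{\ge0}$ denotes $d\times k$ matrices with nonnegative entries. $\mathrm{OPT}=\min\{\|\bm{A}-\bm{U}\bm{U}^T\bm{A}\|_F^2:\bm{U}\in\mathbb{R}^{d\times k}_{\ge0},\ \bm{U}^T\bm{U}=\bm{I}_k\}$. *)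

theory Defs
  imports Complex_Main "Jordan_Normal_Form.Matrix"
begin

definition frobenius_norm :: "real mat \<Rightarrow> real" where
  "frobenius_norm A = sqrt (\<Sum>i<dim_row A. \<Sum>j<dim_col A. (A $$ (i, j))\<^sup>2)"

definition nonneg_orthonormal :: "nat \<Rightarrow> nat \<Rightarrow> real mat set" where
  "nonneg_orthonormal d k =
     {U \<in> carrier_mat d k. (\<forall>i<d. \<forall>j<k. 0 \<le> U $$ (i, j)) \<and> transpose_mat U * U = 1\<^sub>m k}"

definition residual :: "real mat \<Rightarrow> real mat \<Rightarrow> real" where
  "residual A U = (frobenius_norm (A - U * transpose_mat U * A))\<^sup>2"

(* For k \<le> dim_row A the feasible set is nonempty and compact, so this infimum is a minimum.
   For k > dim_row A the feasible set is empty and the value is meaningless. *)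
definition OPT :: "real mat \<Rightarrow> nat \<Rightarrow> real" where
  "OPT A k = (INF U \<in> nonneg_orthonormal (dim_row A) k. residual A U)"


text \<open>
  The model of computation is the real RAM: a random access machine with one memory of natural
  numbers, used for counting and (indirect) addressing, and one memory of real numbers with exact
  unit-cost arithmetic, square roots and comparisons. Natural numbers can be converted to reals;
  there is no conversion in the other direction (no rounding), no multiplication of natural
  numbers, and no real constant in a program. Square roots are needed because an
  admissible output is in general irrational.
\<close>

type_synonym state = "(nat \<Rightarrow> nat) \<times> (nat \<Rightarrow> real)"

datatype nexp =
    NConst nat
  | NAt nexp (* content of the natural number cell with the given address *)
  | NAdd nexp nexp
  | NSub nexp nexp

datatype rexp =
    RAt nexp (* content of the real number cell with the given address *)
  | ROfNat nexp
  | RAdd rexp rexp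
  | RSub rexp rexp
  | RMul rexp rexp
  | RDiv rexp rexp
  | RSqrt rexp

datatype test =
    NLess nexp nexp
  | RLess rexp rexp

datatype com =
    Skip
  | NAssign nexp nexp (* address, value *)
  | RAssign nexp rexp
  | Seq com com
  | Cond test com com
  | While test com

primrec nval :: "nexp \<Rightarrow> state \<Rightarrow> nat" where
  "nval (NConst c) s = c"
| "nval (NAt a) s = fst s (nval a s)"
| "nval (NAdd a b) s = nval a s + nval b s"
| "nval (NSub a b) s = nval a s - nval b s"

(* Division by zero and roots of negative numbers follow the total library conventions;
   a program could detect these cases by comparisons. *)
primrec rval :: "rexp \<Rightarrow> state \<Rightarrow> real" where
  "rval (RAt a) s = snd s (nval a s)"
| "rval (ROfNat a) s = real (nval a s)"
| "rval (RAdd x y) s = rval x s + rval y s"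
| "rval (RSub x y) s = rval x s - rval y s"
| "rval (RMul x y) s = rval x s * rval y s"
| "rval (RDiv x y) s = rval x s / rval y s"
| "rval (RSqrt x) s = sqrt (rval x s)"

primrec tval :: "test \<Rightarrow> state \<Rightarrow> bool" where
  "tval (NLess a b) s \<longleftrightarrow> nval a s < nval b s"
| "tval (RLess x y) s \<longleftrightarrow> rval x s < rval y s"

primrec ncost :: "nexp \<Rightarrow> nat" where
  "ncost (NConst c) = 1"
| "ncost (NAt a) = 1 + ncost a"
| "ncost (NAdd a b) = 1 + ncost a + ncost b"
| "ncost (NSub a b) = 1 + ncost a + ncost b"

primrec rcost :: "rexp \<Rightarrow> nat" where
  "rcost (RAt a) = 1 + ncost a"
| "rcost (ROfNat a) = 1 + ncost a"
| "rcost (RAdd x y) = 1 + rcost x + rcost y"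
| "rcost (RSub x y) = 1 + rcost x + rcost y"
| "rcost (RMul x y) = 1 + rcost x + rcost y"
| "rcost (RDiv x y) = 1 + rcost x + rcost y"
| "rcost (RSqrt x) = 1 + rcost x"

primrec tcost :: "test \<Rightarrow> nat" where
  "tcost (NLess a b) = 1 + ncost a + ncost b"
| "tcost (RLess x y) = 1 + rcost x + rcost y"

(* exec c s t s': started in state s, the program c halts after time t in state s'. *)
inductive exec :: "com \<Rightarrow> state \<Rightarrow> nat \<Rightarrow> state \<Rightarrow> bool" where
  Skip: "exec Skip s 1 s"
| NAssign: "exec (NAssign a e) s (1 + ncost a + ncost e) ((fst s)(nval a s := nval e s), snd s)"
| RAssign: "exec (RAssign a e) s (1 + ncost a + rcost e) (fst s, (snd s)(nval a s := rval e s))"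
| Seq: "exec c1 s1 t1 s2 \<Longrightarrow> exec c2 s2 t2 s3 \<Longrightarrow> exec (Seq c1 c2) s1 (t1 + t2) s3"
| CondTrue: "tval b s \<Longrightarrow> exec c1 s t s' \<Longrightarrow> exec (Cond b c1 c2) s (tcost b + t) s'"
| CondFalse: "\<not> tval b s \<Longrightarrow> exec c2 s t s' \<Longrightarrow> exec (Cond b c1 c2) s (tcost b + t) s'"
| WhileFalse: "\<not> tval b s \<Longrightarrow> exec (While b c) s (tcost b) s"
| WhileTrue: "tval b s1 \<Longrightarrow> exec c s1 t1 s2 \<Longrightarrow> exec (While b c) s2 t2 s3
    \<Longrightarrow> exec (While b c) s1 (tcost b + t1 + t2) s3"

lemma exec_determ:
  "exec c s t1 s1 \<Longrightarrow> exec c s t2 s2 \<Longrightarrow> t1 = t2 \<and> s1 = s2"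
proof (induction arbitrary: t2 s2 rule: exec.induct)
  case (Skip s)
  then show ?case by cases simp
next
  case (NAssign a e s)
  then show ?case by cases simp
next
  case (RAssign a e s)
  then show ?case by cases simp
next
  case (Seq c1 s1 t1 s2' c2 t2' s3)
  from Seq.prems show ?case
    by cases (use Seq.IH in blast)
next
  case (CondTrue b s c1 t s' c2)
  from CondTrue.prems show ?case
    by cases (use CondTrue.hyps CondTrue.IH in blast)+
next
  case (CondFalse b s c2 t s' c1)
  from CondFalse.prems show ?case
    by cases (use CondFalse.hyps CondFalse.IH in blast)+
next
  case (WhileFalse b s c)
  from WhileFalse.prems show ?case
    by cases (use WhileFalse.hyps in blast)+
next
  case (WhileTrue b s1 c t1 s2' t2' s3)
  from WhileTrue.prems show ?case
    by cases (use WhileTrue.hyps WhileTrue.IH in blast)+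
qed

(* Natural number cells 0, 1, 2 hold d, n, k; real cell 0 holds eps and the cells from 1 on hold
   the d x n matrix A row by row; all other cells are 0. *)
definition input_state :: "real mat \<Rightarrow> nat \<Rightarrow> real \<Rightarrow> state" where
  "input_state A k \<epsilon> =
     ((\<lambda>a. if a = 0 then dim_row A else if a = 1 then dim_col A else if a = 2 then k else 0),
      (\<lambda>a. if a = 0 then \<epsilon>
           else if a \<le> dim_row A * dim_col A
             then A $$ ((a - 1) div dim_col A, (a - 1) mod dim_col A)
           else 0))"

lemma input_state_entry:
  assumes "i < dim_row A" and "j < dim_col A"
  shows "snd (input_state A k \<epsilon>) (1 + i * dim_col A + j) = A $$ (i, j)"
proof -
  have "(i + 1) * dim_col A \<le> dim_row A * dim_col A"
    using assms by (intro mult_right_mono) auto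
  then have "Suc (i * dim_col A + j) \<le> dim_row A * dim_col A"
    using assms(2) by simp
  then show ?thesis
    using assms by (simp add: input_state_def)
qed

(* The d x k output is stored row by row in the real cells starting at the address that the
   program has left in natural number cell 0. *)
definition output_mat :: "nat \<Rightarrow> nat \<Rightarrow> state \<Rightarrow> real mat" where
  "output_mat d k s = mat d k (\<lambda>(i, j). snd s (fst s 0 + i * k + j))"

end

(* A nonnegative matrix with orthonormal columns has at most one nonzero entry per row, so the
   problem is to cover the rows a_i of A by k rays with directions v_j, at cost the sum of squared
   distances to the nearest ray.  If a cluster is approximated by a_i ~ w_i v, then v is, up to the
   usual weighting, the mean of the vectors a_i / w_i under the probabilities w_i^2 / sum w^2, and the
   variance of this distribution is the cost of the cluster divided by sum w^2.  Hence the average of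
   m >= 4/eps suitable samples a_i / w_i is a direction that is optimal up to a factor 1 + 1/m.
   The weights can be rounded to integers in {1..B} with B polynomial in nd gamma/eps, because an
   integral matrix has cluster cost zero or at least 1 / |A|_F^2: two integral rows that do not lie on a
   common ray have Gram determinant at least 1 or an obtuse angle.  So it suffices to
   try the B^(2km) choices of km rows and weights.

   The program is compiled from a small language of real-valued expressions with bounded iteration
   whose evaluation recomputes everything from the input and the index of the current choice. The
   recomputation is wasteful, but costs only a power of B^(2km), which the exponent of the bound
   absorbs. *)
theory Submission
  imports Defs
begin

section \<open>Programs and their running time\<close>

text \<open>The residual of a candidate is never computed. Each candidate has a surrogate cost, the
  squared error of the rows against multiples of its directions. This bounds the residual of the
  output from above, because for given \<open>U\<close> the rows of
  \<open>transpose_mat U * A\<close> are the best directions; and for every feasible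
  \<open>U\<close> some candidate has surrogate cost at most \<open>1 + \<epsilon>\<close> times the
  residual of \<open>U\<close>. So minimising the surrogate suffices. Orthonormality forbids a zero
  column, which nearest-ray assignment does not exclude. Hence the first sampled row of each cluster
  is forced into it with a positive coefficient, and a candidate that still has a zero column pays a
  penalty that no minimiser can afford. The error budget is
  \<open>(1 + \<epsilon> / 4) * (1 + \<epsilon> / 2)\<close>: the first factor is sampling, the
  second is rounding of the weights, one quarter relative and one quarter additive. The machine
  cannot round, so addresses, floors and digits are found by counting in loops capped by a fuel. The
  number \<open>W\<close> of candidates dominates all these counts, and the total time is a fixed
  polynomial in \<open>W\<close>.\<close>

definition runs :: "com \<Rightarrow> state \<Rightarrow> nat \<Rightarrow> (state \<Rightarrow> bool) \<Rightarrow> bool" where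
  "runs c s T Q \<longleftrightarrow> (\<exists>t s'. exec c s t s' \<and> t \<le> T \<and> Q s')"

lemma runs_mono:
  assumes "runs c s T P" "T \<le> T'" "\<And>s'. P s' \<Longrightarrow> Q s'"
  shows "runs c s T' Q"
  using assms unfolding runs_def by (meson le_trans)

lemma runs_Skip: "Q s \<Longrightarrow> 1 \<le> T \<Longrightarrow> runs Skip s T Q"
  unfolding runs_def using exec.Skip by blast

lemma runs_NAssign:
  "Q ((fst s)(nval a s := nval e s), snd s) \<Longrightarrow> 1 + ncost a + ncost e \<le> T \<Longrightarrow> runs (NAssign a e) s T Q"
  unfolding runs_def using exec.NAssign by blast

lemma runs_RAssign:
  "Q (fst s, (snd s)(nval a s := rval e s)) \<Longrightarrow> 1 + ncost a + rcost e \<le> T \<Longrightarrow> runs (RAssign a e) s T Q"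
  unfolding runs_def using exec.RAssign by blast

lemma runs_Seq:
  assumes "runs c1 s T1 P" "\<And>s'. P s' \<Longrightarrow> runs c2 s' T2 Q" "T1 + T2 \<le> T"
  shows "runs (Seq c1 c2) s T Q"
proof -
  from assms(1) obtain t s' where 1: "exec c1 s t s'" "t \<le> T1" "P s'"
    unfolding runs_def by blast
  from assms(2)[OF 1(3)] obtain t' s'' where 2: "exec c2 s' t' s''" "t' \<le> T2" "Q s''"
    unfolding runs_def by blast
  have "exec (Seq c1 c2) s (t + t') s''" using 1 2 exec.Seq by blast
  moreover have "t + t' \<le> T" using 1 2 assms(3) by linarith
  ultimately show ?thesis using 2 unfolding runs_def by blast
qed

lemma runs_Cond:
  assumes "tval b s \<Longrightarrow> runs c1 s T' Q" "\<not> tval b s \<Longrightarrow> runs c2 s T' Q" "tcost b + T' \<le> T"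
  shows "runs (Cond b c1 c2) s T Q"
proof (cases "tval b s")
  case True
  then obtain t s' where "exec c1 s t s'" "t \<le> T'" "Q s'"
    using assms(1) unfolding runs_def by blast
  then show ?thesis
    unfolding runs_def using exec.CondTrue[OF True, of c1 t s' c2] assms(3)
    by (intro exI[of _ "tcost b + t"] exI[of _ s']) simp
next
  case False
  then obtain t s' where "exec c2 s t s'" "t \<le> T'" "Q s'"
    using assms(2) unfolding runs_def by blast
  then show ?thesis
    unfolding runs_def using exec.CondFalse[OF False, of c2 t s' c1] assms(3)
    by (intro exI[of _ "tcost b + t"] exI[of _ s']) simp
qed

lemma runs_While:
  assumes init: "I 0 s"
    and step: "\<And>i s. i < N \<Longrightarrow> I i s \<Longrightarrow> tval b s \<and> runs c s T' (I (Suc i))"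
    and final: "\<And>s. I N s \<Longrightarrow> \<not> tval b s"
    and T: "N * (tcost b + T') + tcost b \<le> T"
  shows "runs (While b c) s T (I N)"
proof -
  \<comment> \<open>Induction on the number \<open>j\<close> of rounds still to come:
    \<open>exec.WhileTrue\<close> peels off the first round, so the rest of the loop is the smaller
    case.\<close>
  have "runs (While b c) s (j * (tcost b + T') + tcost b) (I N)" if "I (N - j) s" "j \<le> N" for j s
    using that
  proof (induction j arbitrary: s)
    case 0
    then have "exec (While b c) s (tcost b) s" using final exec.WhileFalse by simp
    then show ?case using 0 unfolding runs_def by (intro exI[of _ "tcost b"] exI[of _ s]) simp
  next
    case (Suc j)
    then have "tval b s" "runs c s T' (I (Suc (N - Suc j)))"
      using step[of "N - Suc j" s] by auto
    moreover have "Suc (N - Suc j) = N - j" using Suc.prems by simp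
    ultimately obtain t s' where 1: "exec c s t s'" "t \<le> T'" "I (N - j) s'"
      unfolding runs_def by auto
    with Suc obtain t' s'' where 2: "exec (While b c) s' t' s''"
      "t' \<le> j * (tcost b + T') + tcost b" "I N s''"
      unfolding runs_def by (meson Suc_leD)
    have "exec (While b c) s (tcost b + t + t') s''"
      using \<open>tval b s\<close> 1 2 exec.WhileTrue by blast
    then show ?case using 1 2 unfolding runs_def
      by (intro exI[of _ "tcost b + t + t'"] exI[of _ s'']) simp
  qed
  from this[of N s] init have "runs (While b c) s (N * (tcost b + T') + tcost b) (I N)" by simp
  then show ?thesis by (rule runs_mono) (use T in auto)
qed

definition ceil_into :: "nat \<Rightarrow> rexp \<Rightarrow> com" where
  "ceil_into c e = Seq (NAssign (NConst c) (NConst 0))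
     (While (RLess (ROfNat (NAt (NConst c))) e)
        (NAssign (NConst c) (NAdd (NAt (NConst c)) (NConst 1))))"

text \<open>The cell \<open>c\<close> is counted up until it reaches \<open>x\<close>. The test
  evaluates \<open>e\<close> afresh in every round, hence the hypothesis that its value does not
  depend on \<open>c\<close>. For negative \<open>x\<close> no round takes place, in agreement with
  \<open>nat\<close>.\<close>

lemma runs_ceil_into:
  assumes e: "\<And>v. rval e ((fst s)(c := v), snd s) = x"
    and T: "nat \<lceil>x\<rceil> * (12 + rcost e) + 8 + rcost e \<le> T"
  shows "runs (ceil_into c e) s T (\<lambda>s'. s' = ((fst s)(c := nat \<lceil>x\<rceil>), snd s))"
  unfolding ceil_into_def
proof (rule runs_Seq)
  show "runs (NAssign (NConst c) (NConst 0)) s 3 (\<lambda>s'. s' = ((fst s)(c := 0), snd s))"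
    by (rule runs_NAssign) auto
  fix s' assume s': "s' = ((fst s)(c := 0), snd s)"
  show "runs (While (RLess (ROfNat (NAt (NConst c))) e)
        (NAssign (NConst c) (NAdd (NAt (NConst c)) (NConst 1)))) s'
        (nat \<lceil>x\<rceil> * (12 + rcost e) + 5 + rcost e) (\<lambda>s'. s' = ((fst s)(c := nat \<lceil>x\<rceil>), snd s))"
  proof (rule runs_While[where I = "\<lambda>i s'. s' = ((fst s)(c := i), snd s)" and T' = 7])
    show "s' = ((fst s)(c := 0), snd s)" by fact
    fix i s' assume "i < nat \<lceil>x\<rceil>" and s': "s' = ((fst s)(c := i), snd s)"
    then have "real i < x" by linarith
    then show "tval (RLess (ROfNat (NAt (NConst c))) e) s' \<and>
      runs (NAssign (NConst c) (NAdd (NAt (NConst c)) (NConst 1))) s' 7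
       (\<lambda>s'. s' = ((fst s)(c := Suc i), snd s))"
      using s' e by (auto intro!: runs_NAssign)
  next
    fix s' assume s': "s' = ((fst s)(c := nat \<lceil>x\<rceil>), snd s)"
    have "\<not> real (nat \<lceil>x\<rceil>) < x" by linarith
    then show "\<not> tval (RLess (ROfNat (NAt (NConst c))) e) s'"
      using s' e by simp
  qed (simp add: algebra_simps)
qed (use T in simp)

section \<open>A language of real expressions, its compiler and its running time\<close>

datatype bop = Plus | Minus | Times | Divide

primrec bop_val :: "bop \<Rightarrow> real \<Rightarrow> real \<Rightarrow> real" where
  "bop_val Plus x y = x + y"
| "bop_val Minus x y = x - y"
| "bop_val Times x y = x * y"
| "bop_val Divide x y = x / y"

primrec bop_rexp :: "bop \<Rightarrow> rexp \<Rightarrow> rexp \<Rightarrow> rexp" where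
  "bop_rexp Plus = RAdd"
| "bop_rexp Minus = RSub"
| "bop_rexp Times = RMul"
| "bop_rexp Divide = RDiv"

lemma rval_bop [simp]: "rval (bop_rexp f x y) s = bop_val f (rval x s) (rval y s)"
  by (cases f) auto

lemma rcost_bop [simp]: "rcost (bop_rexp f x y) = 1 + rcost x + rcost y"
  by (cases f) auto

text \<open>In \<open>EIter x b i e\<close> the body \<open>e\<close> sees the accumulator as variable \<open>x\<close> and the loop counter as
  variable \<open>x + 1\<close>. The number of rounds is the bound \<open>b\<close> rounded up, but at most the value of
  variable 0: this fuel makes the running time of an expression independent of its semantics.\<close>

datatype ex =
    EVar nat
  | ECst nat
  | EBin bop ex ex
  | ESqrt ex
  | EInp ex
  | EIf ex ex ex ex
  | EIter nat ex ex ex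

primrec iter :: "(nat \<Rightarrow> 'a \<Rightarrow> 'a) \<Rightarrow> nat \<Rightarrow> 'a \<Rightarrow> 'a" where
  "iter f 0 a = a"
| "iter f (Suc n) a = f n (iter f n a)"

text \<open>Real addresses are rounded up, because the machine has no conversion from reals to naturals
  and has to count up to the address; addresses beyond the input are clipped.\<close>

definition lookup :: "(nat \<Rightarrow> real) \<Rightarrow> nat \<Rightarrow> real \<Rightarrow> real" where
  "lookup inp M v = (if real M < v then inp 0 else inp (nat \<lceil>v\<rceil>))"

primrec ev :: "(nat \<Rightarrow> real) \<Rightarrow> nat \<Rightarrow> ex \<Rightarrow> (nat \<Rightarrow> real) \<Rightarrow> real" where
  "ev inp M (EVar y) \<sigma> = \<sigma> y"
| "ev inp M (ECst c) \<sigma> = real c"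
| "ev inp M (EBin f a b) \<sigma> = bop_val f (ev inp M a \<sigma>) (ev inp M b \<sigma>)"
| "ev inp M (ESqrt a) \<sigma> = sqrt (ev inp M a \<sigma>)"
| "ev inp M (EInp a) \<sigma> = lookup inp M (ev inp M a \<sigma>)"
| "ev inp M (EIf a b c e) \<sigma> = (if ev inp M a \<sigma> < ev inp M b \<sigma> then ev inp M c \<sigma> else ev inp M e \<sigma>)"
| "ev inp M (EIter x b i e) \<sigma> =
     iter (\<lambda>j a. ev inp M e (\<sigma>(x := a, x + 1 := real j)))
       (nat \<lceil>min (ev inp M b \<sigma>) (\<sigma> 0)\<rceil>) (ev inp M i \<sigma>)"

text \<open>\<open>V\<close> collects the variables in scope and \<open>p\<close> is the target
  register. In use all of \<open>V\<close> lies below \<open>p\<close>, so \<open>p \<le> x\<close>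
  keeps a loop from overwriting a variable. A loop occupies \<open>x\<close> (accumulator),
  \<open>x + 1\<close> (counter) and \<open>x + 2\<close> (bound), which is why its start value and
  body are evaluated at \<open>x + 3\<close>.\<close>

primrec wfe :: "ex \<Rightarrow> nat set \<Rightarrow> nat \<Rightarrow> bool" where
  "wfe (EVar y) V p \<longleftrightarrow> y \<in> V"
| "wfe (ECst c) V p \<longleftrightarrow> True"
| "wfe (EBin f a b) V p \<longleftrightarrow> wfe a V p \<and> wfe b V (Suc p)"
| "wfe (ESqrt a) V p \<longleftrightarrow> wfe a V p"
| "wfe (EInp a) V p \<longleftrightarrow> wfe a V p"
| "wfe (EIf a b c e) V p \<longleftrightarrow> wfe a V p \<and> wfe b V (Suc p) \<and> wfe c V p \<and> wfe e V p"
| "wfe (EIter x b i e) V p \<longleftrightarrow> p \<le> x \<and> wfe b V x \<and> wfe i V (x + 3)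
     \<and> wfe e (insert x (insert (x + 1) V)) (x + 3)"

text \<open>Natural cell 3 holds the address of the first real register and cell 5 the last address of the
  input; cell 4 is a temporary for computed addresses.  The compiled expression leaves its value in
  register \<open>p\<close> and uses the registers from \<open>p\<close> on.\<close>

definition reg :: "nat \<Rightarrow> nexp" where
  "reg r = NAdd (NAt (NConst 3)) (NConst r)"

lemma nval_reg [simp]: "nval (reg r) s = fst s 3 + r"
  by (simp add: reg_def)

lemma ncost_reg [simp]: "ncost (reg r) = 4"
  by (simp add: reg_def)

primrec compile :: "ex \<Rightarrow> nat \<Rightarrow> com" where
  "compile (EVar y) p = RAssign (reg p) (RAt (reg y))"
| "compile (ECst c) p = RAssign (reg p) (ROfNat (NConst c))"
| "compile (EBin f a b) p = Seq (compile a p) (Seq (compile b (Suc p))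
     (RAssign (reg p) (bop_rexp f (RAt (reg p)) (RAt (reg (Suc p))))))"
| "compile (ESqrt a) p = Seq (compile a p) (RAssign (reg p) (RSqrt (RAt (reg p))))"
| "compile (EInp a) p = Seq (compile a p)
     (Cond (RLess (ROfNat (NAt (NConst 5))) (RAt (reg p)))
       (RAssign (reg p) (RAt (NConst 0)))
       (Seq (ceil_into 4 (RAt (reg p))) (RAssign (reg p) (RAt (NAt (NConst 4))))))"
| "compile (EIf a b c e) p = Seq (compile a p) (Seq (compile b (Suc p))
     (Cond (RLess (RAt (reg p)) (RAt (reg (Suc p)))) (compile c p) (compile e p)))"
| "compile (EIter x b i e) p = Seq (compile b x)
     (Seq (Cond (RLess (RAt (reg 0)) (RAt (reg x)))
            (RAssign (reg (x + 2)) (RAt (reg 0))) (RAssign (reg (x + 2)) (RAt (reg x))))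
     (Seq (compile i (x + 3))
     (Seq (RAssign (reg x) (RAt (reg (x + 3))))
     (Seq (RAssign (reg (x + 1)) (ROfNat (NConst 0)))
     (Seq (While (RLess (RAt (reg (x + 1))) (RAt (reg (x + 2))))
            (Seq (compile e (x + 3))
            (Seq (RAssign (reg x) (RAt (reg (x + 3))))
                 (RAssign (reg (x + 1)) (RAdd (RAt (reg (x + 1))) (ROfNat (NConst 1)))))))
       (RAssign (reg p) (RAt (reg x))))))))"

text \<open>Only the syntax and the fuel enter. Each level of iteration multiplies by
  \<open>F\<close>, so for a fixed expression this is a polynomial in \<open>F\<close>.\<close>

primrec tm :: "nat \<Rightarrow> ex \<Rightarrow> nat" where
  "tm F (EVar y) = 10"
| "tm F (ECst c) = 10"
| "tm F (EBin f a b) = tm F a + tm F b + 20"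
| "tm F (ESqrt a) = tm F a + 20"
| "tm F (EInp a) = tm F a + F * 20 + 50"
| "tm F (EIf a b c e) = tm F a + tm F b + tm F c + tm F e + 20"
| "tm F (EIter x b i e) = tm F b + tm F i + F * (tm F e + 40) + 100"

text \<open>The input fills the cells up to \<open>M\<close> and the registers start at
  \<open>base\<close>. \<open>M_F\<close> bounds the count up to an input address by the
  fuel.\<close>

locale machine =
  fixes inp :: "nat \<Rightarrow> real" and M base F :: nat
  assumes M_base: "M < base" and M_F: "M \<le> F"
begin

definition okst :: "state \<Rightarrow> (nat \<Rightarrow> real) \<Rightarrow> nat set \<Rightarrow> bool" where
  "okst s \<sigma> V \<longleftrightarrow> fst s 3 = base \<and> fst s 5 = M \<and> (\<forall>a\<le>M. snd s a = inp a)
     \<and> (\<forall>y\<in>V. snd s (base + y) = \<sigma> y)"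

text \<open>What an evaluation into register \<open>p\<close> preserves: the input, all lower
  registers, and whatever else is stored below them. Cell 4 is exempt as the scratch cell of
  lookups.\<close>

definition frm :: "nat \<Rightarrow> state \<Rightarrow> state \<Rightarrow> bool" where
  "frm p s s' \<longleftrightarrow> (\<forall>a. a \<noteq> 4 \<longrightarrow> fst s' a = fst s a) \<and> (\<forall>a<base + p. snd s' a = snd s a)"

lemma frm_trans: "frm p s s' \<Longrightarrow> frm q s' s'' \<Longrightarrow> p \<le> q \<Longrightarrow> frm p s s''"
  by (simp add: frm_def)

lemma okst_frm: "okst s \<sigma> V \<Longrightarrow> frm p s s' \<Longrightarrow> V \<subseteq> {..<p} \<Longrightarrow> okst s' \<sigma> V"
  using M_base unfolding okst_def frm_def by (fastforce simp: subset_iff)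

text \<open>The induction generalises over target, scope and valuation, since a second operand is
  evaluated at the next register and a loop body in a larger scope. Variable 0 must be in scope
  because every loop reads its fuel there; \<open>\<sigma> 0 \<le> real F\<close> turns this cap
  into the time bound.\<close>

lemma runs_compile:
  assumes "wfe e V p" "0 \<in> V" "V \<subseteq> {..<p}" "okst s \<sigma> V" "\<sigma> 0 \<le> real F"
  shows "runs (compile e p) s (tm F e)
    (\<lambda>s'. frm p s s' \<and> snd s' (base + p) = ev inp M e \<sigma>)"
  using assms
proof (induction e arbitrary: V p s \<sigma>)
  case (EVar y)
  then show ?case by (auto simp: okst_def frm_def intro!: runs_RAssign)
next
  case (ECst c)
  then show ?case by (auto simp: okst_def frm_def intro!: runs_RAssign)
next
  case (EBin f a b)
  have V: "V \<subseteq> {..<Suc p}" using EBin.prems by auto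
  show ?case unfolding compile.simps
  proof (rule runs_Seq)
    show "runs (compile a p) s (tm F a) (\<lambda>s'. frm p s s' \<and> snd s' (base + p) = ev inp M a \<sigma>)"
      using EBin.prems by (intro EBin.IH(1)[where V=V]) simp_all
    fix s1 assume 1: "frm p s s1 \<and> snd s1 (base + p) = ev inp M a \<sigma>"
    then have ok1: "okst s1 \<sigma> V" using EBin.prems okst_frm by blast
    show "runs (Seq (compile b (Suc p)) (RAssign (reg p) (bop_rexp f (RAt (reg p)) (RAt (reg (Suc p))))))
        s1 (tm F b + 20) (\<lambda>s'. frm p s s' \<and> snd s' (base + p) = ev inp M (EBin f a b) \<sigma>)"
    proof (rule runs_Seq)
      show "runs (compile b (Suc p)) s1 (tm F b)
        (\<lambda>s'. frm (Suc p) s1 s' \<and> snd s' (base + Suc p) = ev inp M b \<sigma>)"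
        using EBin.prems V ok1 by (intro EBin.IH(2)[where V=V]) simp_all
      fix s2 assume 2: "frm (Suc p) s1 s2 \<and> snd s2 (base + Suc p) = ev inp M b \<sigma>"
      then have "frm p s s2" "snd s2 (base + p) = ev inp M a \<sigma>" "fst s2 3 = base"
        using 1 ok1 by (auto intro: frm_trans[where q="Suc p"] simp: frm_def okst_def)
      then show "runs (RAssign (reg p) (bop_rexp f (RAt (reg p)) (RAt (reg (Suc p))))) s2 20
         (\<lambda>s'. frm p s s' \<and> snd s' (base + p) = ev inp M (EBin f a b) \<sigma>)"
        using 2 by (intro runs_RAssign) (simp_all add: frm_def)
    qed simp
  qed simp
next
  case (ESqrt a)
  show ?case unfolding compile.simps
  proof (rule runs_Seq)
    show "runs (compile a p) s (tm F a) (\<lambda>s'. frm p s s' \<and> snd s' (base + p) = ev inp M a \<sigma>)"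
      using ESqrt.prems by (intro ESqrt.IH[where V=V]) simp_all
    fix s1 assume 1: "frm p s s1 \<and> snd s1 (base + p) = ev inp M a \<sigma>"
    then have "fst s1 3 = base" using ESqrt.prems by (auto simp: okst_def frm_def)
    then show "runs (RAssign (reg p) (RSqrt (RAt (reg p)))) s1 20
      (\<lambda>s'. frm p s s' \<and> snd s' (base + p) = ev inp M (ESqrt a) \<sigma>)"
      using 1 by (intro runs_RAssign) (simp_all add: frm_def)
  qed simp
next
  case (EInp a)
  show ?case unfolding compile.simps
  proof (rule runs_Seq)
    show "runs (compile a p) s (tm F a) (\<lambda>s'. frm p s s' \<and> snd s' (base + p) = ev inp M a \<sigma>)"
      using EInp.prems by (intro EInp.IH[where V=V]) simp_all
    fix s1 assume 1: "frm p s s1 \<and> snd s1 (base + p) = ev inp M a \<sigma>"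
    let ?v = "ev inp M a \<sigma>"
    have ok1: "okst s1 \<sigma> V" using 1 EInp.prems okst_frm by blast
    then have s1: "fst s1 3 = base" "fst s1 5 = M" "\<forall>a\<le>M. snd s1 a = inp a"
      by (auto simp: okst_def)
    show "runs (Cond (RLess (ROfNat (NAt (NConst 5))) (RAt (reg p)))
       (RAssign (reg p) (RAt (NConst 0)))
       (Seq (ceil_into 4 (RAt (reg p))) (RAssign (reg p) (RAt (NAt (NConst 4))))))
        s1 (F * 20 + 50) (\<lambda>s'. frm p s s' \<and> snd s' (base + p) = ev inp M (EInp a) \<sigma>)"
    proof (rule runs_Cond[where T'="F * 20 + 40"])
      assume "tval (RLess (ROfNat (NAt (NConst 5))) (RAt (reg p))) s1"
      then show "runs (RAssign (reg p) (RAt (NConst 0))) s1 (F * 20 + 40)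
        (\<lambda>s'. frm p s s' \<and> snd s' (base + p) = ev inp M (EInp a) \<sigma>)"
        using 1 s1 by (intro runs_RAssign) (simp_all add: frm_def lookup_def)
    next
      assume "\<not> tval (RLess (ROfNat (NAt (NConst 5))) (RAt (reg p))) s1"
      then have v: "?v \<le> real M" using 1 s1 by simp
      then have M: "nat \<lceil>?v\<rceil> \<le> M" by linarith
      then have F: "nat \<lceil>?v\<rceil> \<le> F" using M_F by linarith
      show "runs (Seq (ceil_into 4 (RAt (reg p))) (RAssign (reg p) (RAt (NAt (NConst 4))))) s1 (F * 20 + 40)
        (\<lambda>s'. frm p s s' \<and> snd s' (base + p) = ev inp M (EInp a) \<sigma>)"
      proof (rule runs_Seq)
        show "runs (ceil_into 4 (RAt (reg p))) s1 (F * 17 + 13) (\<lambda>s'. s' = ((fst s1)(4 := nat \<lceil>?v\<rceil>), snd s1))"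
        proof (rule runs_ceil_into)
          show "nat \<lceil>?v\<rceil> * (12 + rcost (RAt (reg p))) + 8 + rcost (RAt (reg p)) \<le> F * 17 + 13"
            using F by simp
        qed (use 1 s1 in simp)
        fix s2 assume "s2 = ((fst s1)(4 := nat \<lceil>?v\<rceil>), snd s1)"
        then show "runs (RAssign (reg p) (RAt (NAt (NConst 4)))) s2 20
         (\<lambda>s'. frm p s s' \<and> snd s' (base + p) = ev inp M (EInp a) \<sigma>)"
          using 1 s1 v M by (intro runs_RAssign) (auto simp: lookup_def frm_def)
      qed simp
    qed simp
  qed simp
next
  case (EIf a b c e)
  have V: "V \<subseteq> {..<Suc p}" using EIf.prems by auto
  show ?case unfolding compile.simps
  proof (rule runs_Seq)
    show "runs (compile a p) s (tm F a) (\<lambda>s'. frm p s s' \<and> snd s' (base + p) = ev inp M a \<sigma>)"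
      using EIf.prems by (intro EIf.IH(1)[where V=V]) simp_all
    fix s1 assume 1: "frm p s s1 \<and> snd s1 (base + p) = ev inp M a \<sigma>"
    then have ok1: "okst s1 \<sigma> V" using EIf.prems okst_frm by blast
    show "runs (Seq (compile b (Suc p)) (Cond (RLess (RAt (reg p)) (RAt (reg (Suc p)))) (compile c p) (compile e p)))
        s1 (tm F b + tm F c + tm F e + 20) (\<lambda>s'. frm p s s' \<and> snd s' (base + p) = ev inp M (EIf a b c e) \<sigma>)"
    proof (rule runs_Seq)
      show "runs (compile b (Suc p)) s1 (tm F b)
        (\<lambda>s'. frm (Suc p) s1 s' \<and> snd s' (base + Suc p) = ev inp M b \<sigma>)"
        using EIf.prems V ok1 by (intro EIf.IH(2)[where V=V]) simp_all
      fix s2 assume 2: "frm (Suc p) s1 s2 \<and> snd s2 (base + Suc p) = ev inp M b \<sigma>"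
      then have 3: "frm p s s2" "snd s2 (base + p) = ev inp M a \<sigma>" "fst s2 3 = base"
        using 1 ok1 by (auto intro: frm_trans[where q="Suc p"] simp: frm_def okst_def)
      have ok2: "okst s2 \<sigma> V" using 3 EIf.prems okst_frm by blast
      have c: "runs (compile c p) s2 (tm F c) (\<lambda>s'. frm p s2 s' \<and> snd s' (base + p) = ev inp M c \<sigma>)"
        using EIf.prems ok2 by (intro EIf.IH(3)[where V=V]) simp_all
      have e: "runs (compile e p) s2 (tm F e) (\<lambda>s'. frm p s2 s' \<and> snd s' (base + p) = ev inp M e \<sigma>)"
        using EIf.prems ok2 by (intro EIf.IH(4)[where V=V]) simp_all
      show "runs (Cond (RLess (RAt (reg p)) (RAt (reg (Suc p)))) (compile c p) (compile e p)) s2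
        (tm F c + tm F e + 20)
         (\<lambda>s'. frm p s s' \<and> snd s' (base + p) = ev inp M (EIf a b c e) \<sigma>)"
      proof (rule runs_Cond[where T'="tm F c + tm F e"])
        assume "tval (RLess (RAt (reg p)) (RAt (reg (Suc p)))) s2"
        then show "runs (compile c p) s2 (tm F c + tm F e)
          (\<lambda>s'. frm p s s' \<and> snd s' (base + p) = ev inp M (EIf a b c e) \<sigma>)"
          using 2 3 by (intro runs_mono[OF c]) (simp_all add: frm_def)
      next
        assume "\<not> tval (RLess (RAt (reg p)) (RAt (reg (Suc p)))) s2"
        then show "runs (compile e p) s2 (tm F c + tm F e)
          (\<lambda>s'. frm p s s' \<and> snd s' (base + p) = ev inp M (EIf a b c e) \<sigma>)"
          using 2 3 by (intro runs_mono[OF e]) (simp_all add: frm_def)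
      qed simp
    qed simp
  qed simp
next
  case (EIter x b i e)
  let ?B = "min (ev inp M b \<sigma>) (\<sigma> 0)"
  let ?N = "nat \<lceil>?B\<rceil>"
  let ?W = "insert x (insert (x + 1) V)"
  define f where "f = (\<lambda>j a. ev inp M e (\<sigma>(x := a, x + 1 := real j)))"
  define A where "A = ev inp M i \<sigma>"
  have px: "p \<le> x" using EIter.prems by simp
  have Vx: "V \<subseteq> {..<x}" "V \<subseteq> {..<x+3}" "x \<notin> V" "x + 1 \<notin> V" "0 < x"
    using EIter.prems px by fastforce+
  have NF: "?N \<le> F" using EIter.prems by linarith
  have W: "?W \<subseteq> {..<x+3}" using Vx by auto
  show ?case unfolding compile.simps
  proof (rule runs_Seq)
    show "runs (compile b x) s (tm F b) (\<lambda>s'. frm x s s' \<and> snd s' (base + x) = ev inp M b \<sigma>)"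
      using EIter.prems Vx by (intro EIter.IH(1)[where V=V]) simp_all
    fix s1 assume 1: "frm x s s1 \<and> snd s1 (base + x) = ev inp M b \<sigma>"
    then have ok1: "okst s1 \<sigma> V" using EIter.prems okst_frm Vx by blast
    let ?c6 = "RAssign (reg p) (RAt (reg x))"
    let ?cb = "Seq (compile e (x + 3))
            (Seq (RAssign (reg x) (RAt (reg (x + 3))))
                 (RAssign (reg (x + 1)) (RAdd (RAt (reg (x + 1))) (ROfNat (NConst 1)))))"
    let ?c5 = "Seq (While (RLess (RAt (reg (x + 1))) (RAt (reg (x + 2)))) ?cb) ?c6"
    let ?c4 = "Seq (RAssign (reg (x + 1)) (ROfNat (NConst 0))) ?c5"
    let ?c3 = "Seq (RAssign (reg x) (RAt (reg (x + 3)))) ?c4"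
    let ?c2 = "Seq (compile i (x + 3)) ?c3"
    let ?Q = "\<lambda>s'. frm p s s' \<and> snd s' (base + p) = ev inp M (EIter x b i e) \<sigma>"
    show "runs (Seq (Cond (RLess (RAt (reg 0)) (RAt (reg x)))
            (RAssign (reg (x + 2)) (RAt (reg 0))) (RAssign (reg (x + 2)) (RAt (reg x)))) ?c2)
       s1 (tm F i + F * (tm F e + 40) + 100) ?Q"
    proof (rule runs_Seq)
      show "runs (Cond (RLess (RAt (reg 0)) (RAt (reg x)))
            (RAssign (reg (x + 2)) (RAt (reg 0))) (RAssign (reg (x + 2)) (RAt (reg x)))) s1 21
           (\<lambda>s'. frm x s s' \<and> snd s' (base + (x + 2)) = ?B)"
        using 1 ok1 \<open>0 \<in> V\<close>
        by (intro runs_Cond[where T'=10] runs_RAssign) (auto simp: okst_def frm_def min_def)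
      fix s2 assume 2: "frm x s s2 \<and> snd s2 (base + (x + 2)) = ?B"
      then have ok2: "okst s2 \<sigma> V" using EIter.prems okst_frm Vx by blast
      show "runs ?c2 s2 (tm F i + F * (tm F e + 40) + 79) ?Q"
      proof (rule runs_Seq)
        show "runs (compile i (x + 3)) s2 (tm F i)
          (\<lambda>s'. frm (x + 3) s2 s' \<and> snd s' (base + (x + 3)) = ev inp M i \<sigma>)"
          using EIter.prems Vx ok2 by (intro EIter.IH(2)[where V=V]) simp_all
        fix s3 assume 3: "frm (x + 3) s2 s3 \<and> snd s3 (base + (x + 3)) = ev inp M i \<sigma>"
        then have 3: "frm x s s3" "snd s3 (base + (x + 3)) = A" "snd s3 (base + (x + 2)) = ?B"
          using 2 by (auto intro: frm_trans[where q="x+3"] simp: frm_def A_def)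
        then have ok3: "okst s3 \<sigma> V" using EIter.prems okst_frm Vx by blast
        show "runs ?c3 s3 (F * (tm F e + 40) + 79) ?Q"
        proof (rule runs_Seq)
          show "runs (RAssign (reg x) (RAt (reg (x + 3)))) s3 10
             (\<lambda>s'. frm x s s' \<and> snd s' (base + x) = A \<and> snd s' (base + (x + 2)) = ?B)"
            using 3 ok3 by (intro runs_RAssign) (auto simp: okst_def frm_def)
          fix s4 assume 4: "frm x s s4 \<and> snd s4 (base + x) = A \<and> snd s4 (base + (x + 2)) = ?B"
          then have ok4: "okst s4 \<sigma> V" using EIter.prems okst_frm Vx by blast
          show "runs ?c4 s4 (F * (tm F e + 40) + 69) ?Q"
          proof (rule runs_Seq)
            let ?I = "\<lambda>j s'. frm x s s' \<and> snd s' (base + x) = iter f j A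
               \<and> snd s' (base + (x + 1)) = real j \<and> snd s' (base + (x + 2)) = ?B"
            show "runs (RAssign (reg (x + 1)) (ROfNat (NConst 0))) s4 10 (?I 0)"
              using 4 ok4 by (intro runs_RAssign) (auto simp: okst_def frm_def)
            fix s5 assume 5: "?I 0 s5"
            show "runs ?c5 s5 (F * (tm F e + 40) + 59) ?Q"
            proof (rule runs_Seq)
              show "runs (While (RLess (RAt (reg (x + 1))) (RAt (reg (x + 2)))) ?cb) s5
                  (F * (tm F e + 40) + 20) (?I ?N)"
              proof (rule runs_While[where I = "?I" and T' = "tm F e + 29"])
                show "?I 0 s5" by fact
              next
                fix j s6 assume j: "j < ?N" and 6: "?I j s6"
                then have ok6: "okst s6 \<sigma> V" using EIter.prems okst_frm Vx by blast
                \<comment> \<open>The counter is compared with the unrounded bound, which yields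
                  exactly the ceiling as number of rounds.\<close>
                have "real j < ?B" using j by linarith
                then have t: "tval (RLess (RAt (reg (x + 1))) (RAt (reg (x + 2)))) s6"
                  using 6 ok6 by (simp add: okst_def)
                have ok6': "okst s6 (\<sigma>(x := iter f j A, x + 1 := real j)) ?W"
                  using ok6 6 Vx by (auto simp: okst_def)
                have "runs ?cb s6 (tm F e + 29) (?I (Suc j))"
                proof (rule runs_Seq)
                  show "runs (compile e (x + 3)) s6 (tm F e)
                     (\<lambda>s'. frm (x + 3) s6 s' \<and> snd s' (base + (x + 3))
                       = ev inp M e (\<sigma>(x := iter f j A, x + 1 := real j)))"
                    by (rule EIter.IH(3)[OF _ _ W ok6']) (use EIter.prems Vx in simp_all)
                  fix s7 assume 7: "frm (x + 3) s6 s7 \<and> snd s7 (base + (x + 3))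
                       = ev inp M e (\<sigma>(x := iter f j A, x + 1 := real j))"
                  then have "snd s7 (base + (x + 3)) = iter f (Suc j) A" "frm x s s7"
                    "snd s7 (base + (x + 1)) = real j" "snd s7 (base + (x + 2)) = ?B"
                    "fst s7 3 = base"
                    using 6 ok6 by (auto intro: frm_trans[where q="x+3"] simp: f_def frm_def okst_def)
                  then show "runs (Seq (RAssign (reg x) (RAt (reg (x + 3))))
                 (RAssign (reg (x + 1)) (RAdd (RAt (reg (x + 1))) (ROfNat (NConst 1))))) s7 29 (?I (Suc j))"
                    by (intro runs_Seq[where ?T1.0=10 and ?T2.0=19 and
                       P="\<lambda>s'. s' = (fst s7, (snd s7)(base + x := iter f (Suc j) A))"] runs_RAssign)
                      (simp_all add: frm_def)
                qed simp
                then show "tval (RLess (RAt (reg (x + 1))) (RAt (reg (x + 2)))) s6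
                   \<and> runs ?cb s6 (tm F e + 29) (?I (Suc j))" using t by blast
              next
                fix s6 assume 6: "?I ?N s6"
                then have ok6: "okst s6 \<sigma> V" using EIter.prems okst_frm Vx by blast
                have "\<not> real ?N < ?B" by linarith
                then show "\<not> tval (RLess (RAt (reg (x + 1))) (RAt (reg (x + 2)))) s6"
                  using 6 ok6 by (simp add: okst_def del: min_less_iff_conj)
              next
                have "?N * (tm F e + 40) \<le> F * (tm F e + 40)" using NF by (rule mult_right_mono) simp
                then show "?N * (tcost (RLess (RAt (reg (x + 1))) (RAt (reg (x + 2)))) + (tm F e + 29))
                  + tcost (RLess (RAt (reg (x + 1))) (RAt (reg (x + 2)))) \<le> F * (tm F e + 40) + 20"
                  by (simp add: algebra_simps)
              qed
              fix s8 assume 8: "?I ?N s8"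
              then have "okst s8 \<sigma> V" using EIter.prems okst_frm Vx by blast
              then show "runs ?c6 s8 39 ?Q"
                using 8 px by (intro runs_RAssign)
                   (auto simp: okst_def frm_def f_def A_def)
            qed simp
          qed simp
        qed simp
      qed simp
    qed simp
  qed simp
qed

end

section \<open>Rays approximating the rows of a matrix\<close>

text \<open>The parallel axis identity: as a function of \<open>z\<close> the left side is a
  quadratic with leading coefficient \<open>\<Sum>i\<in>S. (w i)\<^sup>2\<close> and vertex at the
  weighted mean \<open>v\<close>.\<close>

lemma sum_square_weighted_mean:
  fixes a w :: "'i \<Rightarrow> real"
  assumes W: "(\<Sum>i\<in>S. (w i)\<^sup>2) \<noteq> 0"
    and v: "v = (\<Sum>i\<in>S. w i * a i) / (\<Sum>i\<in>S. (w i)\<^sup>2)"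
  shows "(\<Sum>i\<in>S. (a i - w i * z)\<^sup>2) = (\<Sum>i\<in>S. (a i - w i * v)\<^sup>2) + (\<Sum>i\<in>S. (w i)\<^sup>2) * (z - v)\<^sup>2"
proof -
  let ?W = "\<Sum>i\<in>S. (w i)\<^sup>2" and ?P = "\<Sum>i\<in>S. w i * a i"
  have *: "(\<Sum>i\<in>S. (a i - w i * z)\<^sup>2) = (\<Sum>i\<in>S. (a i)\<^sup>2) - 2 * z * ?P + z\<^sup>2 * ?W" for z
    by (simp add: power2_eq_square algebra_simps sum.distrib sum_subtractf sum_distrib_left)
  have P: "?P = v * ?W" using W v by simp
  show ?thesis unfolding * P by (simp add: power2_eq_square algebra_simps)
qed

text \<open>For a unit vector \<open>w\<close> the vertex is the inner product of \<open>w\<close>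
  and \<open>a\<close>, so orthogonal projection is least squares.\<close>

lemma sum_square_projection_le:
  fixes a w :: "'i \<Rightarrow> real"
  assumes "(\<Sum>i\<in>S. (w i)\<^sup>2) = 1"
  shows "(\<Sum>i\<in>S. (a i - w i * (\<Sum>i\<in>S. w i * a i))\<^sup>2) \<le> (\<Sum>i\<in>S. (a i - w i * z)\<^sup>2)"
  using sum_square_weighted_mean[of w S "\<Sum>i\<in>S. w i * a i" a z] assms by simp

lemma exists_le_weighted_average:
  fixes f p :: "'i \<Rightarrow> real"
  assumes "finite S" "S \<noteq> {}" "\<And>i. i \<in> S \<Longrightarrow> 0 < p i"
    and "(\<Sum>i\<in>S. p i * f i) \<le> (\<Sum>i\<in>S. p i) * c"
  shows "\<exists>i\<in>S. f i \<le> c"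
proof (rule ccontr)
  assume "\<not> ?thesis"
  then have "(\<Sum>i\<in>S. p i * c) < (\<Sum>i\<in>S. p i * f i)"
    using assms by (intro sum_strict_mono) auto
  then show False using assms(4) by (simp add: sum_distrib_right)
qed

text \<open>Maurey's argument made greedy: choosing each sample to do at least as well as the
  average keeps the squared error of the partial sums linear in their length.\<close>

lemma exists_samples:
  fixes a :: "'i \<Rightarrow> nat \<Rightarrow> real" and w :: "'i \<Rightarrow> real"
  assumes S: "finite S" "S \<noteq> {}" and w: "\<And>i. i \<in> S \<Longrightarrow> 0 < w i"
    and W: "W = (\<Sum>i\<in>S. (w i)\<^sup>2)"
    and v: "\<And>l. v l = (\<Sum>i\<in>S. w i * a i l) / W"
    and E: "E = (\<Sum>i\<in>S. \<Sum>l<n. (a i l - w i * v l)\<^sup>2)"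
  shows "\<exists>R. (\<forall>s. R s \<in> S) \<and> (\<Sum>l<n. (\<Sum>s<m. a (R s) l / w (R s) - v l)\<^sup>2) \<le> real m * (E / W)"
proof (induction m)
  case 0
  obtain i where "i \<in> S" using S by blast
  then show ?case by (intro exI[of _ "\<lambda>_. i"]) simp
next
  case (Suc m)
  then obtain R where R: "\<forall>s. R s \<in> S"
    and le: "(\<Sum>l<n. (\<Sum>s<m. a (R s) l / w (R s) - v l)\<^sup>2) \<le> real m * (E / W)" by blast
  define Y where "Y l = (\<Sum>s<m. a (R s) l / w (R s) - v l)" for l
  have W0: "0 < W" unfolding W by (intro sum_pos zero_less_power S w)
  \<comment> \<open>Expand the square around \<open>Y l\<close>. The mixed term is a multiple of
    \<open>(\<Sum>i\<in>S. w i * a i l) - W * v l\<close>, which vanishes by the choice of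
    \<open>v\<close>.\<close>
  have *: "(\<Sum>i\<in>S. (w i)\<^sup>2 * (Y l + (a i l / w i - v l))\<^sup>2)
      = W * (Y l)\<^sup>2 + (\<Sum>i\<in>S. (a i l - w i * v l)\<^sup>2)" for l
  proof -
    have "(\<Sum>i\<in>S. (w i)\<^sup>2 * (Y l + (a i l / w i - v l))\<^sup>2)
      = (\<Sum>i\<in>S. (w i)\<^sup>2 * (Y l)\<^sup>2 + 2 * Y l * (w i * a i l - (w i)\<^sup>2 * v l) + (a i l - w i * v l)\<^sup>2)"
    proof (rule sum.cong[OF refl])
      fix i assume "i \<in> S"
      then have "w i \<noteq> 0" using w by force
      then show "(w i)\<^sup>2 * (Y l + (a i l / w i - v l))\<^sup>2
        = (w i)\<^sup>2 * (Y l)\<^sup>2 + 2 * Y l * (w i * a i l - (w i)\<^sup>2 * v l) + (a i l - w i * v l)\<^sup>2"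
        by (simp add: power2_eq_square field_simps)
    qed
    also have "\<dots> = W * (Y l)\<^sup>2 + 2 * Y l * ((\<Sum>i\<in>S. w i * a i l) - W * v l)
       + (\<Sum>i\<in>S. (a i l - w i * v l)\<^sup>2)"
      unfolding W by (simp add: sum.distrib sum_subtractf flip: sum_distrib_left sum_distrib_right)
    finally show ?thesis using v[of l] W0 by simp
  qed
  have "(\<Sum>i\<in>S. (w i)\<^sup>2 * (\<Sum>l<n. (Y l + (a i l / w i - v l))\<^sup>2))
      = (\<Sum>l<n. \<Sum>i\<in>S. (w i)\<^sup>2 * (Y l + (a i l / w i - v l))\<^sup>2)"
    unfolding sum_distrib_left by (rule sum.swap)
  also have "\<dots> = W * (\<Sum>l<n. (Y l)\<^sup>2) + E"
    unfolding * E by (simp add: sum.distrib flip: sum_distrib_left) (rule sum.swap)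
  also have "\<dots> = W * ((\<Sum>l<n. (Y l)\<^sup>2) + E / W)" using W0 by (simp add: field_simps)
  finally have "(\<Sum>i\<in>S. (w i)\<^sup>2 * (\<Sum>l<n. (Y l + (a i l / w i - v l))\<^sup>2))
      \<le> (\<Sum>i\<in>S. (w i)\<^sup>2) * ((\<Sum>l<n. (Y l)\<^sup>2) + E / W)" unfolding W by simp
  from exists_le_weighted_average[OF S zero_less_power[OF w] this]
  obtain i where i: "i \<in> S"
    "(\<Sum>l<n. (Y l + (a i l / w i - v l))\<^sup>2) \<le> (\<Sum>l<n. (Y l)\<^sup>2) + E / W" by auto
  have "(\<Sum>s<m. a ((R(m := i)) s) l / w ((R(m := i)) s) - v l) = Y l" for l
    unfolding Y_def by (intro sum.cong) auto
  then have "(\<Sum>l<n. (\<Sum>s<Suc m. a ((R(m := i)) s) l / w ((R(m := i)) s) - v l)\<^sup>2)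
      = (\<Sum>l<n. (Y l + (a i l / w i - v l))\<^sup>2)" by simp
  also have "\<dots> \<le> real (Suc m) * (E / W)"
    using i(2) le unfolding Y_def by (simp add: algebra_simps)
  finally show ?case using R i(1) by (intro exI[of _ "R(m := i)"]) auto
qed

text \<open>By the parallel axis identity a direction \<open>y\<close> costs \<open>E\<close> plus
  \<open>W\<close> times its squared distance to the optimum \<open>v\<close>. The average of
  \<open>m\<close> samples has squared distance at most \<open>E / (W * m)\<close>, so it exceeds
  the optimal cost \<open>E\<close> by at most \<open>E / m\<close>.\<close>

lemma exists_samples_cost:
  fixes a :: "'i \<Rightarrow> nat \<Rightarrow> real" and w :: "'i \<Rightarrow> real" and z :: "nat \<Rightarrow> real"
  assumes S: "finite S" "S \<noteq> {}" and w: "\<And>i. i \<in> S \<Longrightarrow> 0 < w i" and m: "0 < m"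
  shows "\<exists>R. (\<forall>s. R s \<in> S) \<and>
    (\<Sum>i\<in>S. \<Sum>l<n. (a i l - w i * ((\<Sum>s<m. a (R s) l / w (R s)) / real m))\<^sup>2)
      \<le> (1 + 1 / real m) * (\<Sum>i\<in>S. \<Sum>l<n. (a i l - w i * z l)\<^sup>2)"
proof -
  define W where "W = (\<Sum>i\<in>S. (w i)\<^sup>2)"
  define v where "v l = (\<Sum>i\<in>S. w i * a i l) / W" for l
  define E where "E = (\<Sum>i\<in>S. \<Sum>l<n. (a i l - w i * v l)\<^sup>2)"
  have W0: "0 < W" unfolding W_def by (intro sum_pos zero_less_power S w)
  obtain R where R: "\<forall>s. R s \<in> S"
    and le: "(\<Sum>l<n. (\<Sum>s<m. a (R s) l / w (R s) - v l)\<^sup>2) \<le> real m * (E / W)"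
    using exists_samples[where w=w and a=a and m=m and n=n, OF S w W_def v_def E_def] by blast
  have cost: "(\<Sum>i\<in>S. \<Sum>l<n. (a i l - w i * y l)\<^sup>2) = E + W * (\<Sum>l<n. (y l - v l)\<^sup>2)" for y
  proof -
    have "(\<Sum>i\<in>S. \<Sum>l<n. (a i l - w i * y l)\<^sup>2) = (\<Sum>l<n. \<Sum>i\<in>S. (a i l - w i * y l)\<^sup>2)"
      by (rule sum.swap)
    also have "\<dots> = (\<Sum>l<n. (\<Sum>i\<in>S. (a i l - w i * v l)\<^sup>2) + W * (y l - v l)\<^sup>2)"
      unfolding W_def using W0
      by (intro sum.cong refl sum_square_weighted_mean) (auto simp: v_def W_def)
    finally show ?thesis
      unfolding E_def by (simp add: sum.distrib flip: sum_distrib_left) (rule sum.swap)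
  qed
  have "(\<Sum>l<n. ((\<Sum>s<m. a (R s) l / w (R s)) / real m - v l)\<^sup>2)
     = (\<Sum>l<n. ((\<Sum>s<m. a (R s) l / w (R s) - v l) / real m)\<^sup>2)"
    using m by (simp add: sum_subtractf diff_divide_distrib)
  also have "\<dots> = (\<Sum>l<n. (\<Sum>s<m. a (R s) l / w (R s) - v l)\<^sup>2) / (real m)\<^sup>2"
    by (simp only: power_divide sum_divide_distrib[symmetric])
  also have "\<dots> \<le> (real m * (E / W)) / (real m)\<^sup>2"
    by (rule divide_right_mono[OF le]) simp
  also have "\<dots> = E / W / real m" using m by (simp add: power2_eq_square)
  finally have "W * (\<Sum>l<n. ((\<Sum>s<m. a (R s) l / w (R s)) / real m - v l)\<^sup>2) \<le> W * (E / W / real m)"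
    using W0 by (intro mult_left_mono) auto
  then have "W * (\<Sum>l<n. ((\<Sum>s<m. a (R s) l / w (R s)) / real m - v l)\<^sup>2) \<le> E / real m"
    using W0 by simp
  then have "(\<Sum>i\<in>S. \<Sum>l<n. (a i l - w i * ((\<Sum>s<m. a (R s) l / w (R s)) / real m))\<^sup>2)
      \<le> (1 + 1 / real m) * E"
    unfolding cost by (simp add: algebra_simps)
  also have "\<dots> \<le> (1 + 1 / real m) * (\<Sum>i\<in>S. \<Sum>l<n. (a i l - w i * z l)\<^sup>2)"
    unfolding cost[of z] using W0
    by (intro mult_left_mono) (auto intro!: mult_nonneg_nonneg sum_nonneg)
  finally show ?thesis using R by blast
qed

section \<open>A positive cost of integral rows is bounded away from zero\<close>

lemma Ints_sum_square_ge_1: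
  fixes x :: "nat \<Rightarrow> real"
  assumes "\<And>l. l < n \<Longrightarrow> x l \<in> \<int>" "\<exists>l<n. x l \<noteq> 0"
  shows "1 \<le> (\<Sum>l<n. (x l)\<^sup>2)"
proof -
  have I: "(\<Sum>l<n. (x l)\<^sup>2) \<in> \<int>" using assms(1) by (intro Ints_sum Ints_power) auto
  have "(\<Sum>l<n. (x l)\<^sup>2) \<noteq> 0" using assms(2) by (auto simp: sum_nonneg_eq_0_iff)
  from Ints_nonzero_abs_ge1[OF I this] show ?thesis by (simp add: sum_nonneg)
qed

text \<open>The form \<open>Q(\<beta>, -\<alpha>) = \<parallel>\<beta>x - \<alpha>y\<parallel>\<^sup>2\<close> has a positive integral determinant, or no mixed term
  of the wrong sign, hence it is bounded below by determinant over trace.\<close>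

lemma integral_rays_gap:
  fixes x y z :: "nat \<Rightarrow> real"
  assumes x: "\<And>l. l < n \<Longrightarrow> x l \<in> \<int>" and y: "\<And>l. l < n \<Longrightarrow> y l \<in> \<int>"
    and x0: "\<exists>l<n. x l \<noteq> 0"
    and par: "\<not> (\<exists>c\<ge>0. \<forall>l<n. y l = c * x l)"
    and \<alpha>: "0 \<le> \<alpha>" and \<beta>: "0 \<le> \<beta>"
  shows "1 \<le> ((\<Sum>l<n. (x l)\<^sup>2) + (\<Sum>l<n. (y l)\<^sup>2)) *
    ((\<Sum>l<n. (x l - \<alpha> * z l)\<^sup>2) + (\<Sum>l<n. (y l - \<beta> * z l)\<^sup>2))"
proof -
  define X where "X = (\<Sum>l<n. (x l)\<^sup>2)"
  define Y where "Y = (\<Sum>l<n. (y l)\<^sup>2)"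
  define c where "c = (\<Sum>l<n. x l * y l)"
  define E where "E = (\<Sum>l<n. (x l - \<alpha> * z l)\<^sup>2) + (\<Sum>l<n. (y l - \<beta> * z l)\<^sup>2)"
  define T where "T = \<alpha>\<^sup>2 + \<beta>\<^sup>2"
  define Q where "Q = \<beta>\<^sup>2 * X - 2 * \<alpha> * \<beta> * c + \<alpha>\<^sup>2 * Y"
  have y0: "\<exists>l<n. y l \<noteq> 0" using par by (metis mult_zero_left order_refl)
  have X1: "1 \<le> X" unfolding X_def using x x0 by (rule Ints_sum_square_ge_1)
  have Y1: "1 \<le> Y" unfolding Y_def using y y0 by (rule Ints_sum_square_ge_1)
  have "1 \<le> (X + Y) * E"
  proof (cases "T = 0")
    case True
    then have "\<alpha> = 0" "\<beta> = 0" unfolding T_def by (auto simp: add_nonneg_eq_0_iff)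
    then have "E = X + Y" unfolding E_def X_def Y_def by simp
    moreover have "1 * 1 \<le> (X + Y) * (X + Y)" using X1 Y1 by (intro mult_mono) auto
    ultimately show ?thesis by simp
  next
    case False
    then have T0: "0 < T" unfolding T_def by (simp add: less_le)
    have sq: "(\<Sum>l<n. (p * x l - q * y l)\<^sup>2) = p\<^sup>2 * X - 2 * q * p * c + q\<^sup>2 * Y" for p q
      unfolding X_def Y_def c_def
      by (simp add: power2_eq_square algebra_simps sum.distrib sum_subtractf sum_distrib_left)
    have "Q = (\<Sum>l<n. (\<beta> * x l - \<alpha> * y l)\<^sup>2)"
      unfolding Q_def sq ..
    \<comment> \<open>Since \<open>\<beta> * x l - \<alpha> * y l\<close> equals \<open>\<beta> * (x
      l - \<alpha> * z l) - \<alpha> * (y l - \<beta> * z l)\<close>, the unknown direction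
      \<open>z\<close> cancels. The bound is then Cauchy-Schwarz, with the defect written as a
      square.\<close>
    also have "\<dots> \<le> (\<Sum>l<n. T * ((x l - \<alpha> * z l)\<^sup>2 + (y l - \<beta> * z l)\<^sup>2))"
    proof (rule sum_mono)
      fix l
      have "T * ((x l - \<alpha> * z l)\<^sup>2 + (y l - \<beta> * z l)\<^sup>2) - (\<beta> * x l - \<alpha> * y l)\<^sup>2
        = (\<alpha> * (x l - \<alpha> * z l) + \<beta> * (y l - \<beta> * z l))\<^sup>2"
        unfolding T_def by (simp add: power2_eq_square algebra_simps)
      then show "(\<beta> * x l - \<alpha> * y l)\<^sup>2 \<le> T * ((x l - \<alpha> * z l)\<^sup>2 + (y l - \<beta> * z l)\<^sup>2)"
        by (metis diff_ge_0_iff_ge zero_le_power2)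
    qed
    also have "\<dots> = T * E" unfolding E_def by (simp add: sum_distrib_left sum.distrib distrib_left)
    finally have QE: "Q \<le> T * E" .
    have TQ: "T \<le> (X + Y) * Q"
    \<comment> \<open>If the angle is not acute, the mixed term of \<open>Q\<close> is nonnegative
      and \<open>X\<close>, \<open>Y\<close> being at least 1 already gives
      \<open>T \<le> Q\<close>. For an acute angle the Gram determinant does the work.\<close>
    proof (cases "c \<le> 0")
      case True
      have "1 * T \<le> (X + Y) * T" using X1 Y1 T0 by (intro mult_right_mono) auto
      also have "T \<le> Q"
      proof -
        have "\<beta>\<^sup>2 * 1 \<le> \<beta>\<^sup>2 * X" "\<alpha>\<^sup>2 * 1 \<le> \<alpha>\<^sup>2 * Y" using X1 Y1 by (intro mult_left_mono; simp)+
        moreover have "\<alpha> * \<beta> * c \<le> 0" using True \<alpha> \<beta> by (simp add: mult_nonneg_nonpos)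
        ultimately show ?thesis unfolding Q_def T_def by simp
      qed
      then have "(X + Y) * T \<le> (X + Y) * Q" using X1 Y1 by (intro mult_left_mono) auto
      finally show ?thesis by simp
    next
      case False
      define G where "G = X * Y - c\<^sup>2"
      have XG: "X * G = (\<Sum>l<n. (c * x l - X * y l)\<^sup>2)"
        unfolding sq G_def by (simp add: power2_eq_square algebra_simps)
      \<comment> \<open>\<open>X * G\<close> is a squared length, so \<open>G = 0\<close> would make
        \<open>y\<close> the multiple \<open>c / X\<close> of \<open>x\<close>. In this case the
        factor is nonnegative, which \<open>par\<close> rules out.\<close>
      have "G \<noteq> 0"
      proof
        assume "G = 0"
        then have "\<forall>l<n. c * x l - X * y l = 0" using XG by (simp add: sum_nonneg_eq_0_iff)
        then have "\<forall>l<n. y l = (c / X) * x l" using X1 by (auto simp: field_simps)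
        moreover have "0 \<le> c / X" using False X1 by simp
        ultimately show False using par by blast
      qed
      moreover have "0 \<le> X * G" unfolding XG by (simp add: sum_nonneg)
      ultimately have "0 < G" using X1 by (simp add: zero_le_mult_iff)
      moreover have "G \<in> \<int>" unfolding G_def X_def Y_def c_def using x y
        by (intro Ints_diff Ints_mult Ints_power Ints_sum) auto
      ultimately have "1 \<le> G" using Ints_nonzero_abs_ge1[of G] by simp
      then have "1 * T \<le> G * T" using T0 by (intro mult_right_mono) auto
      also have "\<dots> \<le> (X + Y) * Q"
      proof -
        \<comment> \<open>Cayley-Hamilton for the Gram matrix with entries \<open>X\<close>,
          \<open>c\<close>, \<open>c\<close>, \<open>Y\<close>, applied to the vector
          \<open>(\<beta>, -\<alpha>)\<close>: the squared length of its image is trace times the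
          quadratic form minus determinant times its squared length.\<close>
        have "(X + Y) * Q - G * T = (X * \<beta> - c * \<alpha>)\<^sup>2 + (c * \<beta> - Y * \<alpha>)\<^sup>2"
          unfolding Q_def G_def T_def by (simp add: power2_eq_square algebra_simps)
        then show ?thesis by (smt (verit) zero_le_power2)
      qed
      finally show ?thesis by simp
    qed
    also have "\<dots> \<le> (X + Y) * (T * E)" using QE X1 Y1 by (intro mult_left_mono) auto
    finally have "T * 1 \<le> T * ((X + Y) * E)" by (simp add: algebra_simps)
    then show ?thesis using T0 by simp
  qed
  then show ?thesis unfolding X_def Y_def E_def .
qed

section \<open>Rounding the weights, and good samples for one cluster\<close>

lemma power2_diff_le_weighted:
  fixes r t \<theta> :: real
  assumes "0 < \<theta>"
  shows "(r - t)\<^sup>2 \<le> (1 + \<theta>) * r\<^sup>2 + (1 + 1 / \<theta>) * t\<^sup>2"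
proof -
  have "(1 + \<theta>) * r\<^sup>2 + (1 + 1 / \<theta>) * t\<^sup>2 - (r - t)\<^sup>2 = (\<theta> * r + t)\<^sup>2 / \<theta>"
    using assms by (simp add: power2_eq_square field_simps)
  also have "0 \<le> \<dots>" using assms by simp
  finally show ?thesis by simp
qed

text \<open>Rounding \<open>real B * u i\<close> up moves the weight \<open>w i / real B\<close> by
  at most \<open>1 / real B\<close>. The preceding weighted inequality separates this perturbation
  from the original error; at most \<open>d\<close> rows pay for it. The scale \<open>B\<close> is
  moved into the direction, so that the weights are integers.\<close>

lemma rounded_weights_cost:
  fixes a :: "'i \<Rightarrow> nat \<Rightarrow> real" and u :: "'i \<Rightarrow> real" and v :: "nat \<Rightarrow> real" and B :: nat
  assumes S: "finite S" "card S \<le> d" and \<theta>: "0 < \<theta>" and B: "0 < B"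
    and w: "\<And>i. i \<in> S \<Longrightarrow> w i = of_int \<lceil>real B * u i\<rceil>"
  shows "(\<Sum>i\<in>S. \<Sum>l<n. (a i l - w i * (v l / real B))\<^sup>2)
    \<le> (1 + \<theta>) * (\<Sum>i\<in>S. \<Sum>l<n. (a i l - u i * v l)\<^sup>2)
      + (1 + 1 / \<theta>) * (real d * (\<Sum>l<n. (v l)\<^sup>2) / (real B)\<^sup>2)"
proof -
  have "(\<Sum>i\<in>S. \<Sum>l<n. (a i l - w i * (v l / real B))\<^sup>2)
    \<le> (\<Sum>i\<in>S. \<Sum>l<n. (1 + \<theta>) * (a i l - u i * v l)\<^sup>2 + (1 + 1 / \<theta>) * ((v l)\<^sup>2 / (real B)\<^sup>2))"
  proof (intro sum_mono)
    fix i l assume i: "i \<in> S"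
    define \<eta> where "\<eta> = w i / real B - u i"
    have "\<bar>w i - real B * u i\<bar> \<le> 1" unfolding w[OF i] by linarith
    then have "\<bar>\<eta>\<bar> \<le> 1 / real B" unfolding \<eta>_def using B by (simp add: abs_le_iff field_simps)
    then have "\<eta>\<^sup>2 \<le> (1 / real B)\<^sup>2" by (rule abs_le_square_iff[THEN iffD1, OF order_trans]) simp
    then have \<eta>: "(\<eta> * v l)\<^sup>2 \<le> (v l)\<^sup>2 / (real B)\<^sup>2"
      using mult_right_mono[of "\<eta>\<^sup>2" "(1 / real B)\<^sup>2" "(v l)\<^sup>2"]
      by (simp add: power_mult_distrib power_divide)
    have "a i l - w i * (v l / real B) = (a i l - u i * v l) - \<eta> * v l"
      unfolding \<eta>_def by (simp add: algebra_simps)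
    then have "(a i l - w i * (v l / real B))\<^sup>2
        \<le> (1 + \<theta>) * (a i l - u i * v l)\<^sup>2 + (1 + 1 / \<theta>) * (\<eta> * v l)\<^sup>2"
      by (simp only: power2_diff_le_weighted[OF \<theta>])
    also have "\<dots> \<le> (1 + \<theta>) * (a i l - u i * v l)\<^sup>2 + (1 + 1 / \<theta>) * ((v l)\<^sup>2 / (real B)\<^sup>2)"
      using \<eta> \<theta> by (intro add_left_mono mult_left_mono) auto
    finally show "(a i l - w i * (v l / real B))\<^sup>2
        \<le> (1 + \<theta>) * (a i l - u i * v l)\<^sup>2 + (1 + 1 / \<theta>) * ((v l)\<^sup>2 / (real B)\<^sup>2)" .
  qed
  also have "\<dots> = (1 + \<theta>) * (\<Sum>i\<in>S. \<Sum>l<n. (a i l - u i * v l)\<^sup>2)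
      + (1 + 1 / \<theta>) * (real (card S) * (\<Sum>l<n. (v l)\<^sup>2) / (real B)\<^sup>2)"
    by (simp add: sum.distrib flip: sum_distrib_left sum_divide_distrib)
  also have "\<dots> \<le> (1 + \<theta>) * (\<Sum>i\<in>S. \<Sum>l<n. (a i l - u i * v l)\<^sup>2)
      + (1 + 1 / \<theta>) * (real d * (\<Sum>l<n. (v l)\<^sup>2) / (real B)\<^sup>2)"
    using S \<theta> by (intro add_left_mono mult_left_mono divide_right_mono mult_right_mono)
      (auto intro: sum_nonneg)
  finally show ?thesis .
qed

lemma sum_two_le:
  fixes f :: "'i \<Rightarrow> real"
  assumes "finite S" "i \<in> S" "j \<in> S" "i \<noteq> j" "\<And>i. i \<in> S \<Longrightarrow> 0 \<le> f i"
  shows "f i + f j \<le> sum f S"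
proof -
  have "f i + f j = sum f {i, j}" using assms by simp
  also have "\<dots> \<le> sum f S" using assms by (intro sum_mono2) auto
  finally show ?thesis .
qed

text \<open>Rounding costs an additive error, which a cluster of cost zero cannot absorb. If the
  rows lie on a common ray, copies of one row with weight 1 reproduce it exactly; otherwise the cost
  is at least \<open>1 / A\<close> and the error becomes relative. The clause on
  \<open>c (R 0)\<close> provides the coefficient with which the first sample is later forced into
  the cluster.\<close>

lemma cluster_samples:
  fixes a :: "nat \<Rightarrow> nat \<Rightarrow> real" and u v :: "nat \<Rightarrow> real" and d n m B :: nat
  assumes int: "\<And>i l. i < d \<Longrightarrow> l < n \<Longrightarrow> a i l \<in> \<int>"
    and S: "S \<subseteq> {..<d}" "S \<noteq> {}"
    and u: "\<And>i. i \<in> S \<Longrightarrow> 0 < u i" "(\<Sum>i\<in>S. (u i)\<^sup>2) = 1"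
    and v: "\<And>l. v l = (\<Sum>i\<in>S. u i * a i l)"
    and \<epsilon>: "0 < \<epsilon>" "\<epsilon> < 1"
    and B: "1 \<le> B" "5 * real d * (\<Sum>i<d. \<Sum>l<n. (a i l)\<^sup>2) / \<epsilon> \<le> real B"
    and m: "0 < m" "4 / \<epsilon> \<le> real m"
  shows "\<exists>R (w :: nat \<Rightarrow> nat) c. (\<forall>s. R s \<in> S) \<and> (\<forall>s. 1 \<le> w s \<and> w s \<le> B) \<and> (\<forall>i\<in>S. 0 \<le> c i) \<and>
    c (R 0) = real (w 0) \<and>
    (\<Sum>i\<in>S. \<Sum>l<n. (a i l - c i * ((\<Sum>s<m. a (R s) l / real (w s)) / real m))\<^sup>2)
      \<le> (1 + \<epsilon>) * (\<Sum>i\<in>S. \<Sum>l<n. (a i l - u i * v l)\<^sup>2)"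
proof (cases "\<exists>i0\<in>S. \<forall>i\<in>S. \<exists>c\<ge>0. \<forall>l<n. a i l = c * a i0 l")
  case True
  then obtain i0 where i0: "i0 \<in> S" and "\<forall>i\<in>S. \<exists>c\<ge>0. \<forall>l<n. a i l = c * a i0 l" by blast
  then obtain c where c: "\<And>i. i \<in> S \<Longrightarrow> 0 \<le> c i \<and> (\<forall>l<n. a i l = c i * a i0 l)" by metis
  \<comment> \<open>The first sample must have coefficient \<open>w 0 = 1\<close>. The factor
    \<open>c i0\<close> may be different from 1 when the row \<open>i0\<close> is zero.\<close>
  define c' where "c' = c(i0 := 1)"
  have "(\<Sum>i\<in>S. \<Sum>l<n. (a i l - c' i * ((\<Sum>s<m. a i0 l / real (1::nat)) / real m))\<^sup>2) = 0"
  proof (intro sum.neutral ballI)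
    fix i l assume "i \<in> S" "l \<in> {..<n}"
    then have "a i l = c i * a i0 l" using c by blast
    then show "(a i l - c' i * ((\<Sum>s<m. a i0 l / real (1::nat)) / real m))\<^sup>2 = 0"
      using m(1) by (cases "i = i0") (simp_all add: c'_def)
  qed
  moreover have "0 \<le> (1 + \<epsilon>) * (\<Sum>i\<in>S. \<Sum>l<n. (a i l - u i * v l)\<^sup>2)"
    using \<epsilon> by (intro mult_nonneg_nonneg sum_nonneg) auto
  moreover have "\<forall>i\<in>S. 0 \<le> c' i" using c by (auto simp: c'_def)
  ultimately show ?thesis using i0 B(1)
    by (intro exI[of _ "\<lambda>_. i0"] exI[of _ "\<lambda>_. 1::nat"] exI[of _ c']) (auto simp: c'_def)
next
  case False
  have fin: "finite S" using S finite_subset by blast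
  have cS: "card S \<le> d" using card_mono[OF _ S(1)] by simp
  define A where "A = (\<Sum>i<d. \<Sum>l<n. (a i l)\<^sup>2)"
  define E where "E = (\<Sum>i\<in>S. \<Sum>l<n. (a i l - u i * v l)\<^sup>2)"
  have E0: "0 \<le> E" unfolding E_def by (intro sum_nonneg) auto
  obtain i0 where i0: "i0 \<in> S" "\<exists>l<n. a i0 l \<noteq> 0"
  proof (rule ccontr)
    assume "\<not> thesis"
    then have "\<forall>i\<in>S. \<forall>l<n. a i l = 0" using that by blast
    then have "\<forall>i0\<in>S. \<forall>i\<in>S. 0 \<le> (0::real) \<and> (\<forall>l<n. a i l = 0 * a i0 l)" by simp
    then have "\<exists>i0\<in>S. \<forall>i\<in>S. \<exists>c\<ge>0. \<forall>l<n. a i l = c * a i0 l" using S(2) by blast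
    then show False using False by blast
  qed
  with False obtain i1 where i1: "i1 \<in> S" "\<not> (\<exists>c\<ge>0. \<forall>l<n. a i1 l = c * a i0 l)" by blast
  have ne: "i0 \<noteq> i1"
  proof
    assume "i0 = i1"
    then have "(0::real) \<le> 1 \<and> (\<forall>l<n. a i1 l = 1 * a i0 l)" by simp
    then show False using i1(2) by blast
  qed
  have "1 \<le> ((\<Sum>l<n. (a i0 l)\<^sup>2) + (\<Sum>l<n. (a i1 l)\<^sup>2)) *
    ((\<Sum>l<n. (a i0 l - u i0 * v l)\<^sup>2) + (\<Sum>l<n. (a i1 l - u i1 * v l)\<^sup>2))"
  proof (rule integral_rays_gap)
    show "0 \<le> u i0" "0 \<le> u i1" using i0 i1 u(1) by (auto intro: less_imp_le)
    show "a i0 l \<in> \<int>" "a i1 l \<in> \<int>" if "l < n" for l using that i0 i1 S int by auto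
  qed (fact i0(2), fact i1(2))
  also have "\<dots> \<le> A * E"
  proof (rule mult_mono)
    show "(\<Sum>l<n. (a i0 l)\<^sup>2) + (\<Sum>l<n. (a i1 l)\<^sup>2) \<le> A" unfolding A_def
      by (rule sum_two_le[where f="\<lambda>i. \<Sum>l<n. (a i l)\<^sup>2"]) (use i0 i1 ne S in \<open>auto intro: sum_nonneg\<close>)
    show "(\<Sum>l<n. (a i0 l - u i0 * v l)\<^sup>2) + (\<Sum>l<n. (a i1 l - u i1 * v l)\<^sup>2) \<le> E" unfolding E_def
      by (rule sum_two_le[where f="\<lambda>i. \<Sum>l<n. (a i l - u i * v l)\<^sup>2"])
        (use i0 i1 ne fin in \<open>auto intro: sum_nonneg\<close>)
  qed (auto simp: A_def intro!: sum_nonneg add_nonneg_nonneg)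
  finally have AE: "1 \<le> A * E" .
  have A0: "0 < A"
  proof (rule ccontr)
    assume "\<not> 0 < A"
    then have "A * E \<le> 0" using E0 by (intro mult_nonpos_nonneg) auto
    then show False using AE by simp
  qed
  have d0: "0 < d" using S by auto
  have V: "(\<Sum>l<n. (v l)\<^sup>2) \<le> A"
  proof -
    have "(\<Sum>l<n. (v l)\<^sup>2) \<le> (\<Sum>l<n. \<Sum>i\<in>S. (a i l)\<^sup>2)"
    proof (rule sum_mono)
      fix l
      \<comment> \<open>The parallel axis identity at the origin bounds the length of a
        projection.\<close>
      have "(\<Sum>i\<in>S. (a i l - u i * 0)\<^sup>2) = (\<Sum>i\<in>S. (a i l - u i * v l)\<^sup>2) + (\<Sum>i\<in>S. (u i)\<^sup>2) * (0 - v l)\<^sup>2"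
        by (rule sum_square_weighted_mean) (use u v in auto)
      then show "(v l)\<^sup>2 \<le> (\<Sum>i\<in>S. (a i l)\<^sup>2)" using u(2) by (simp add: sum_nonneg)
    qed
    also have "\<dots> = (\<Sum>i\<in>S. \<Sum>l<n. (a i l)\<^sup>2)" by (rule sum.swap)
    also have "\<dots> \<le> A" unfolding A_def using S by (intro sum_mono2) (auto intro: sum_nonneg)
    finally show ?thesis .
  qed
  \<comment> \<open>Rounding up keeps every weight at least 1, so that it can serve as a divisor;
    \<open>u i \<le> 1\<close> keeps it at most \<open>B\<close>.\<close>
  define w where "w i = nat \<lceil>real B * u i\<rceil>" for i
  have u1: "u i \<le> 1" if "i \<in> S" for i
  proof -
    have "(u i)\<^sup>2 \<le> 1" using member_le_sum[OF that _ fin, of "\<lambda>i. (u i)\<^sup>2"] u(2) by simp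
    then show ?thesis using power2_le_imp_le[of "u i" 1] by simp
  qed
  have w: "real (w i) = of_int \<lceil>real B * u i\<rceil>" "1 \<le> w i" "w i \<le> B" if "i \<in> S" for i
  proof -
    have pos: "0 < real B * u i" using B(1) u(1)[OF that] by simp
    then show "real (w i) = of_int \<lceil>real B * u i\<rceil>" "1 \<le> w i" unfolding w_def by linarith+
    have "real B * u i \<le> real B" using u1[OF that] by (simp add: mult_left_le)
    then show "w i \<le> B" unfolding w_def by linarith
  qed
  have "(\<Sum>i\<in>S. \<Sum>l<n. (a i l - real (w i) * (v l / real B))\<^sup>2)
    \<le> (1 + \<epsilon> / 4) * E + (1 + 1 / (\<epsilon> / 4)) * (real d * (\<Sum>l<n. (v l)\<^sup>2) / (real B)\<^sup>2)"
    unfolding E_def using \<epsilon> B(1) w fin cS by (intro rounded_weights_cost) auto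
  \<comment> \<open>Origin of the 5 in the bound on \<open>B\<close>: with
    \<open>\<theta> = \<epsilon> / 4\<close> the factor \<open>1 + 1 / \<theta>\<close> is at most
    \<open>5 / \<epsilon>\<close>. The additive term is then at most
    \<open>\<epsilon> / (5 * d * A)\<close>, and \<open>AE\<close> turns this into a share of
    \<open>E\<close>.\<close>
  also have "\<dots> \<le> (1 + \<epsilon> / 4) * E + \<epsilon> / 4 * E"
  proof -
    have e5: "1 + 1 / (\<epsilon> / 4) \<le> 5 / \<epsilon>" using \<epsilon> by (simp add: field_simps)
    have pos: "0 < 5 * real d * A / \<epsilon>" using \<epsilon> A0 d0 by simp
    have B2: "(5 * real d * A / \<epsilon>)\<^sup>2 \<le> (real B)\<^sup>2"
      using pos B(2)[folded A_def] by (intro power_mono) auto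
    have dA: "real d * (\<Sum>l<n. (v l)\<^sup>2) \<le> real d * A" using V by (intro mult_left_mono) auto
    have "real d * (\<Sum>l<n. (v l)\<^sup>2) / (real B)\<^sup>2 \<le> real d * A / (5 * real d * A / \<epsilon>)\<^sup>2"
    proof (rule frac_le[OF _ dA _ B2])
      show "0 \<le> real d * A" using A0 by simp
      show "0 < (5 * real d * A / \<epsilon>)\<^sup>2" using pos by (rule zero_less_power)
    qed
    then have "(1 + 1 / (\<epsilon> / 4)) * (real d * (\<Sum>l<n. (v l)\<^sup>2) / (real B)\<^sup>2)
      \<le> 5 / \<epsilon> * (real d * A / (5 * real d * A / \<epsilon>)\<^sup>2)"
      by (rule mult_mono[OF e5]) (use \<epsilon> in \<open>auto intro!: divide_nonneg_nonneg mult_nonneg_nonneg sum_nonneg\<close>)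
    also have "\<dots> = \<epsilon> / (5 * (real d * A))"
      using \<epsilon> A0 d0 by (simp add: power2_eq_square field_simps)
    also have "\<dots> \<le> \<epsilon> / (4 * A)"
    proof -
      have "4 * A \<le> 5 * (1 * A)" using A0 by simp
      also have "\<dots> \<le> 5 * (real d * A)" using d0 A0 by (intro mult_left_mono mult_right_mono) auto
      finally show ?thesis using \<epsilon> A0 by (intro divide_left_mono) (auto intro!: mult_pos_pos)
    qed
    also have "\<dots> \<le> \<epsilon> / 4 * E"
      using AE \<epsilon> A0 by (simp add: field_simps)
    finally show ?thesis by simp
  qed
  finally have r: "(\<Sum>i\<in>S. \<Sum>l<n. (a i l - real (w i) * (v l / real B))\<^sup>2) \<le> (1 + \<epsilon> / 2) * E"
    by (simp add: algebra_simps)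
  have w0: "0 < real (w i)" if "i \<in> S" for i using w(2)[OF that] by simp
  obtain R where R: "\<forall>s. R s \<in> S" and
    le: "(\<Sum>i\<in>S. \<Sum>l<n. (a i l - real (w i) * ((\<Sum>s<m. a (R s) l / real (w (R s))) / real m))\<^sup>2)
      \<le> (1 + 1 / real m) * (\<Sum>i\<in>S. \<Sum>l<n. (a i l - real (w i) * (v l / real B))\<^sup>2)"
    using exists_samples_cost[where a=a and n=n and z="\<lambda>l. v l / real B" and w="\<lambda>i. real (w i)", OF fin S(2) w0 m(1)]
    by blast
  note le
  also have "(1 + 1 / real m) * (\<Sum>i\<in>S. \<Sum>l<n. (a i l - real (w i) * (v l / real B))\<^sup>2)
     \<le> (1 + \<epsilon> / 4) * ((1 + \<epsilon> / 2) * E)"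
  proof (rule mult_mono[OF _ r])
    show "1 + 1 / real m \<le> 1 + \<epsilon> / 4" using m \<epsilon> by (simp add: field_simps)
  qed (use \<epsilon> in \<open>auto intro!: sum_nonneg\<close>)
  \<comment> \<open>The increments of the product are three quarters of \<open>\<epsilon>\<close>
    and one eighth of its square.\<close>
  also have "\<dots> \<le> (1 + \<epsilon>) * E"
  proof -
    have "\<epsilon> * \<epsilon> \<le> \<epsilon>" using \<epsilon> by (simp add: mult_left_le)
    then have "(1 + \<epsilon> / 4) * (1 + \<epsilon> / 2) \<le> 1 + \<epsilon>" using \<epsilon> by (simp add: field_simps)
    then have "(1 + \<epsilon> / 4) * (1 + \<epsilon> / 2) * E \<le> (1 + \<epsilon>) * E" using E0 by (rule mult_right_mono)
    then show ?thesis by (simp only: mult.assoc)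
  qed
  finally show ?thesis unfolding E_def using R w(2,3)
    by (intro exI[of _ R] exI[of _ "\<lambda>s. w (R s)"] exI[of _ "\<lambda>i. real (w i)"]) auto
qed

section \<open>Candidate solutions and their surrogate cost\<close>

lemma iter_argmin:
  fixes f :: "nat \<Rightarrow> 'a :: linorder"
  assumes "0 < k"
  shows "iter (\<lambda>j b. if f j < f b then j else b) k 0 < k \<and>
    (\<forall>j<k. f (iter (\<lambda>j b. if f j < f b then j else b) k 0) \<le> f j)"
  using assms
proof (induction k rule: nat_induct_non_zero)
  case 1
  then show ?case by simp
next
  case (Suc k)
  then show ?case by (auto simp: less_Suc_eq dest: less_imp_le order.strict_trans2)
qed

lemma ray_projection_le:
  fixes x v :: "nat \<Rightarrow> real" and n :: nat
  defines "p \<equiv> \<Sum>l<n. x l * v l" and "q \<equiv> \<Sum>l<n. (v l)\<^sup>2"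
  assumes c: "0 \<le> c"
  shows "(\<Sum>l<n. (x l - (if 0 < p then p / q else 0) * v l)\<^sup>2) \<le> (\<Sum>l<n. (x l - c * v l)\<^sup>2)"
proof -
  have sq: "(\<Sum>l<n. (x l - t * v l)\<^sup>2) = (\<Sum>l<n. (x l)\<^sup>2) - 2 * t * p + t\<^sup>2 * q" for t
    unfolding p_def q_def
    by (simp add: power2_eq_square algebra_simps sum.distrib sum_subtractf sum_distrib_left)
  have q0: "0 \<le> q" unfolding q_def by (simp add: sum_nonneg)
  show ?thesis
  proof (cases "0 < p")
    case True
    have "q \<noteq> 0"
    proof
      assume "q = 0"
      then have "\<forall>l<n. v l = 0" unfolding q_def by (simp add: sum_nonneg_eq_0_iff)
      then have "p = 0" unfolding p_def by simp
      then show False using True by simp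
    qed
    then have q1: "0 < q" using q0 by simp
    have "(- 2 * c * p + c\<^sup>2 * q) - (- 2 * (p / q) * p + (p / q)\<^sup>2 * q) = (c * q - p)\<^sup>2 / q"
      using q1 by (simp add: power2_eq_square field_simps)
    moreover have "0 \<le> (c * q - p)\<^sup>2 / q" using q1 by simp
    ultimately show ?thesis using True unfolding sq by simp
  next
    case False
    then have "0 \<le> - (c * p)" "0 \<le> c\<^sup>2 * q" using c q0 by (auto simp: mult_nonneg_nonpos)
    then show ?thesis using False unfolding sq by simp
  qed
qed

section \<open>Feasible matrices and their residual\<close>

lemma nonneg_orthonormalD:
  assumes "U \<in> nonneg_orthonormal d k"
  shows "U \<in> carrier_mat d k" "\<And>i j. i < d \<Longrightarrow> j < k \<Longrightarrow> 0 \<le> U $$ (i, j)"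
    "\<And>j j'. j < k \<Longrightarrow> j' < k \<Longrightarrow> (\<Sum>i<d. U $$ (i, j) * U $$ (i, j')) = (if j = j' then 1 else 0)"
proof -
  show U: "U \<in> carrier_mat d k" and "\<And>i j. i < d \<Longrightarrow> j < k \<Longrightarrow> 0 \<le> U $$ (i, j)"
    using assms unfolding nonneg_orthonormal_def by auto
  fix j j' assume j: "j < k" "j' < k"
  have "(transpose_mat U * U) $$ (j, j') = (\<Sum>i<d. U $$ (i, j) * U $$ (i, j'))"
    using U j by (simp add: scalar_prod_def atLeast0LessThan)
  moreover have "transpose_mat U * U = 1\<^sub>m k" using assms unfolding nonneg_orthonormal_def by auto
  ultimately show "(\<Sum>i<d. U $$ (i, j) * U $$ (i, j')) = (if j = j' then 1 else 0)" using j by simp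
qed

lemma nonneg_orthonormalI:
  assumes U: "U \<in> carrier_mat d k" and "\<And>i j. i < d \<Longrightarrow> j < k \<Longrightarrow> 0 \<le> U $$ (i, j)"
    and orth: "\<And>j j'. j < k \<Longrightarrow> j' < k \<Longrightarrow>
      (\<Sum>i<d. U $$ (i, j) * U $$ (i, j')) = (if j = j' then 1 else 0)"
  shows "U \<in> nonneg_orthonormal d k"
proof -
  have "transpose_mat U * U = 1\<^sub>m k"
  proof (rule eq_matI)
    fix j j' assume "j < dim_row (1\<^sub>m k :: real mat)" "j' < dim_col (1\<^sub>m k :: real mat)"
    then have j: "j < k" "j' < k" by auto
    have "(transpose_mat U * U) $$ (j, j') = (\<Sum>i<d. U $$ (i, j) * U $$ (i, j'))"
      using U j by (simp add: scalar_prod_def atLeast0LessThan)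
    then show "(transpose_mat U * U) $$ (j, j') = 1\<^sub>m k $$ (j, j')" using orth[OF j] j by simp
  qed (use U in auto)
  then show ?thesis using assms unfolding nonneg_orthonormal_def by auto
qed

lemma residual_eq:
  assumes A: "A \<in> carrier_mat d n" and U: "U \<in> carrier_mat d k"
  shows "residual A U = (\<Sum>i<d. \<Sum>l<n.
    (A $$ (i, l) - (\<Sum>j<k. U $$ (i, j) * (\<Sum>i'<d. U $$ (i', j) * A $$ (i', l))))\<^sup>2)"
proof -
  have UA: "U * transpose_mat U * A = U * (transpose_mat U * A)"
    using A U by (intro assoc_mult_mat[of _ d k _ d _ n]) auto
  have e: "(U * (transpose_mat U * A)) $$ (i, l)
     = (\<Sum>j<k. U $$ (i, j) * (\<Sum>i'<d. U $$ (i', j) * A $$ (i', l)))" if "i < d" "l < n" for i l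
    using A U that by (simp add: scalar_prod_def atLeast0LessThan)
  have "residual A U = (\<Sum>i<d. \<Sum>l<n. (A $$ (i, l) - (U * (transpose_mat U * A)) $$ (i, l))\<^sup>2)"
    unfolding residual_def frobenius_norm_def UA
    using A U by (subst real_sqrt_pow2) (auto intro!: sum_nonneg sum.cong)
  also have "\<dots> = (\<Sum>i<d. \<Sum>l<n.
    (A $$ (i, l) - (\<Sum>j<k. U $$ (i, j) * (\<Sum>i'<d. U $$ (i', j) * A $$ (i', l))))\<^sup>2)"
    using e by (intro sum.cong refl) simp
  finally show ?thesis .
qed

lemma residual_eq_rays:
  assumes A: "A \<in> carrier_mat d n" and U: "U \<in> carrier_mat d k"
    and r: "\<And>i. i < d \<Longrightarrow> r i < k" "\<And>i j. i < d \<Longrightarrow> j < k \<Longrightarrow> j \<noteq> r i \<Longrightarrow> U $$ (i, j) = 0"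
  shows "residual A U = (\<Sum>i<d. \<Sum>l<n.
    (A $$ (i, l) - U $$ (i, r i) * (\<Sum>i'<d. U $$ (i', r i) * A $$ (i', l)))\<^sup>2)"
proof -
  have "(\<Sum>j<k. U $$ (i, j) * (\<Sum>i'<d. U $$ (i', j) * A $$ (i', l)))
     = U $$ (i, r i) * (\<Sum>i'<d. U $$ (i', r i) * A $$ (i', l))" if "i < d" for i l
  proof -
    have "(\<Sum>j<k. U $$ (i, j) * (\<Sum>i'<d. U $$ (i', j) * A $$ (i', l)))
      = (\<Sum>j\<in>{r i}. U $$ (i, j) * (\<Sum>i'<d. U $$ (i', j) * A $$ (i', l)))"
      using r that by (intro sum.mono_neutral_right) auto
    then show ?thesis by simp
  qed
  then show ?thesis unfolding residual_eq[OF A U] by (intro sum.cong refl) simp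
qed

text \<open>In each cluster and coordinate the entries of \<open>U\<close> are unit weights, so the
  projection used by the residual beats any other direction \<open>z\<close>. This is what makes a
  cost computed from sampled directions an upper bound for the residual.\<close>

lemma residual_le_rays:
  assumes A: "A \<in> carrier_mat d n" and U: "U \<in> nonneg_orthonormal d k"
    and r: "\<And>i. i < d \<Longrightarrow> r i < k" "\<And>i j. i < d \<Longrightarrow> j < k \<Longrightarrow> j \<noteq> r i \<Longrightarrow> U $$ (i, j) = 0"
  shows "residual A U \<le> (\<Sum>i<d. \<Sum>l<n. (A $$ (i, l) - U $$ (i, r i) * z (r i) l)\<^sup>2)"
proof -
  note UD = nonneg_orthonormalD[OF U]
  have group: "(\<Sum>i<d. f i (r i)) = (\<Sum>j<k. \<Sum>i\<in>{i\<in>{..<d}. r i = j}. f i j)" for f :: "nat \<Rightarrow> nat \<Rightarrow> real"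
  proof -
    have "(\<Sum>i<d. f i (r i)) = (\<Sum>j<k. \<Sum>i\<in>{i\<in>{..<d}. r i = j}. f i (r i))"
      using r by (intro sum.group[symmetric]) auto
    also have "\<dots> = (\<Sum>j<k. \<Sum>i\<in>{i\<in>{..<d}. r i = j}. f i j)"
      by (intro sum.cong refl) auto
    finally show ?thesis .
  qed
  have restrict: "(\<Sum>i<d. U $$ (i, j) * f i) = (\<Sum>i\<in>{i\<in>{..<d}. r i = j}. U $$ (i, j) * f i)"
    if "j < k" for j and f :: "nat \<Rightarrow> real"
    using r that by (intro sum.mono_neutral_right) auto
  have "residual A U = (\<Sum>l<n. \<Sum>i<d.
    (A $$ (i, l) - U $$ (i, r i) * (\<Sum>i'<d. U $$ (i', r i) * A $$ (i', l)))\<^sup>2)"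
    by (subst residual_eq_rays[where r=r, OF A UD(1) r]) (auto intro: sum.swap)
  also have "\<dots> \<le> (\<Sum>l<n. \<Sum>i<d. (A $$ (i, l) - U $$ (i, r i) * z (r i) l)\<^sup>2)"
  proof (rule sum_mono)
    fix l
    show "(\<Sum>i<d. (A $$ (i, l) - U $$ (i, r i) * (\<Sum>i'<d. U $$ (i', r i) * A $$ (i', l)))\<^sup>2)
      \<le> (\<Sum>i<d. (A $$ (i, l) - U $$ (i, r i) * z (r i) l)\<^sup>2)"
      unfolding group[of "\<lambda>i j. (A $$ (i, l) - U $$ (i, j) * (\<Sum>i'<d. U $$ (i', j) * A $$ (i', l)))\<^sup>2"]
        group[of "\<lambda>i j. (A $$ (i, l) - U $$ (i, j) * z j l)\<^sup>2"]
    proof (rule sum_mono)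
      fix j assume "j \<in> {..<k}"
      then have j: "j < k" by simp
      show "(\<Sum>i\<in>{i\<in>{..<d}. r i = j}. (A $$ (i, l) - U $$ (i, j) * (\<Sum>i'<d. U $$ (i', j) * A $$ (i', l)))\<^sup>2)
        \<le> (\<Sum>i\<in>{i\<in>{..<d}. r i = j}. (A $$ (i, l) - U $$ (i, j) * z j l)\<^sup>2)"
        unfolding restrict[OF j]
      proof (rule sum_square_projection_le)
        show "(\<Sum>i\<in>{i\<in>{..<d}. r i = j}. (U $$ (i, j))\<^sup>2) = 1"
          using UD(3)[OF j j] restrict[OF j] by (simp add: power2_eq_square)
      qed
    qed
  qed
  also have "\<dots> = (\<Sum>i<d. \<Sum>l<n. (A $$ (i, l) - U $$ (i, r i) * z (r i) l)\<^sup>2)"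
    by (rule sum.swap)
  finally show ?thesis .
qed

text \<open>A vanishing sum of nonnegative products has vanishing terms, so different columns have
  disjoint supports. A zero row gets an arbitrary label.\<close>

lemma nonneg_orthonormal_rows:
  assumes U: "U \<in> nonneg_orthonormal d k" and k: "0 < k"
  obtains r where "\<And>i. i < d \<Longrightarrow> r i < k" "\<And>i j. i < d \<Longrightarrow> j < k \<Longrightarrow> j \<noteq> r i \<Longrightarrow> U $$ (i, j) = 0"
proof -
  note UD = nonneg_orthonormalD[OF U]
  have "\<exists>r<k. \<forall>j<k. j \<noteq> r \<longrightarrow> U $$ (i, j) = 0" if i: "i < d" for i
  proof (cases "\<exists>r<k. U $$ (i, r) \<noteq> 0")
    case True
    then obtain r where r: "r < k" "U $$ (i, r) \<noteq> 0" by blast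
    have "U $$ (i, j) = 0" if "j < k" "j \<noteq> r" for j
    proof -
      have "(\<Sum>i<d. U $$ (i, j) * U $$ (i, r)) = 0" using UD(3) that r by simp
      then have "\<forall>i\<in>{..<d}. U $$ (i, j) * U $$ (i, r) = 0"
        using UD(2) that r by (subst (asm) sum_nonneg_eq_0_iff) auto
      then show ?thesis using i r by auto
    qed
    then show ?thesis using r by blast
  next
    case False
    then show ?thesis using k by blast
  qed
  then show ?thesis using that by metis
qed

text \<open>The case of zero directions; it calibrates the penalty in
  \<open>candidate.cost\<close>.\<close>

lemma residual_le_total:
  assumes A: "A \<in> carrier_mat d n" and U: "U \<in> nonneg_orthonormal d k" and k: "0 < k"
  shows "residual A U \<le> (\<Sum>i<d. \<Sum>l<n. (A $$ (i, l))\<^sup>2)"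
proof -
  obtain r where r: "\<And>i. i < d \<Longrightarrow> r i < k" "\<And>i j. i < d \<Longrightarrow> j < k \<Longrightarrow> j \<noteq> r i \<Longrightarrow> U $$ (i, j) = 0"
    using nonneg_orthonormal_rows[OF U k] by blast
  from residual_le_rays[where r=r and z="\<lambda>_ _. 0", OF A U r] show ?thesis by simp
qed

lemma nonneg_orthonormal_nonempty:
  assumes "k \<le> d"
  shows "nonneg_orthonormal d k \<noteq> {}"
proof -
  have "mat d k (\<lambda>(i, j). if i = j then 1 else 0) \<in> nonneg_orthonormal d k"
  proof (rule nonneg_orthonormalI)
    fix j j' assume j: "j < k" "j' < k"
    have "(\<Sum>i<d. mat d k (\<lambda>(i, j). if i = j then 1 else 0) $$ (i, j)
         * mat d k (\<lambda>(i, j). if i = j then 1 else 0) $$ (i, j'))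
      = (\<Sum>i<d. if i = j then (if j = j' then 1 else 0 :: real) else 0)"
      using j by (intro sum.cong) auto
    then show "(\<Sum>i<d. mat d k (\<lambda>(i, j). if i = j then 1 else 0) $$ (i, j)
         * mat d k (\<lambda>(i, j). if i = j then 1 else 0) $$ (i, j')) = (if j = j' then 1 else 0 :: real)"
      using j assms by simp
  qed auto
  then show ?thesis by blast
qed

lemma le_OPT:
  assumes A: "A \<in> carrier_mat d n" and "k \<le> d" and \<epsilon>: "0 < \<epsilon>"
    and le: "\<And>U. U \<in> nonneg_orthonormal d k \<Longrightarrow> x \<le> (1 + \<epsilon>) * residual A U"
  shows "x \<le> (1 + \<epsilon>) * OPT A k"
proof -
  have "x / (1 + \<epsilon>) \<le> OPT A k"
    unfolding OPT_def using A nonneg_orthonormal_nonempty[OF \<open>k \<le> d\<close>] le \<epsilon>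
    by (intro cINF_greatest) (auto simp: field_simps)
  then show ?thesis using \<epsilon> by (simp add: field_simps)
qed

text \<open>A candidate consists of \<open>m\<close> rows \<open>R j s\<close> with weights \<open>w j s\<close> for each cluster \<open>j\<close>;
  the row \<open>R j 0\<close> is forced into cluster \<open>j\<close>, so that no cluster is empty if these rows are
  distinct.\<close>

locale candidate =
  fixes a :: "nat \<Rightarrow> nat \<Rightarrow> real" and d n k m :: nat and R w :: "nat \<Rightarrow> nat \<Rightarrow> nat"
begin

definition dir :: "nat \<Rightarrow> nat \<Rightarrow> real" where
  "dir j l = (\<Sum>s<m. a (R j s) l / real (w j s)) / real m"

definition dot :: "nat \<Rightarrow> nat \<Rightarrow> real" where
  "dot i j = (\<Sum>l<n. a i l * dir j l)"

definition nrm :: "nat \<Rightarrow> real" where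
  "nrm j = (\<Sum>l<n. (dir j l)\<^sup>2)"

text \<open>The seed row \<open>R j 0\<close> takes its sampled weight instead of the clipped
  projection coefficient: the latter could be zero, and the column with it.\<close>

definition cf :: "nat \<Rightarrow> nat \<Rightarrow> real" where
  "cf i j = (if R j 0 = i then real (w j 0) else if 0 < dot i j then dot i j / nrm j else 0)"

definition err :: "nat \<Rightarrow> nat \<Rightarrow> real" where
  "err i j = (\<Sum>l<n. (a i l - cf i j * dir j l)\<^sup>2)"

text \<open>The value -1 is below every error, so a seed wins the minimisation in
  \<open>lab\<close>.\<close>

definition key :: "nat \<Rightarrow> nat \<Rightarrow> real" where
  "key i j = (if R j 0 = i then - 1 else err i j)"

definition lab :: "nat \<Rightarrow> nat" where
  "lab i = iter (\<lambda>j b. if key i j < key i b then j else b) k 0"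

definition colsq :: "nat \<Rightarrow> real" where
  "colsq j = (\<Sum>i<d. if lab i = j then (cf i j)\<^sup>2 else 0)"

definition total :: real where
  "total = (\<Sum>i<d. \<Sum>l<n. (a i l)\<^sup>2)"

text \<open>Every feasible matrix has residual at most \<open>total\<close>, and
  \<open>1 + \<epsilon>\<close> is below 2, so the penalty for one zero column already exceeds what
  a good candidate costs.\<close>

definition cost :: real where
  "cost = (\<Sum>i<d. \<Sum>j<k. if lab i = j then err i j else 0)
    + (\<Sum>j<k. if 0 < colsq j then 0 else 2 * total + 1)"

definition out :: "nat \<Rightarrow> nat \<Rightarrow> real" where
  "out i j = (if lab i = j then cf i j / sqrt (colsq j) else 0)"

lemma err_nonneg: "0 \<le> err i j"
  unfolding err_def by (simp add: sum_nonneg)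

lemma cf_nonneg: "0 \<le> cf i j"
  unfolding cf_def nrm_def by (simp add: sum_nonneg)

lemma lab:
  assumes "0 < k"
  shows "lab i < k" "j < k \<Longrightarrow> key i (lab i) \<le> key i j"
  using iter_argmin[OF assms, of "key i"] unfolding lab_def by auto

lemma cost_ge:
  assumes "0 < k"
  shows "(\<Sum>i<d. err i (lab i)) \<le> cost" "j < k \<Longrightarrow> \<not> 0 < colsq j \<Longrightarrow> 2 * total + 1 \<le> cost"
proof -
  have 1: "(\<Sum>i<d. \<Sum>j<k. if lab i = j then err i j else 0) = (\<Sum>i<d. err i (lab i))"
    using lab(1)[OF assms] by (intro sum.cong refl) simp
  have t: "0 \<le> total" unfolding total_def by (simp add: sum_nonneg)
  have 2: "0 \<le> (\<Sum>j<k. if 0 < colsq j then 0 else 2 * total + 1)"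
    using t by (intro sum_nonneg) auto
  show "(\<Sum>i<d. err i (lab i)) \<le> cost" unfolding cost_def 1 using 2 by simp
  assume j: "j < k" "\<not> 0 < colsq j"
  have "2 * total + 1 = (\<lambda>j. if 0 < colsq j then 0 else 2 * total + 1) j" using j by simp
  also have "\<dots> \<le> (\<Sum>j<k. if 0 < colsq j then 0 else 2 * total + 1)"
    using j t by (intro member_le_sum[where f="\<lambda>j. if 0 < colsq j then 0 else 2 * total + 1"]) auto
  finally show "2 * total + 1 \<le> cost"
    unfolding cost_def 1 using sum_nonneg[of "{..<d}" "\<lambda>i. err i (lab i)"] err_nonneg by fastforce
qed

lemma out_feasible:
  assumes k: "0 < k" and pos: "\<And>j. j < k \<Longrightarrow> 0 < colsq j"
  shows "mat d k (\<lambda>(i, j). out i j) \<in> nonneg_orthonormal d k"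
proof (rule nonneg_orthonormalI)
  fix i j assume "i < d" "j < k"
  then show "0 \<le> mat d k (\<lambda>(i, j). out i j) $$ (i, j)"
    using cf_nonneg pos by (simp add: out_def less_imp_le)
next
  fix j j' assume j: "j < k" "j' < k"
  have "(\<Sum>i<d. mat d k (\<lambda>(i, j). out i j) $$ (i, j) * mat d k (\<lambda>(i, j). out i j) $$ (i, j'))
    = (\<Sum>i<d. out i j * out i j')" using j by (intro sum.cong) auto
  also have "\<dots> = (if j = j' then 1 else 0)"
  proof (cases "j = j'")
    case True
    have "(\<Sum>i<d. out i j * out i j) = (\<Sum>i<d. (if lab i = j then (cf i j)\<^sup>2 else 0) / colsq j)"
      using pos[OF j(1)] by (intro sum.cong) (auto simp: out_def power2_eq_square)
    also have "\<dots> = 1"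
      using pos[OF j(1)] unfolding sum_divide_distrib[symmetric] colsq_def[symmetric] by simp
    finally show ?thesis using True by simp
  next
    case False
    then show ?thesis by (auto simp: out_def intro!: sum.neutral)
  qed
  finally show "(\<Sum>i<d. mat d k (\<lambda>(i, j). out i j) $$ (i, j) * mat d k (\<lambda>(i, j). out i j) $$ (i, j'))
    = (if j = j' then 1 else 0)" .
qed auto

lemma out_residual:
  assumes k: "0 < k" and pos: "\<And>j. j < k \<Longrightarrow> 0 < colsq j"
    and A: "A \<in> carrier_mat d n" "\<And>i l. i < d \<Longrightarrow> l < n \<Longrightarrow> A $$ (i, l) = a i l"
  shows "residual A (mat d k (\<lambda>(i, j). out i j)) \<le> cost"
proof -
  let ?U = "mat d k (\<lambda>(i, j). out i j)"
  \<comment> \<open>The factor \<open>sqrt (colsq j)\<close> in the direction undoes the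
    normalisation of the column.\<close>
  have "residual A ?U \<le> (\<Sum>i<d. \<Sum>l<n. (A $$ (i, l) - ?U $$ (i, lab i) * (sqrt (colsq (lab i)) * dir (lab i) l))\<^sup>2)"
    using out_feasible[OF k pos] lab(1)[OF k]
    by (intro residual_le_rays[OF A(1), where z="\<lambda>j l. sqrt (colsq j) * dir j l"]) (auto simp: out_def)
  also have "\<dots> = (\<Sum>i<d. err i (lab i))"
  proof (intro sum.cong refl)
    fix i assume i: "i \<in> {..<d}"
    have "0 < colsq (lab i)" using lab(1)[OF k] pos by blast
    then have eq: "?U $$ (i, lab i) * (sqrt (colsq (lab i)) * dir (lab i) l) = cf i (lab i) * dir (lab i) l" for l
      using i lab(1)[OF k] by (simp add: out_def)
    show "(\<Sum>l<n. (A $$ (i, l) - ?U $$ (i, lab i) * (sqrt (colsq (lab i)) * dir (lab i) l))\<^sup>2) = err i (lab i)"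
      unfolding err_def
    proof (intro sum.cong refl)
      fix l assume "l \<in> {..<n}"
      then have "A $$ (i, l) = a i l" using i A(2) by simp
      then show "(A $$ (i, l) - ?U $$ (i, lab i) * (sqrt (colsq (lab i)) * dir (lab i) l))\<^sup>2
        = (a i l - cf i (lab i) * dir (lab i) l)\<^sup>2" by (simp only: eq)
    qed
  qed
  also have "\<dots> \<le> cost" by (rule cost_ge[OF k])
  finally show ?thesis .
qed

end

text \<open>Sample each column of \<open>U\<close> on its support. The inner quantifier over
  \<open>R'\<close> and \<open>w'\<close> is there because an index of finitely many digits fixes a
  candidate only on the samples \<open>s < m\<close>.\<close>

lemma exists_good_candidate:
  fixes a :: "nat \<Rightarrow> nat \<Rightarrow> real"
  assumes A: "A \<in> carrier_mat d n" "\<And>i l. i < d \<Longrightarrow> l < n \<Longrightarrow> A $$ (i, l) = a i l"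
    and int: "\<And>i l. i < d \<Longrightarrow> l < n \<Longrightarrow> a i l \<in> \<int>"
    and k: "0 < k" and \<epsilon>: "0 < \<epsilon>" "\<epsilon> < 1"
    and B: "1 \<le> B" "5 * real d * (\<Sum>i<d. \<Sum>l<n. (a i l)\<^sup>2) / \<epsilon> \<le> real B"
    and m: "0 < m" "4 / \<epsilon> \<le> real m"
    and U: "U \<in> nonneg_orthonormal d k"
  shows "\<exists>R w. (\<forall>j<k. \<forall>s. R j s < d \<and> 1 \<le> w j s \<and> w j s \<le> B) \<and>
    (\<forall>R' w'. (\<forall>j<k. \<forall>s<m. R' j s = R j s \<and> w' j s = w j s) \<longrightarrow>
      candidate.cost a d n k m R' w' \<le> (1 + \<epsilon>) * residual A U)"
proof -
  note UD = nonneg_orthonormalD[OF U]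
  obtain r where r: "\<And>i. i < d \<Longrightarrow> r i < k" "\<And>i j. i < d \<Longrightarrow> j < k \<Longrightarrow> j \<noteq> r i \<Longrightarrow> U $$ (i, j) = 0"
    using nonneg_orthonormal_rows[OF U k] by blast
  define S where "S j = {i. i < d \<and> 0 < U $$ (i, j)}" for j
  define v where "v j l = (\<Sum>i\<in>S j. U $$ (i, j) * a i l)" for j l
  have U0: "U $$ (i, j) = 0" if "i < d" "j < k" "i \<notin> S j" for i j
    using UD(2)[of i j] that unfolding S_def by simp
  have Sr: "r i = j" if "i \<in> S j" "j < k" for i j using that r(2)[of i j] unfolding S_def by force
  have Sfin: "finite (S j)" "S j \<subseteq> {..<d}" for j unfolding S_def by auto
  have sum_S: "(\<Sum>i<d. U $$ (i, j) * f i) = (\<Sum>i\<in>S j. U $$ (i, j) * f i)"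
    if "j < k" for j and f :: "nat \<Rightarrow> real"
    using Sfin U0 that by (intro sum.mono_neutral_right) auto
  have unit: "(\<Sum>i\<in>S j. (U $$ (i, j))\<^sup>2) = 1" if "j < k" for j
    using UD(3)[OF that that] sum_S[OF that] by (simp add: power2_eq_square)
  define P where "P j R w c \<longleftrightarrow> (\<forall>s. R s \<in> S j) \<and> (\<forall>s. 1 \<le> w s \<and> w s \<le> B) \<and>
    (\<forall>i\<in>S j. 0 \<le> c i) \<and> c (R 0) = real (w 0) \<and>
    (\<Sum>i\<in>S j. \<Sum>l<n. (a i l - c i * ((\<Sum>s<m. a (R s) l / real (w s)) / real m))\<^sup>2)
      \<le> (1 + \<epsilon>) * (\<Sum>i\<in>S j. \<Sum>l<n. (a i l - U $$ (i, j) * v j l)\<^sup>2)"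
    for j R and w :: "nat \<Rightarrow> nat" and c
  have "\<exists>R w c. P j R w c" if j: "j < k" for j
  proof -
    have "S j \<noteq> {}" using unit[OF j] by force
    moreover have "0 < U $$ (i, j)" if "i \<in> S j" for i using that unfolding S_def by simp
    ultimately show ?thesis unfolding P_def
      by (intro cluster_samples[where a=a and d=d and n=n and S="S j" and u="\<lambda>i. U $$ (i, j)" and v="v j",
          OF int Sfin(2) _ _ unit[OF j] v_def \<epsilon> B m])
  qed
  then obtain R0 w0 c where P: "\<And>j. j < k \<Longrightarrow> P j (R0 j) (w0 j) (c j)" by metis
  have bound: "candidate.cost a d n k m R w \<le> (1 + \<epsilon>) * residual A U"
    if agree: "\<And>j s. j < k \<Longrightarrow> s < m \<Longrightarrow> R j s = R0 j s \<and> w j s = w0 j s" for R w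
  proof -
    have Rwc: "R j 0 \<in> S j" "1 \<le> w j 0" "\<And>i. i \<in> S j \<Longrightarrow> 0 \<le> c j i" "c j (R j 0) = real (w j 0)"
      "(\<Sum>i\<in>S j. \<Sum>l<n. (a i l - c j i * ((\<Sum>s<m. a (R j s) l / real (w j s)) / real m))\<^sup>2)
        \<le> (1 + \<epsilon>) * (\<Sum>i\<in>S j. \<Sum>l<n. (a i l - U $$ (i, j) * v j l)\<^sup>2)" if j: "j < k" for j
    proof -
      note Pj = P[OF j, unfolded P_def]
      show "R j 0 \<in> S j" "1 \<le> w j 0" "c j (R j 0) = real (w j 0)" using Pj agree[OF j m(1)] by simp_all
      show "0 \<le> c j i" if "i \<in> S j" for i
        using Pj[THEN conjunct2, THEN conjunct2, THEN conjunct1] that by blast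
      have "(\<Sum>s<m. a (R j s) l / real (w j s)) = (\<Sum>s<m. a (R0 j s) l / real (w0 j s))" for l
        using agree[OF j] by (intro sum.cong) auto
      then show "(\<Sum>i\<in>S j. \<Sum>l<n. (a i l - c j i * ((\<Sum>s<m. a (R j s) l / real (w j s)) / real m))\<^sup>2)
        \<le> (1 + \<epsilon>) * (\<Sum>i\<in>S j. \<Sum>l<n. (a i l - U $$ (i, j) * v j l)\<^sup>2)" using Pj by simp
    qed
    interpret candidate a d n k m R w .
    \<comment> \<open>The intermediate cost: each row stays in the cluster that \<open>U\<close>
      gives it, with the coefficient from the sampling; a zero row of \<open>U\<close> gets
      coefficient 0.\<close>
    define h where "h i = (\<Sum>l<n. (a i l - (if i \<in> S (r i) then c (r i) i else 0) * dir (r i) l)\<^sup>2)" for i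
    define g where "g i = (\<Sum>l<n. (a i l - U $$ (i, r i) * v (r i) l)\<^sup>2)" for i
    \<comment> \<open>The winning label has key -1, so it has the same seed row. Seeds lie in the
      supports of their columns, which are disjoint.\<close>
    have seed: "lab (R j 0) = j" if "j < k" for j
    proof -
      have "key (R j 0) (lab (R j 0)) \<le> key (R j 0) j" using lab(2)[OF k] that .
      then have "R (lab (R j 0)) 0 = R j 0"
        using err_nonneg[of "R j 0" "lab (R j 0)"] unfolding key_def by (simp split: if_splits)
      moreover have "R (lab (R j 0)) 0 \<in> S (lab (R j 0))" "R j 0 \<in> S j"
        using Rwc(1) lab(1)[OF k] that by blast+
      ultimately show ?thesis using Sr[of "R j 0"] that lab(1)[OF k] by metis
    qed
    \<comment> \<open>Relabelling only helps: a seed keeps its cluster and coefficient, and any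
      other row takes the ray of least error with the best nonnegative coefficient.\<close>
    have eh: "err i (lab i) \<le> h i" if i: "i < d" for i
    proof (cases "\<exists>j<k. R j 0 = i")
      case True
      then obtain j where j: "j < k" "R j 0 = i" by blast
      then have "lab i = j" "i \<in> S j" using seed Rwc(1) by auto
      then have "r i = j" using Sr j by blast
      then show ?thesis
        unfolding err_def h_def cf_def using j \<open>lab i = j\<close> \<open>i \<in> S j\<close> Rwc(4)[OF j(1)] by simp
    next
      case False
      then have "key i j = err i j" if "j < k" for j using that unfolding key_def by auto
      then have "err i (lab i) \<le> err i (r i)" using lab(1)[OF k, of i] lab(2)[OF k r(1)[OF i], of i] r(1)[OF i] by simp
      also have "\<dots> \<le> h i"
      proof -
        have "cf i (r i) = (if 0 < dot i (r i) then dot i (r i) / nrm (r i) else 0)"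
          using False r(1)[OF i] unfolding cf_def by auto
        then show ?thesis
          unfolding err_def h_def using Rwc(3)[OF r(1)[OF i]] unfolding dot_def nrm_def
          by (simp only:) (rule ray_projection_le, simp)
      qed
      finally show ?thesis .
    qed
    have dirj: "dir j l = (\<Sum>s<m. a (R j s) l / real (w j s)) / real m" for j l by (rule dir_def)
    have res: "residual A U = (\<Sum>i<d. g i)"
      unfolding residual_eq_rays[where r=r, OF A(1) UD(1) r, simplified] g_def v_def
    proof (intro sum.cong refl)
      fix i l assume "i \<in> {..<d}" "l \<in> {..<n}"
      then show "(A $$ (i, l) - U $$ (i, r i) * (\<Sum>i'<d. U $$ (i', r i) * A $$ (i', l)))\<^sup>2
        = (a i l - U $$ (i, r i) * (\<Sum>i'\<in>S (r i). U $$ (i', r i) * a i' l))\<^sup>2"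
        using A(2) sum_S[OF r(1), of i "\<lambda>i. a i l"] by simp
    qed
    \<comment> \<open>\<open>D\<close> is partitioned by the supports. The remaining rows of
      \<open>U\<close> are zero and contribute their full squared norm to both \<open>h\<close> and
      \<open>g\<close>.\<close>
    define D where "D = {i. i < d \<and> i \<in> S (r i)}"
    have split: "(\<Sum>i<d. f i) = (\<Sum>j<k. \<Sum>i\<in>S j. f i) + (\<Sum>i\<in>{..<d} - D. f i)" for f :: "nat \<Rightarrow> real"
    proof -
      have "(\<Sum>i<d. f i) = (\<Sum>i\<in>D. f i) + (\<Sum>i\<in>{..<d} - D. f i)"
        by (subst sum.subset_diff[of D]) (auto simp: D_def)
      also have "(\<Sum>i\<in>D. f i) = (\<Sum>j<k. \<Sum>i\<in>{i\<in>D. r i = j}. f i)"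
        using r(1) by (intro sum.group[symmetric]) (auto simp: D_def)
      also have "\<dots> = (\<Sum>j<k. \<Sum>i\<in>S j. f i)"
      proof (intro sum.cong refl)
        fix j assume "j \<in> {..<k}"
        then show "{i\<in>D. r i = j} = S j" using Sr Sfin(2)[of j] unfolding D_def by auto
      qed
      finally show ?thesis .
    qed
    have "(\<Sum>i<d. h i) \<le> (\<Sum>j<k. (1 + \<epsilon>) * (\<Sum>i\<in>S j. g i)) + (\<Sum>i\<in>{..<d} - D. (1 + \<epsilon>) * g i)"
      unfolding split[of h]
    proof (intro add_mono sum_mono)
      fix j assume "j \<in> {..<k}"
      then have j: "j < k" by simp
      have "(\<Sum>i\<in>S j. h i) = (\<Sum>i\<in>S j. \<Sum>l<n. (a i l - c j i * dir j l)\<^sup>2)"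
        using Sr j unfolding h_def by (intro sum.cong refl) auto
      also have "\<dots> \<le> (1 + \<epsilon>) * (\<Sum>i\<in>S j. \<Sum>l<n. (a i l - U $$ (i, j) * v j l)\<^sup>2)"
        unfolding dirj by (rule Rwc(5)[OF j])
      also have "(\<Sum>i\<in>S j. \<Sum>l<n. (a i l - U $$ (i, j) * v j l)\<^sup>2) = (\<Sum>i\<in>S j. g i)"
        using Sr j unfolding g_def by (intro sum.cong refl) auto
      finally show "(\<Sum>i\<in>S j. h i) \<le> (1 + \<epsilon>) * (\<Sum>i\<in>S j. g i)" .
    next
      fix i assume i: "i \<in> {..<d} - D"
      then have "i \<notin> S (r i)" unfolding D_def by auto
      then have "h i = g i" using U0[of i "r i"] r(1) i unfolding h_def g_def by auto
      moreover have "0 \<le> g i" unfolding g_def by (simp add: sum_nonneg)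
      ultimately show "h i \<le> (1 + \<epsilon>) * g i" using \<epsilon> by (simp add: mult_le_cancel_right1)
    qed
    also have "\<dots> = (1 + \<epsilon>) * residual A U"
      unfolding res split[of g] by (simp only: sum_distrib_left[symmetric] distrib_left)
    finally have hres: "(\<Sum>i<d. h i) \<le> (1 + \<epsilon>) * residual A U" .
    have pos: "0 < colsq j" if j: "j < k" for j
    proof -
      let ?f = "\<lambda>i. if lab i = j then (cf i j)\<^sup>2 else 0"
      have "R j 0 \<in> S j" by (rule Rwc(1)[OF j])
      then have "R j 0 \<in> {..<d}" using Sfin(2) by blast
      then have "?f (R j 0) \<le> colsq j" unfolding colsq_def by (intro member_le_sum) auto
      moreover have "cf (R j 0) j = real (w j 0)" unfolding cf_def by simp
      moreover have "1 \<le> w j 0" by (rule Rwc(2)[OF j])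
      then have "0 < real (w j 0)" by simp
      ultimately have "(real (w j 0))\<^sup>2 \<le> colsq j" "0 < (real (w j 0))\<^sup>2"
        using seed[OF j] by simp_all
      then show ?thesis by linarith
    qed
    have "cost = (\<Sum>i<d. err i (lab i))"
      unfolding cost_def using lab(1)[OF k] pos by simp
    also have "\<dots> \<le> (\<Sum>i<d. h i)" using eh by (intro sum_mono) auto
    finally show "cost \<le> (1 + \<epsilon>) * residual A U" using hres by simp
  qed
  have range: "R0 j s < d \<and> 1 \<le> w0 j s \<and> w0 j s \<le> B" if j: "j < k" for j s
  proof -
    note Pj = P[OF j, unfolded P_def]
    have "R0 j s \<in> S j" using Pj[THEN conjunct1] by blast
    then show ?thesis using Pj[THEN conjunct2, THEN conjunct1] Sfin(2) by blast
  qed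
  have "\<forall>R' w'. (\<forall>j<k. \<forall>s<m. R' j s = R0 j s \<and> w' j s = w0 j s) \<longrightarrow>
      candidate.cost a d n k m R' w' \<le> (1 + \<epsilon>) * residual A U"
  proof (intro allI impI)
    fix R w assume ag: "\<forall>j<k. \<forall>s<m. R j s = R0 j s \<and> w j s = w0 j s"
    show "candidate.cost a d n k m R w \<le> (1 + \<epsilon>) * residual A U"
      by (rule bound) (use ag in simp)
  qed
  moreover have "\<forall>j<k. \<forall>s. R0 j s < d \<and> 1 \<le> w0 j s \<and> w0 j s \<le> B" using range by blast
  ultimately show ?thesis
    by - (rule exI[of _ R0], rule exI[of _ w0], rule conjI)
qed

section \<open>The objective function as an expression\<close>

text \<open>Variables 0 to 7 are the fuel, \<open>d\<close>, \<open>n\<close>, \<open>k\<close>, \<open>m\<close>, \<open>B\<close>, \<open>\<parallel>A\<parallel>\<^sup>2\<close> and \<open>\<epsilon>\<close>.  In the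
  following definitions \<open>x\<close> is the first variable free for binders, \<open>X\<close> the variable holding the index
  of the candidate, whose base-\<open>B\<close> digits are the rows and weights, and \<open>i\<close>, \<open>j\<close>, \<open>l\<close> are variables too.\<close>

definition eSum :: "nat \<Rightarrow> ex \<Rightarrow> ex \<Rightarrow> ex" where
  "eSum x b e = EIter x b (ECst 0) (EBin Plus (EVar x) e)"

definition eSq :: "ex \<Rightarrow> ex" where
  "eSq a = EBin Times a a"

text \<open>The only test is a strict comparison; on integers, equality means that the squared
  difference is below 1.\<close>

definition eEq :: "ex \<Rightarrow> ex \<Rightarrow> ex \<Rightarrow> ex \<Rightarrow> ex" where
  "eEq a b c e = EIf (eSq (EBin Minus a b)) (ECst 1) c e"

definition eFloor :: "nat \<Rightarrow> ex \<Rightarrow> ex" where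
  "eFloor x y = EIter x y (ECst 0)
     (EIf y (EBin Plus (EVar (x + 1)) (ECst 1)) (EVar x) (EBin Plus (EVar x) (ECst 1)))"

definition ePow :: "nat \<Rightarrow> ex \<Rightarrow> ex" where
  "ePow x t = EIter x t (ECst 1) (EBin Times (EVar x) (EVar 5))"

text \<open>Two consecutive truncations of \<open>X\<close> differ, after scaling by
  \<open>B\<close>, in the digit alone. Nested binders are spaced by 20, which leaves room for the
  three cells of a loop and the temporaries between two loops.\<close>

definition eDig :: "nat \<Rightarrow> nat \<Rightarrow> ex \<Rightarrow> ex" where
  "eDig x X t = EBin Minus (eFloor x (EBin Divide (EVar X) (ePow (x + 20) t)))
     (EBin Times (EVar 5)
       (eFloor x (EBin Divide (EVar X) (ePow (x + 20) (EBin Plus t (ECst 1))))))"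

text \<open>The matrix starts at cell 1, after the accuracy parameter.\<close>

definition eA :: "ex \<Rightarrow> ex \<Rightarrow> ex" where
  "eA i l = EInp (EBin Plus (EBin Plus (EBin Times i (EVar 2)) l) (ECst 1))"

definition ePos :: "nat \<Rightarrow> ex \<Rightarrow> ex" where
  "ePos j s = EBin Times (EBin Plus (EBin Times (EVar j) (EVar 4)) s) (ECst 2)"

definition eRow :: "nat \<Rightarrow> nat \<Rightarrow> nat \<Rightarrow> ex \<Rightarrow> ex" where
  "eRow x X j s = eDig x X (ePos j s)"

text \<open>Row and weight of a sample are neighbouring digits. Digits start at 0 and weights at
  1.\<close>

definition eWt :: "nat \<Rightarrow> nat \<Rightarrow> nat \<Rightarrow> ex \<Rightarrow> ex" where
  "eWt x X j s = EBin Plus (eDig x X (EBin Plus (ePos j s) (ECst 1))) (ECst 1)"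

definition eDir :: "nat \<Rightarrow> nat \<Rightarrow> nat \<Rightarrow> nat \<Rightarrow> ex" where
  "eDir x X j l = EBin Divide (eSum x (EVar 4)
     (EBin Divide (eA (eRow (x + 20) X j (EVar (x + 1))) (EVar l))
       (eWt (x + 20) X j (EVar (x + 1))))) (EVar 4)"

definition eDot :: "nat \<Rightarrow> nat \<Rightarrow> nat \<Rightarrow> nat \<Rightarrow> ex" where
  "eDot x X i j = eSum x (EVar 2)
     (EBin Times (eA (EVar i) (EVar (x + 1))) (eDir (x + 20) X j (x + 1)))"

definition eNrm :: "nat \<Rightarrow> nat \<Rightarrow> nat \<Rightarrow> ex" where
  "eNrm x X j = eSum x (EVar 2) (eSq (eDir (x + 20) X j (x + 1)))"

definition eSeed :: "nat \<Rightarrow> nat \<Rightarrow> nat \<Rightarrow> nat \<Rightarrow> ex \<Rightarrow> ex \<Rightarrow> ex" where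
  "eSeed x X i j c e = eEq (eRow x X j (ECst 0)) (EVar i) c e"

definition eCf :: "nat \<Rightarrow> nat \<Rightarrow> nat \<Rightarrow> nat \<Rightarrow> ex" where
  "eCf x X i j = eSeed x X i j (eWt x X j (ECst 0))
     (EIf (ECst 0) (eDot x X i j) (EBin Divide (eDot x X i j) (eNrm x X j)) (ECst 0))"

definition eErr :: "nat \<Rightarrow> nat \<Rightarrow> nat \<Rightarrow> nat \<Rightarrow> ex" where
  "eErr x X i j = eSum x (EVar 2) (eSq (EBin Minus (eA (EVar i) (EVar (x + 1)))
     (EBin Times (eCf (x + 20) X i j) (eDir (x + 20) X j (x + 1)))))"

definition eKey :: "nat \<Rightarrow> nat \<Rightarrow> nat \<Rightarrow> nat \<Rightarrow> ex" where
  "eKey x X i j = eSeed x X i j (EBin Minus (ECst 0) (ECst 1)) (eErr x X i j)"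

definition eLab :: "nat \<Rightarrow> nat \<Rightarrow> nat \<Rightarrow> ex" where
  "eLab x X i = EIter x (EVar 3) (ECst 0)
     (EIf (eKey (x + 20) X i (x + 1)) (eKey (x + 20) X i x) (EVar (x + 1)) (EVar x))"

definition eIs :: "nat \<Rightarrow> nat \<Rightarrow> nat \<Rightarrow> nat \<Rightarrow> ex \<Rightarrow> ex \<Rightarrow> ex" where
  "eIs x X i j c e = eEq (eLab x X i) (EVar j) c e"

definition eColsq :: "nat \<Rightarrow> nat \<Rightarrow> nat \<Rightarrow> ex" where
  "eColsq x X j = eSum x (EVar 1)
     (eIs (x + 20) X (x + 1) j (eSq (eCf (x + 20) X (x + 1) j)) (ECst 0))"

definition eCost :: "nat \<Rightarrow> nat \<Rightarrow> ex" where
  "eCost x X = EBin Plus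
     (eSum x (EVar 1) (eSum (x + 20) (EVar 3)
       (eIs (x + 40) X (x + 1) (x + 21) (eErr (x + 40) X (x + 1) (x + 21)) (ECst 0))))
     (eSum x (EVar 3) (EIf (ECst 0) (eColsq (x + 20) X (x + 1)) (ECst 0)
       (EBin Plus (EBin Times (ECst 2) (EVar 6)) (ECst 1))))"

text \<open>The number of rounds is the fuel itself, which at this stage is the number of
  candidates.\<close>

definition eBest :: "nat \<Rightarrow> ex" where
  "eBest x = EIter x (EVar 0) (ECst 0)
     (EIf (eCost (x + 20) (x + 1)) (eCost (x + 20) x) (EVar (x + 1)) (EVar x))"

text \<open>An iteration with bound 1 serves as a let: it binds the row \<open>x\<close> and the
  column \<open>x + 20\<close> of position \<open>t\<close> in the row-by-row output.\<close>

definition eOut :: "nat \<Rightarrow> nat \<Rightarrow> nat \<Rightarrow> ex" where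
  "eOut x X t = EIter x (ECst 1) (eFloor (x + 20) (EBin Divide (EVar t) (EVar 3)))
     (EIter (x + 20) (ECst 1) (EBin Minus (EVar t) (EBin Times (EVar 3) (EVar x)))
       (eIs (x + 40) X x (x + 20)
         (EBin Divide (eCf (x + 40) X x (x + 20)) (ESqrt (eColsq (x + 40) X (x + 20)))) (ECst 0)))"

definition eTotal :: "nat \<Rightarrow> ex" where
  "eTotal x = eSum x (EBin Times (EVar 1) (EVar 2)) (eSq (EInp (EBin Plus (EVar (x + 1)) (ECst 1))))"

text \<open>Two nested loops instead of one of \<open>2 * (k * m)\<close> rounds: the fuel here is
  only \<open>B\<close>, which bounds \<open>k\<close> and \<open>m\<close> but perhaps not their
  product.\<close>

definition ePower :: "nat \<Rightarrow> ex" where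
  "ePower x = EIter x (EVar 3) (ECst 1)
     (EIter (x + 20) (EVar 4) (EVar x) (EBin Times (EVar (x + 20)) (eSq (EVar 5))))"

section \<open>Well-formedness of the expressions\<close>

definition params_in :: "nat set \<Rightarrow> bool" where
  "params_in V \<longleftrightarrow> {..<8} \<subseteq> V"

lemma params_in_insert [simp]: "params_in V \<Longrightarrow> params_in (insert x V)"
  by (auto simp: params_in_def)

lemma params_in_mem [simp]: "params_in V \<Longrightarrow> 0 \<in> V" "params_in V \<Longrightarrow> Suc 0 \<in> V"
  "params_in V \<Longrightarrow> 2 \<in> V" "params_in V \<Longrightarrow> 3 \<in> V" "params_in V \<Longrightarrow> 4 \<in> V"
  "params_in V \<Longrightarrow> 5 \<in> V" "params_in V \<Longrightarrow> 6 \<in> V"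
  by (auto simp: params_in_def)

text \<open>The form needed for loop-free arguments, which are substituted below binders and hence
  evaluated at other registers and in larger scopes.\<close>

definition simple_in :: "ex \<Rightarrow> nat set \<Rightarrow> bool" where
  "simple_in e V \<longleftrightarrow> (\<forall>V' p. V \<subseteq> V' \<longrightarrow> wfe e V' p)"

lemma simple_in_wfe: "simple_in e V \<Longrightarrow> wfe e V p"
  by (auto simp: simple_in_def)

lemma simple_in_insert [simp]: "simple_in e V \<Longrightarrow> simple_in e (insert x V)"
  unfolding simple_in_def by blast

lemma simple_in_simps [simp]:
  "simple_in (EVar y) V \<longleftrightarrow> y \<in> V" "simple_in (ECst c) V"
  "simple_in a V \<Longrightarrow> simple_in b V \<Longrightarrow> simple_in (EBin f a b) V"
  by (auto simp: simple_in_def)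

lemma wfe_eDig [simp]:
  "params_in V \<Longrightarrow> X \<in> V \<Longrightarrow> simple_in t V \<Longrightarrow> p + 8 \<le> x \<Longrightarrow> wfe (eDig x X t) V p"
  by (simp add: eDig_def eFloor_def ePow_def simple_in_wfe)

lemma simple_ePos [simp]: "params_in V \<Longrightarrow> j \<in> V \<Longrightarrow> simple_in s V \<Longrightarrow> simple_in (ePos j s) V"
  by (simp add: ePos_def)

lemma wfe_eRow [simp]:
  "params_in V \<Longrightarrow> X \<in> V \<Longrightarrow> j \<in> V \<Longrightarrow> simple_in s V \<Longrightarrow> p + 8 \<le> x \<Longrightarrow> wfe (eRow x X j s) V p"
  by (simp add: eRow_def)

lemma wfe_eWt [simp]:
  "params_in V \<Longrightarrow> X \<in> V \<Longrightarrow> j \<in> V \<Longrightarrow> simple_in s V \<Longrightarrow> p + 8 \<le> x \<Longrightarrow> wfe (eWt x X j s) V p"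
  by (simp add: eWt_def)

lemma wfe_eA [simp]:
  "params_in V \<Longrightarrow> wfe i V p \<Longrightarrow> simple_in l V \<Longrightarrow> wfe (eA i l) V p"
  by (simp add: eA_def simple_in_wfe)

lemma wfe_eDir [simp]:
  "params_in V \<Longrightarrow> X \<in> V \<Longrightarrow> j \<in> V \<Longrightarrow> l \<in> V \<Longrightarrow> p + 8 \<le> x \<Longrightarrow> wfe (eDir x X j l) V p"
  by (simp add: eDir_def eSum_def)

lemma wfe_eDot [simp]:
  "params_in V \<Longrightarrow> X \<in> V \<Longrightarrow> i \<in> V \<Longrightarrow> j \<in> V \<Longrightarrow> p + 8 \<le> x \<Longrightarrow> wfe (eDot x X i j) V p"
  by (simp add: eDot_def eSum_def)

lemma wfe_eNrm [simp]:
  "params_in V \<Longrightarrow> X \<in> V \<Longrightarrow> j \<in> V \<Longrightarrow> p + 8 \<le> x \<Longrightarrow> wfe (eNrm x X j) V p"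
  by (simp add: eNrm_def eSum_def eSq_def)

lemma wfe_eCf [simp]:
  "params_in V \<Longrightarrow> X \<in> V \<Longrightarrow> i \<in> V \<Longrightarrow> j \<in> V \<Longrightarrow> p + 10 \<le> x \<Longrightarrow> wfe (eCf x X i j) V p"
  by (simp add: eCf_def eSeed_def eEq_def eSq_def)

lemma wfe_eErr [simp]:
  "params_in V \<Longrightarrow> X \<in> V \<Longrightarrow> i \<in> V \<Longrightarrow> j \<in> V \<Longrightarrow> p + 8 \<le> x \<Longrightarrow> wfe (eErr x X i j) V p"
  by (simp add: eErr_def eSum_def eSq_def)

lemma wfe_eKey [simp]:
  "params_in V \<Longrightarrow> X \<in> V \<Longrightarrow> i \<in> V \<Longrightarrow> j \<in> V \<Longrightarrow> p + 10 \<le> x \<Longrightarrow> wfe (eKey x X i j) V p"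
  by (simp add: eKey_def eSeed_def eEq_def eSq_def)

lemma wfe_eLab [simp]:
  "params_in V \<Longrightarrow> X \<in> V \<Longrightarrow> i \<in> V \<Longrightarrow> p + 8 \<le> x \<Longrightarrow> wfe (eLab x X i) V p"
  by (simp add: eLab_def)

lemma wfe_eIs [simp]:
  "params_in V \<Longrightarrow> X \<in> V \<Longrightarrow> i \<in> V \<Longrightarrow> j \<in> V \<Longrightarrow> wfe c V p \<Longrightarrow> wfe e V p \<Longrightarrow> p + 10 \<le> x
   \<Longrightarrow> wfe (eIs x X i j c e) V p"
  by (simp add: eIs_def eEq_def eSq_def)

lemma wfe_eColsq [simp]:
  "params_in V \<Longrightarrow> X \<in> V \<Longrightarrow> j \<in> V \<Longrightarrow> p + 8 \<le> x \<Longrightarrow> wfe (eColsq x X j) V p"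
  by (simp add: eColsq_def eSum_def eSq_def)

lemma wfe_eCost [simp]:
  "params_in V \<Longrightarrow> X \<in> V \<Longrightarrow> p + 8 \<le> x \<Longrightarrow> wfe (eCost x X) V p"
  by (simp add: eCost_def eSum_def)

lemma wfe_eBest [simp]: "params_in V \<Longrightarrow> p + 8 \<le> x \<Longrightarrow> wfe (eBest x) V p"
  by (simp add: eBest_def)

lemma wfe_eOut [simp]:
  "params_in V \<Longrightarrow> X \<in> V \<Longrightarrow> t \<in> V \<Longrightarrow> p + 8 \<le> x \<Longrightarrow> wfe (eOut x X t) V p"
  by (simp add: eOut_def eFloor_def)

lemma wfe_eTotal [simp]: "params_in V \<Longrightarrow> p + 8 \<le> x \<Longrightarrow> wfe (eTotal x) V p"
  by (simp add: eTotal_def eSum_def eSq_def)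

lemma wfe_ePower [simp]: "params_in V \<Longrightarrow> p + 8 \<le> x \<Longrightarrow> wfe (ePower x) V p"
  by (simp add: ePower_def eSq_def)

section \<open>Values of the expressions\<close>

lemma iter_cong:
  "(\<And>j a. j < n \<Longrightarrow> f j a = g j a) \<Longrightarrow> iter f n a = iter g n a"
  by (induction n) auto

lemma iter_sum: "iter (\<lambda>j a. a + f j) n 0 = (\<Sum>j<n. f j :: real)"
  by (induction n) auto

lemma iter_mult: "iter (\<lambda>j a. a * (c::real)) n b = b * c ^ n"
  by (induction n) auto

text \<open>A simulation with invariant \<open>P\<close>: the accumulators of the minimum searches
  are indices held as reals, and the loop body behaves as intended only on valid indices.\<close>

lemma iter_map:
  fixes n :: nat
  assumes "P a" "\<And>j a. j < n \<Longrightarrow> P a \<Longrightarrow> P (g j a) \<and> f j (h a) = h (g j a)"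
  shows "iter f n (h a) = h (iter g n a)"
proof -
  have "P (iter g i a) \<and> iter f i (h a) = h (iter g i a)" if "i \<le> n" for i
    using that assms by (induction i) auto
  then show ?thesis by blast
qed

lemma iter_floor:
  fixes y :: real
  assumes "0 \<le> y"
  shows "iter (\<lambda>j a. if y < real j + 1 then a else a + 1) (nat \<lceil>y\<rceil>) 0 = real_of_int \<lfloor>y\<rfloor>"
proof -
  have "iter (\<lambda>j a. if y < real j + 1 then a else a + 1) i 0 = min (real i) (real_of_int \<lfloor>y\<rfloor>)" for i
  proof (induction i)
    case 0
    then show ?case using assms by simp
  next
    case (Suc i)
    show ?case
    proof (cases "y < real i + 1")
      case True
      then have "\<lfloor>y\<rfloor> < int i + 1" by (subst floor_less_iff) simp
      then have "real_of_int \<lfloor>y\<rfloor> \<le> real i" by linarith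
      then show ?thesis using Suc True by simp
    next
      case False
      then have "int (Suc i) \<le> \<lfloor>y\<rfloor>" by linarith
      then have "real (Suc i) \<le> real_of_int \<lfloor>y\<rfloor>" by linarith
      then show ?thesis using Suc False by simp
    qed
  qed
  moreover have "real_of_int \<lfloor>y\<rfloor> \<le> real (nat \<lceil>y\<rceil>)" by linarith
  ultimately show ?thesis by simp
qed

lemma ev_eSum:
  assumes "ev inp M b \<sigma> = real b'" "real b' \<le> \<sigma> 0"
    and "\<And>a j. j < b' \<Longrightarrow> ev inp M e (\<sigma>(x := a, Suc x := real j)) = f j"
  shows "ev inp M (eSum x b e) \<sigma> = (\<Sum>j<b'. f j)"
proof -
  have "ev inp M (eSum x b e) \<sigma>
    = iter (\<lambda>j a. a + ev inp M e (\<sigma>(x := a, Suc x := real j))) b' 0"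
    using assms(1,2) by (simp add: eSum_def)
  also have "\<dots> = iter (\<lambda>j a. a + f j) b' 0"
    using assms(3) by (intro iter_cong) simp
  finally show ?thesis by (simp add: iter_sum)
qed

lemma ev_eSq [simp]: "ev inp M (eSq a) \<sigma> = (ev inp M a \<sigma>)\<^sup>2"
  by (simp add: eSq_def power2_eq_square)

lemma ev_eEq:
  assumes "ev inp M a \<sigma> = real a'" "ev inp M b \<sigma> = real b'"
  shows "ev inp M (eEq a b c e) \<sigma> = (if a' = b' then ev inp M c \<sigma> else ev inp M e \<sigma>)"
proof -
  have "(real a' - real b')\<^sup>2 < 1 \<longleftrightarrow> \<bar>real a' - real b'\<bar> < 1"
    by (rule abs_square_less_1)
  also have "\<dots> \<longleftrightarrow> a' = b'" by linarith
  finally show ?thesis using assms by (simp add: eEq_def)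
qed

lemma ev_eFloor:
  assumes "ev inp M y \<sigma> = v" "\<And>a j. ev inp M y (\<sigma>(x := a, Suc x := j)) = v"
    and "0 \<le> v" "v \<le> \<sigma> 0"
  shows "ev inp M (eFloor x y) \<sigma> = real_of_int \<lfloor>v\<rfloor>"
proof -
  have "ev inp M (eFloor x y) \<sigma> = iter (\<lambda>j a. if v < real j + 1 then a else a + 1) (nat \<lceil>v\<rceil>) 0"
    using assms by (simp add: eFloor_def cong: if_cong)
  then show ?thesis using iter_floor[OF assms(3)] by simp
qed

lemma ev_ePow:
  assumes "ev inp M t \<sigma> = real t'" "real t' \<le> \<sigma> 0" "5 < x"
  shows "ev inp M (ePow x t) \<sigma> = \<sigma> 5 ^ t'"
  using assms by (simp add: ePow_def iter_mult)

definition dgt :: "nat \<Rightarrow> nat \<Rightarrow> nat \<Rightarrow> nat" where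
  "dgt B X t = X div B ^ t mod B"

text \<open>The position \<open>t\<close> is evaluated inside loops that own the registers from
  \<open>x\<close> on, hence the hypothesis over all valuations agreeing below \<open>x\<close>. The
  \<open>+ 1\<close> in \<open>t'\<close> is the second power of \<open>B\<close>.\<close>

lemma ev_eDig:
  assumes B: "\<sigma> 5 = real B" "0 < B" and X: "X < x" "\<sigma> X = real X'" "real X' \<le> \<sigma> 0"
    and t: "\<And>\<sigma>'. (\<forall>y<x. \<sigma>' y = \<sigma> y) \<Longrightarrow> ev inp M t \<sigma>' = real t'"
    and t': "real t' + 1 \<le> \<sigma> 0" and x: "5 < x"
  shows "ev inp M (eDig x X t) \<sigma> = real (dgt B X' t')"
proof -
  have fl: "ev inp M (eFloor x (EBin Divide (EVar X) (ePow (x + 20) e))) \<sigma> = real (X' div B ^ e')"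
    if e: "\<And>\<sigma>'. (\<forall>y<x. \<sigma>' y = \<sigma> y) \<Longrightarrow> ev inp M e \<sigma>' = real e'" and e': "real e' \<le> \<sigma> 0" for e e'
  proof -
    let ?v = "real X' / real B ^ e'"
    have v: "ev inp M (EBin Divide (EVar X) (ePow (x + 20) e)) \<sigma>' = ?v"
      if s: "\<forall>y<x. \<sigma>' y = \<sigma> y" for \<sigma>'
    proof -
      have "\<sigma>' 0 = \<sigma> 0" "\<sigma>' 5 = \<sigma> 5" "\<sigma>' X = \<sigma> X" using s x X by auto
      then have "ev inp M (ePow (x + 20) e) \<sigma>' = real B ^ e'"
        using e[OF s] e' x B by (subst ev_ePow) auto
      then show ?thesis using \<open>\<sigma>' X = \<sigma> X\<close> X by simp
    qed
    have "?v \<le> real X'" using B(2) by (simp add: divide_le_eq mult_le_cancel_left1)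
    then have "ev inp M (eFloor x (EBin Divide (EVar X) (ePow (x + 20) e))) \<sigma> = real_of_int \<lfloor>?v\<rfloor>"
      using X by (intro ev_eFloor v) auto
    also have "\<dots> = real (X' div B ^ e')"
      using floor_divide_of_nat_eq[of X' "B ^ e'", where ?'a = real] by simp
    finally show ?thesis .
  qed
  have 1: "ev inp M (eFloor x (EBin Divide (EVar X) (ePow (x + 20) t))) \<sigma> = real (X' div B ^ t')"
    using t t' by (intro fl) auto
  have 2: "ev inp M (eFloor x (EBin Divide (EVar X) (ePow (x + 20) (EBin Plus t (ECst 1))))) \<sigma>
      = real (X' div B ^ (t' + 1))"
    using t t' by (intro fl) auto
  have "X' div B ^ t' = B * (X' div B ^ (t' + 1)) + dgt B X' t'"
    unfolding dgt_def by (simp add: div_mult2_eq mult.commute[of B])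
  then have "real (X' div B ^ t') = real B * real (X' div B ^ (t' + 1)) + real (dgt B X' t')"
    by (metis of_nat_add of_nat_mult)
  then show ?thesis unfolding eDig_def ev.simps 1 2 using B by simp
qed

text \<open>The fuel \<open>W\<close> is at least every loop bound of the objective, so its cap in
  \<open>EIter\<close> never changes a value.\<close>

locale sem =
  fixes inp :: "nat \<Rightarrow> real" and M W d n k m B :: nat and S :: real
  assumes pos: "0 < k" "0 < m" "0 < B"
    and W: "d \<le> W" "n \<le> W" "k \<le> W" "m \<le> W" "2 * (k * m) \<le> W"
begin

definition par :: "(nat \<Rightarrow> real) \<Rightarrow> bool" where
  "par \<sigma> \<longleftrightarrow> \<sigma> 0 = real W \<and> \<sigma> 1 = real d \<and> \<sigma> 2 = real n \<and> \<sigma> 3 = real k \<and> \<sigma> 4 = real m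
     \<and> \<sigma> 5 = real B \<and> \<sigma> 6 = S"

definition en :: "nat \<Rightarrow> nat \<Rightarrow> real" where
  "en i l = lookup inp M (real (i * n + l + 1))"

definition rows :: "nat \<Rightarrow> nat \<Rightarrow> nat \<Rightarrow> nat" where
  "rows X j s = dgt B X ((j * m + s) * 2)"

definition wts :: "nat \<Rightarrow> nat \<Rightarrow> nat \<Rightarrow> nat" where
  "wts X j s = dgt B X ((j * m + s) * 2 + 1) + 1"

lemma par_upd [simp]: "par \<sigma> \<Longrightarrow> 8 \<le> x \<Longrightarrow> par (\<sigma>(x := a))"
  by (simp add: par_def)

lemma parD [simp]:
  "par \<sigma> \<Longrightarrow> \<sigma> 0 = real W" "par \<sigma> \<Longrightarrow> \<sigma> (Suc 0) = real d" "par \<sigma> \<Longrightarrow> \<sigma> 2 = real n"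
  "par \<sigma> \<Longrightarrow> \<sigma> 3 = real k" "par \<sigma> \<Longrightarrow> \<sigma> 4 = real m" "par \<sigma> \<Longrightarrow> \<sigma> 5 = real B" "par \<sigma> \<Longrightarrow> \<sigma> 6 = S"
  by (simp_all add: par_def)

lemma pos_le:
  assumes "j < k" "s < m"
  shows "real ((j * m + s) * 2 + 1) + 1 \<le> real W"
proof -
  have "(j + 1) * m \<le> k * m" using assms by (intro mult_right_mono) auto
  then have "(j * m + s) * 2 + 2 \<le> 2 * (k * m)" using assms by simp
  then have "(j * m + s) * 2 + 2 \<le> W" using W by linarith
  then show ?thesis by linarith
qed

lemma ev_rows:
  assumes "par \<sigma>" "8 \<le> x" "X < x" "\<sigma> X = real X'" "X' \<le> W" "j < x" "\<sigma> j = real j'" "j' < k"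
    and s: "\<And>\<sigma>'. (\<forall>y<x. \<sigma>' y = \<sigma> y) \<Longrightarrow> ev inp M s \<sigma>' = real s'" "s' < m"
  shows "ev inp M (eRow x X j s) \<sigma> = real (rows X' j' s')"
    and "ev inp M (eWt x X j s) \<sigma> = real (wts X' j' s')"
proof -
  have p: "ev inp M (ePos j s) \<sigma>' = real ((j' * m + s') * 2)" if "\<forall>y<x. \<sigma>' y = \<sigma> y" for \<sigma>'
  proof -
    have "\<sigma>' j = real j'" "\<sigma>' 4 = real m" using that assms by auto
    then show ?thesis using s(1)[OF that] by (simp add: ePos_def)
  qed
  have l: "real ((j' * m + s') * 2 + 1) + 1 \<le> real W" by (rule pos_le) fact+
  show "ev inp M (eRow x X j s) \<sigma> = real (rows X' j' s')"
    unfolding eRow_def rows_def using assms l pos p by (intro ev_eDig) auto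
  have "ev inp M (eDig x X (EBin Plus (ePos j s) (ECst 1))) \<sigma> = real (dgt B X' ((j' * m + s') * 2 + 1))"
    using assms l pos p by (intro ev_eDig) auto
  then show "ev inp M (eWt x X j s) \<sigma> = real (wts X' j' s')"
    by (simp add: eWt_def wts_def)
qed

lemma ev_eA:
  assumes "par \<sigma>" "ev inp M i \<sigma> = real i'" "ev inp M l \<sigma> = real l'"
  shows "ev inp M (eA i l) \<sigma> = en i' l'"
  using assms by (simp add: eA_def en_def add_ac)

context
  fixes X X' :: nat
  assumes X': "X' \<le> W"
begin

interpretation candidate en d n k m "rows X'" "wts X'" .

lemma ev_eDir:
  assumes "par \<sigma>" "8 \<le> x" "X < x" "\<sigma> X = real X'" "j < x" "\<sigma> j = real j'" "j' < k" "l < x" "\<sigma> l = real l'"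
  shows "ev inp M (eDir x X j l) \<sigma> = dir j' l'"
proof -
  have "ev inp M (eSum x (EVar 4)
     (EBin Divide (eA (eRow (x + 20) X j (EVar (x + 1))) (EVar l)) (eWt (x + 20) X j (EVar (x + 1))))) \<sigma>
    = (\<Sum>s<m. en (rows X' j' s) l' / real (wts X' j' s))"
  proof (rule ev_eSum)
    fix a s assume "s < m"
    define \<sigma>' where "\<sigma>' = \<sigma>(x := a, Suc x := real s)"
    have par: "par \<sigma>'" using assms unfolding \<sigma>'_def by simp
    have "ev inp M (eRow (x + 20) X j (EVar (x + 1))) \<sigma>' = real (rows X' j' s)"
      using assms par X' \<open>s < m\<close> by (intro ev_rows) (auto simp: \<sigma>'_def)
    then have 1: "ev inp M (eA (eRow (x + 20) X j (EVar (x + 1))) (EVar l)) \<sigma>' = en (rows X' j' s) l'"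
      using assms par by (intro ev_eA) (auto simp: \<sigma>'_def)
    have 2: "ev inp M (eWt (x + 20) X j (EVar (x + 1))) \<sigma>' = real (wts X' j' s)"
      using assms par X' \<open>s < m\<close> by (intro ev_rows) (auto simp: \<sigma>'_def)
    show "ev inp M (EBin Divide (eA (eRow (x + 20) X j (EVar (x + 1))) (EVar l))
       (eWt (x + 20) X j (EVar (x + 1)))) (\<sigma>(x := a, Suc x := real s))
      = en (rows X' j' s) l' / real (wts X' j' s)"
      using 1 2 unfolding \<sigma>'_def[symmetric] by simp
  qed (use assms W in auto)
  then show ?thesis using assms by (simp add: eDir_def dir_def)
qed

lemma ev_eDot:
  assumes "par \<sigma>" "8 \<le> x" "X < x" "\<sigma> X = real X'" "i < x" "\<sigma> i = real i'" "j < x" "\<sigma> j = real j'" "j' < k"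
  shows "ev inp M (eDot x X i j) \<sigma> = dot i' j'"
  unfolding eDot_def dot_def
proof (rule ev_eSum)
  fix a l assume "l < n"
  define \<sigma>' where "\<sigma>' = \<sigma>(x := a, Suc x := real l)"
  have "ev inp M (eA (EVar i) (EVar (x + 1))) \<sigma>' = en i' l"
    using assms by (intro ev_eA) (auto simp: \<sigma>'_def)
  moreover have "ev inp M (eDir (x + 20) X j (x + 1)) \<sigma>' = dir j' l"
    using assms by (intro ev_eDir) (auto simp: \<sigma>'_def)
  ultimately show "ev inp M (EBin Times (eA (EVar i) (EVar (x + 1))) (eDir (x + 20) X j (x + 1)))
     (\<sigma>(x := a, Suc x := real l)) = en i' l * dir j' l"
    unfolding \<sigma>'_def[symmetric] by simp
qed (use assms W in auto)

lemma ev_eNrm: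
  assumes "par \<sigma>" "8 \<le> x" "X < x" "\<sigma> X = real X'" "j < x" "\<sigma> j = real j'" "j' < k"
  shows "ev inp M (eNrm x X j) \<sigma> = nrm j'"
  unfolding eNrm_def nrm_def
proof (rule ev_eSum)
  fix a l assume "l < n"
  have "ev inp M (eDir (x + 20) X j (x + 1)) (\<sigma>(x := a, Suc x := real l)) = dir j' l"
    using assms by (intro ev_eDir) auto
  then show "ev inp M (eSq (eDir (x + 20) X j (x + 1))) (\<sigma>(x := a, Suc x := real l)) = (dir j' l)\<^sup>2"
    by simp
qed (use assms W in auto)

lemma ev_eSeed:
  assumes "par \<sigma>" "8 \<le> x" "X < x" "\<sigma> X = real X'" "\<sigma> i = real i'" "j < x" "\<sigma> j = real j'" "j' < k"
  shows "ev inp M (eSeed x X i j c e) \<sigma> = (if rows X' j' 0 = i' then ev inp M c \<sigma> else ev inp M e \<sigma>)"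
  unfolding eSeed_def using assms X' pos by (intro ev_eEq ev_rows) auto

lemma ev_eCf:
  assumes "par \<sigma>" "8 \<le> x" "X < x" "\<sigma> X = real X'" "i < x" "\<sigma> i = real i'" "j < x" "\<sigma> j = real j'" "j' < k"
  shows "ev inp M (eCf x X i j) \<sigma> = cf i' j'"
proof -
  have "ev inp M (eWt x X j (ECst 0)) \<sigma> = real (wts X' j' 0)"
    using assms X' pos by (intro ev_rows) auto
  then show ?thesis
    unfolding eCf_def cf_def using assms by (simp add: ev_eSeed ev_eDot ev_eNrm)
qed

lemma ev_eErr:
  assumes "par \<sigma>" "8 \<le> x" "X < x" "\<sigma> X = real X'" "i < x" "\<sigma> i = real i'" "j < x" "\<sigma> j = real j'" "j' < k"
  shows "ev inp M (eErr x X i j) \<sigma> = err i' j'"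
  unfolding eErr_def err_def
proof (rule ev_eSum)
  fix a l assume "l < n"
  define \<sigma>' where "\<sigma>' = \<sigma>(x := a, Suc x := real l)"
  have "ev inp M (eA (EVar i) (EVar (x + 1))) \<sigma>' = en i' l"
    using assms by (intro ev_eA) (auto simp: \<sigma>'_def)
  moreover have "ev inp M (eDir (x + 20) X j (x + 1)) \<sigma>' = dir j' l"
    using assms by (intro ev_eDir) (auto simp: \<sigma>'_def)
  moreover have "ev inp M (eCf (x + 20) X i j) \<sigma>' = cf i' j'"
    using assms by (intro ev_eCf) (auto simp: \<sigma>'_def)
  ultimately show "ev inp M (eSq (EBin Minus (eA (EVar i) (EVar (x + 1)))
     (EBin Times (eCf (x + 20) X i j) (eDir (x + 20) X j (x + 1))))) (\<sigma>(x := a, Suc x := real l))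
     = (en i' l - cf i' j' * dir j' l)\<^sup>2"
    unfolding \<sigma>'_def[symmetric] by simp
qed (use assms W in auto)

lemma ev_eKey:
  assumes "par \<sigma>" "8 \<le> x" "X < x" "\<sigma> X = real X'" "i < x" "\<sigma> i = real i'" "j < x" "\<sigma> j = real j'" "j' < k"
  shows "ev inp M (eKey x X i j) \<sigma> = key i' j'"
  unfolding eKey_def key_def using assms by (simp add: ev_eSeed ev_eErr)

lemma ev_eLab:
  assumes "par \<sigma>" "8 \<le> x" "X < x" "\<sigma> X = real X'" "i < x" "\<sigma> i = real i'"
  shows "ev inp M (eLab x X i) \<sigma> = real (lab i')"
proof -
  let ?g = "\<lambda>j b. if key i' j < key i' b then j else b"
  let ?f = "\<lambda>j a. ev inp M (EIf (eKey (x + 20) X i (x + 1)) (eKey (x + 20) X i x) (EVar (x + 1)) (EVar x))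
     (\<sigma>(x := a, x + 1 := real j))"
  have "iter ?f k (real 0) = real (iter ?g k 0)"
  proof (rule iter_map[where P="\<lambda>b. b < k"])
    fix j b assume j: "j < k" and b: "b < k"
    define \<sigma>' where "\<sigma>' = \<sigma>(x := real b, x + 1 := real j)"
    have "ev inp M (eKey (x + 20) X i (x + 1)) \<sigma>' = key i' j"
      using assms j by (intro ev_eKey) (auto simp: \<sigma>'_def)
    moreover have "ev inp M (eKey (x + 20) X i x) \<sigma>' = key i' b"
      using assms b by (intro ev_eKey) (auto simp: \<sigma>'_def)
    moreover have "\<sigma>' x = real b" "\<sigma>' (Suc x) = real j" unfolding \<sigma>'_def by simp_all
    ultimately show "?g j b < k \<and> ?f j (real b) = real (?g j b)"
      using j b unfolding \<sigma>'_def[symmetric] by simp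
  qed (use pos in simp)
  then show ?thesis
    unfolding eLab_def lab_def using assms W by simp
qed

lemma ev_eIs:
  assumes "par \<sigma>" "8 \<le> x" "X < x" "\<sigma> X = real X'" "i < x" "\<sigma> i = real i'" "\<sigma> j = real j'"
  shows "ev inp M (eIs x X i j c e) \<sigma> = (if lab i' = j' then ev inp M c \<sigma> else ev inp M e \<sigma>)"
  unfolding eIs_def using assms by (intro ev_eEq ev_eLab) auto

lemma ev_eColsq:
  assumes "par \<sigma>" "8 \<le> x" "X < x" "\<sigma> X = real X'" "j < x" "\<sigma> j = real j'" "j' < k"
  shows "ev inp M (eColsq x X j) \<sigma> = colsq j'"
  unfolding eColsq_def colsq_def
proof (rule ev_eSum)
  fix a i assume "i < d"
  define \<sigma>' where "\<sigma>' = \<sigma>(x := a, Suc x := real i)"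
  have "ev inp M (eIs (x + 20) X (x + 1) j (eSq (eCf (x + 20) X (x + 1) j)) (ECst 0)) \<sigma>'
    = (if lab i = j' then ev inp M (eSq (eCf (x + 20) X (x + 1) j)) \<sigma>' else ev inp M (ECst 0) \<sigma>')"
    using assms by (intro ev_eIs) (auto simp: \<sigma>'_def)
  moreover have "ev inp M (eCf (x + 20) X (x + 1) j) \<sigma>' = cf i j'"
    using assms by (intro ev_eCf) (auto simp: \<sigma>'_def)
  ultimately show "ev inp M (eIs (x + 20) X (x + 1) j (eSq (eCf (x + 20) X (x + 1) j)) (ECst 0))
     (\<sigma>(x := a, Suc x := real i)) = (if lab i = j' then (cf i j')\<^sup>2 else 0)"
    unfolding \<sigma>'_def[symmetric] by simp
qed (use assms W in auto)

lemma ev_eCost: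
  assumes "par \<sigma>" "8 \<le> x" "X < x" "\<sigma> X = real X'" and S: "S = total"
  shows "ev inp M (eCost x X) \<sigma> = cost"
proof -
  have 1: "ev inp M (eSum x (EVar 1) (eSum (x + 20) (EVar 3)
       (eIs (x + 40) X (x + 1) (x + 21) (eErr (x + 40) X (x + 1) (x + 21)) (ECst 0)))) \<sigma>
    = (\<Sum>i<d. \<Sum>j<k. if lab i = j then err i j else 0)"
  proof (rule ev_eSum)
    fix a i assume "i < d"
    show "ev inp M (eSum (x + 20) (EVar 3) (eIs (x + 40) X (x + 1) (x + 21)
        (eErr (x + 40) X (x + 1) (x + 21)) (ECst 0))) (\<sigma>(x := a, Suc x := real i))
      = (\<Sum>j<k. if lab i = j then err i j else 0)"
    proof (rule ev_eSum)
      fix a' j assume "j < k"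
      define \<sigma>' where "\<sigma>' = \<sigma>(x := a, Suc x := real i, x + 20 := a', Suc (x + 20) := real j)"
      have "ev inp M (eIs (x + 40) X (x + 1) (x + 21) (eErr (x + 40) X (x + 1) (x + 21)) (ECst 0)) \<sigma>'
        = (if lab i = j then ev inp M (eErr (x + 40) X (x + 1) (x + 21)) \<sigma>' else ev inp M (ECst 0) \<sigma>')"
        using assms(1-4) by (intro ev_eIs) (auto simp: \<sigma>'_def)
      moreover have "ev inp M (eErr (x + 40) X (x + 1) (x + 21)) \<sigma>' = err i j"
        using assms(1-4) \<open>j < k\<close> by (intro ev_eErr) (auto simp: \<sigma>'_def)
      ultimately show "ev inp M (eIs (x + 40) X (x + 1) (x + 21)
          (eErr (x + 40) X (x + 1) (x + 21)) (ECst 0))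
         (\<sigma>(x := a, Suc x := real i, x + 20 := a', Suc (x + 20) := real j)) = (if lab i = j then err i j else 0)"
        unfolding \<sigma>'_def[symmetric] by simp
    qed (use assms W in auto)
  qed (use assms W in auto)
  have 2: "ev inp M (eSum x (EVar 3) (EIf (ECst 0) (eColsq (x + 20) X (x + 1)) (ECst 0)
       (EBin Plus (EBin Times (ECst 2) (EVar 6)) (ECst 1)))) \<sigma>
    = (\<Sum>j<k. if 0 < colsq j then 0 else 2 * total + 1)"
  proof (rule ev_eSum)
    fix a j assume "j < k"
    define \<sigma>' where "\<sigma>' = \<sigma>(x := a, Suc x := real j)"
    have "ev inp M (eColsq (x + 20) X (x + 1)) \<sigma>' = colsq j"
      using assms(1-4) \<open>j < k\<close> by (intro ev_eColsq) (auto simp: \<sigma>'_def)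
    moreover have "\<sigma>' 6 = total" using assms unfolding \<sigma>'_def by simp
    ultimately show "ev inp M (EIf (ECst 0) (eColsq (x + 20) X (x + 1)) (ECst 0)
       (EBin Plus (EBin Times (ECst 2) (EVar 6)) (ECst 1))) (\<sigma>(x := a, Suc x := real j))
       = (if 0 < colsq j then 0 else 2 * total + 1)"
      unfolding \<sigma>'_def[symmetric] by simp
  qed (use assms W in auto)
  show ?thesis unfolding eCost_def cost_def using 1 2 by simp
qed

lemma ev_eOut:
  assumes "par \<sigma>" "8 \<le> x" "X < x" "\<sigma> X = real X'" "t < x" "\<sigma> t = real t'" "t' \<le> W"
  shows "ev inp M (eOut x X t) \<sigma> = out (t' div k) (t' mod k)"
proof -
  define i' where "i' = t' div k"
  define j' where "j' = t' mod k"
  have W1: "0 < W" using W(3) pos by simp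
  have "real t' / real k \<le> real t'" using pos by (simp add: divide_le_eq mult_le_cancel_left1)
  then have "real t' / real k \<le> real W" using \<open>t' \<le> W\<close> by linarith
  then have "ev inp M (eFloor (x + 20) (EBin Divide (EVar t) (EVar 3))) \<sigma> = real_of_int \<lfloor>real t' / real k\<rfloor>"
    using assms by (intro ev_eFloor) auto
  then have i: "ev inp M (eFloor (x + 20) (EBin Divide (EVar t) (EVar 3))) \<sigma> = real i'"
    unfolding i'_def using floor_divide_of_nat_eq[of t' k, where ?'a = real] by simp
  have j: "real t' - real k * real i' = real j'"
    unfolding i'_def j'_def
    by (metis add_diff_cancel_left' mult_div_mod_eq of_nat_add of_nat_mult)
  \<comment> \<open>The valuations inside the two one-round loops, whose counters are 0.\<close>
  define \<sigma>1 where "\<sigma>1 = \<sigma>(x := real i', Suc x := 0)"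
  define \<sigma>2 where "\<sigma>2 = \<sigma>1(x + 20 := real j', Suc (x + 20) := 0)"
  have s2: "par \<sigma>2" "\<sigma>2 X = real X'" "\<sigma>2 x = real i'" "\<sigma>2 (x + 20) = real j'"
    using assms unfolding \<sigma>2_def \<sigma>1_def by auto
  have j'k: "j' < k" unfolding j'_def using pos by simp
  have isv: "ev inp M (eIs (x + 40) X x (x + 20)
         (EBin Divide (eCf (x + 40) X x (x + 20)) (ESqrt (eColsq (x + 40) X (x + 20)))) (ECst 0)) \<sigma>2
    = out i' j'"
  proof -
    have "ev inp M (eCf (x + 40) X x (x + 20)) \<sigma>2 = cf i' j'"
      using s2 j'k assms by (intro ev_eCf) auto
    moreover have "ev inp M (eColsq (x + 40) X (x + 20)) \<sigma>2 = colsq j'"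
      using s2 j'k assms by (intro ev_eColsq) auto
    ultimately show ?thesis
      unfolding out_def using s2 assms by (subst ev_eIs) auto
  qed
  have one: "nat \<lceil>min 1 (real W)\<rceil> = 1" using W1 by simp
  have s1: "\<sigma>1 0 = real W" "\<sigma>1 t - \<sigma>1 3 * \<sigma>1 x = real j'" using assms j unfolding \<sigma>1_def by auto
  have "ev inp M (EIter (x + 20) (ECst 1) (EBin Minus (EVar t) (EBin Times (EVar 3) (EVar x)))
       (eIs (x + 40) X x (x + 20)
         (EBin Divide (eCf (x + 40) X x (x + 20)) (ESqrt (eColsq (x + 40) X (x + 20)))) (ECst 0))) \<sigma>1
     = out i' j'"
    using s1 one isv unfolding \<sigma>2_def by simp
  then show ?thesis unfolding eOut_def i'_def[symmetric] j'_def[symmetric]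
    using assms one i unfolding \<sigma>1_def by simp
qed

end

abbreviation costs :: "nat \<Rightarrow> real" where
  "costs X \<equiv> candidate.cost en d n k m (rows X) (wts X)"

lemma ev_eBest:
  assumes "par \<sigma>" "8 \<le> x" and S: "S = candidate.total en d n" and W0: "0 < W"
  shows "\<exists>X<W. ev inp M (eBest x) \<sigma> = real X \<and> (\<forall>Y<W. costs X \<le> costs Y)"
proof -
  let ?g = "\<lambda>j b. if costs j < costs b then j else b"
  let ?f = "\<lambda>j a. ev inp M (EIf (eCost (x + 20) (x + 1)) (eCost (x + 20) x) (EVar (x + 1)) (EVar x))
     (\<sigma>(x := a, x + 1 := real j))"
  have "iter ?f W (real 0) = real (iter ?g W 0)"
  proof (rule iter_map[where P="\<lambda>b. b < W"])
    fix j b assume j: "j < W" and b: "b < W"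
    define \<sigma>' where "\<sigma>' = \<sigma>(x := real b, x + 1 := real j)"
    have "ev inp M (eCost (x + 20) (x + 1)) \<sigma>' = costs j"
      using assms(1,2) j by (intro ev_eCost S) (auto simp: \<sigma>'_def)
    moreover have "ev inp M (eCost (x + 20) x) \<sigma>' = costs b"
      using assms(1,2) b by (intro ev_eCost S) (auto simp: \<sigma>'_def)
    moreover have "\<sigma>' x = real b" "\<sigma>' (Suc x) = real j" unfolding \<sigma>'_def by simp_all
    ultimately show "?g j b < W \<and> ?f j (real b) = real (?g j b)"
      using j b unfolding \<sigma>'_def[symmetric] by simp
  qed (use W0 in simp)
  then have "ev inp M (eBest x) \<sigma> = real (iter ?g W 0)"
    unfolding eBest_def using assms by simp
  then show ?thesis using iter_argmin[OF W0, of costs] by blast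
qed

end

lemma ev_eTotal:
  assumes "\<sigma> 0 = real F" "\<sigma> 1 = real d" "\<sigma> 2 = real n" "d * n \<le> F"
  shows "ev inp M (eTotal x) \<sigma> = (\<Sum>q<d * n. (lookup inp M (real (q + 1)))\<^sup>2)"
  unfolding eTotal_def
  by (rule ev_eSum) (use assms in \<open>auto simp: add_ac simp del: of_nat_mult simp flip: of_nat_mult\<close>)

lemma ev_ePower:
  assumes "\<sigma> 0 = real F" "\<sigma> 3 = real k" "\<sigma> 4 = real m" "\<sigma> 5 = real B" "k \<le> F" "m \<le> F" "8 \<le> x"
  shows "ev inp M (ePower x) \<sigma> = real (B ^ (2 * (k * m)))"
proof -
  have "ev inp M (ePower x) \<sigma> = iter (\<lambda>j a. iter (\<lambda>j a. a * (real B)\<^sup>2) m a) k 1"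
    unfolding ePower_def using assms by (simp add: min_absorb1)
  also have "\<dots> = ((real B)\<^sup>2 ^ m) ^ k" unfolding iter_mult by simp
  also have "\<dots> = real (B ^ (2 * (k * m)))" by (simp add: power_mult[symmetric] mult_ac)
  finally show ?thesis .
qed

lemma exists_digits:
  assumes "\<And>t. t < N \<Longrightarrow> f t < B"
  shows "\<exists>X<B ^ N. \<forall>t<N. dgt B X t = f t"
  using assms
proof (induction N arbitrary: f)
  case 0
  then show ?case by simp
next
  case (Suc N)
  have "f (Suc t) < B" if "t < N" for t using Suc.prems that by simp
  from Suc.IH[where f="\<lambda>t. f (Suc t)", OF this] obtain X where X: "X < B ^ N" "\<forall>t<N. dgt B X t = f (Suc t)"
    by blast
  have f0: "f 0 < B" using Suc.prems by simp
  have "X * B + f 0 < (X + 1) * B" using f0 by simp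
  also have "\<dots> \<le> B ^ N * B" using X(1) by (intro mult_right_mono) auto
  finally have "X * B + f 0 < B ^ Suc N" by (simp add: mult.commute)
  moreover have "dgt B (X * B + f 0) t = f t" if "t < Suc N" for t
  proof (cases t)
    case 0
    then show ?thesis using f0 by (simp add: dgt_def)
  next
    case (Suc t')
    have "(X * B + f 0) div B = X" using f0 by simp
    then have "dgt B (X * B + f 0) (Suc t') = dgt B X t'"
      unfolding dgt_def by (simp add: div_mult2_eq)
    then show ?thesis using Suc X(2) that by simp
  qed
  ultimately show ?case by blast
qed

section \<open>The program\<close>

text \<open>The output area lies between the input and the real registers, so that compiled
  expressions do not touch it; natural cell 6 is used for counting.\<close>

definition prelude :: com where
  "prelude = Seq (NAssign (NConst 3) (NConst 1)) (While (NLess (NAt (NConst 6)) (NAt (NConst 0)))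
     (Seq (NAssign (NConst 5) (NAdd (NAt (NConst 5)) (NAt (NConst 1))))
     (Seq (NAssign (NConst 3) (NAdd (NAt (NConst 3)) (NAdd (NAt (NConst 1)) (NAt (NConst 2)))))
          (NAssign (NConst 6) (NAdd (NAt (NConst 6)) (NConst 1))))))"

primrec set_regs :: "nat \<Rightarrow> rexp list \<Rightarrow> com" where
  "set_regs r [] = Skip"
| "set_regs r (e # es) = Seq (RAssign (reg r) e) (set_regs (Suc r) es)"

text \<open>The first fuel is the address of the registers, which exceeds the number of matrix
  entries. The registers of \<open>B\<close> and of the squared norm get placeholders.\<close>

definition init_regs :: com where
  "init_regs = Seq (ceil_into 6 (RDiv (ROfNat (NConst 4)) (RAt (NConst 0))))
     (set_regs 0 [ROfNat (NAt (NConst 3)), ROfNat (NAt (NConst 0)), ROfNat (NAt (NConst 1)),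
        ROfNat (NAt (NConst 2)), ROfNat (NAt (NConst 6)), ROfNat (NConst 0), ROfNat (NConst 0),
        RAt (NConst 0)])"

definition grid_size :: rexp where
  "grid_size = RDiv (RMul (RMul (ROfNat (NConst 5)) (ROfNat (NAdd (NAt (NConst 5)) (NConst 1))))
     (RAdd (RAt (reg 6)) (ROfNat (NConst 1)))) (RAt (reg 7))"

text \<open>The fuel grows in stages, because each one must be computed with its predecessor: the
  squared norm gives \<open>B\<close>, and fuel \<open>B\<close> suffices to compute the number of
  candidates.\<close>

definition search :: com where
  "search = Seq (compile (eTotal 20) 8)
     (Seq (RAssign (reg 6) (RAt (reg 8)))
     (Seq (ceil_into 6 grid_size)
     (Seq (RAssign (reg 5) (ROfNat (NAt (NConst 6))))
     (Seq (RAssign (reg 0) (ROfNat (NAt (NConst 6))))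
     (Seq (compile (ePower 20) 8)
     (Seq (RAssign (reg 0) (RAt (reg 8)))
          (compile (eBest 20) 8)))))))"

text \<open>The bound on the counter is a product of reals, since naturals cannot be multiplied.
  Cell 0 holds \<open>d\<close> until the end, when the output address replaces it.\<close>

definition write_out :: com where
  "write_out = Seq (NAssign (NConst 6) (NConst 0))
     (Seq (While (RLess (ROfNat (NAt (NConst 6))) (RMul (RAt (reg 1)) (RAt (reg 3))))
        (Seq (RAssign (reg 9) (ROfNat (NAt (NConst 6))))
        (Seq (compile (eOut 20 8 9) 10)
        (Seq (RAssign (NAdd (NAdd (NAt (NConst 5)) (NConst 1)) (NAt (NConst 6))) (RAt (reg 10)))
             (NAssign (NConst 6) (NAdd (NAt (NConst 6)) (NConst 1)))))))
       (NAssign (NConst 0) (NAdd (NAt (NConst 5)) (NConst 1))))"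

definition program :: com where
  "program = Seq prelude (Seq init_regs (Seq search write_out))"

definition run_time :: "nat \<Rightarrow> nat" where
  "run_time F = tm F (eTotal 20) + tm F (ePower 20) + tm F (eBest 20)
     + F * (tm F (eOut 20 8 9) + 100) + 200 * F + 1000"

lemma sum_flatten: "(\<Sum>q<d * n. f q) = (\<Sum>i<d. \<Sum>l<n. f (i * n + l :: nat) :: real)"
proof -
  have "(\<Sum>q<d * n. f q) = (\<Sum>i<d. sum f {i * n..<i * n + n})"
    by (rule sum.nat_group[symmetric])
  also have "\<dots> = (\<Sum>i<d. \<Sum>l<n. f (i * n + l))"
    by (simp add: sum.atLeastLessThan_shift_0[of _ "_ * n"] atLeast0LessThan)
  finally show ?thesis .
qed

section \<open>One instance and the sizes of its parameters\<close>

locale instance_run =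
  fixes A :: "real mat" and d n k :: nat and \<epsilon> :: real
  assumes n0: "0 < n" and k0: "0 < k" and kd: "k \<le> d" and \<epsilon>0: "0 < \<epsilon>" and \<epsilon>1: "\<epsilon> < 1"
    and A: "A \<in> carrier_mat d n"
begin

definition inp :: "nat \<Rightarrow> real" where
  "inp = snd (input_state A k \<epsilon>)"

definition base :: nat where
  "base = d * n + d * k + 1"

definition m :: nat where
  "m = nat \<lceil>4 / \<epsilon>\<rceil>"

definition S :: real where
  "S = (\<Sum>q<d * n. (lookup inp (d * n) (real (q + 1)))\<^sup>2)"

text \<open>The increments by 1 make \<open>B\<close> dominate \<open>d * n\<close> and
  \<open>m\<close> even for the zero matrix. So \<open>B\<close> also works as a base for row digits
  and as a fuel.\<close>

definition B :: nat where
  "B = nat \<lceil>5 * real (d * n + 1) * (S + 1) / \<epsilon>\<rceil>"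

text \<open>One digit for the row and one for the weight of each of \<open>k * m\<close>
  samples.\<close>

definition W :: nat where
  "W = B ^ (2 * (k * m))"

lemma d0: "0 < d" using k0 kd by linarith

lemma S0: "0 \<le> S" unfolding S_def by (simp add: sum_nonneg)

lemma m_ge: "4 / \<epsilon> \<le> real m" unfolding m_def by linarith

lemma m_le: "real m \<le> 5 / \<epsilon>"
proof -
  have "real m \<le> 4 / \<epsilon> + 1" unfolding m_def using \<epsilon>0 by (simp add: of_nat_ceiling)
  also have "\<dots> \<le> 5 / \<epsilon>" using \<epsilon>0 \<epsilon>1 by (simp add: field_simps)
  finally show ?thesis .
qed

lemma m0: "0 < m"
proof -
  have "0 < 4 / \<epsilon>" using \<epsilon>0 by simp
  then show ?thesis using m_ge by linarith
qed

lemma B_ge: "5 * real (d * n + 1) * (S + 1) / \<epsilon> \<le> real B" unfolding B_def by linarith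

lemma B_ge_dn: "5 * real (d * n + 1) / \<epsilon> \<le> real B"
proof -
  have "5 * real (d * n + 1) * 1 \<le> 5 * real (d * n + 1) * (S + 1)"
    using S0 by (intro mult_left_mono) auto
  then have "5 * real (d * n + 1) / \<epsilon> \<le> 5 * real (d * n + 1) * (S + 1) / \<epsilon>"
    using \<epsilon>0 by (intro divide_right_mono) auto
  then show ?thesis using B_ge by linarith
qed

lemma B_bounds: "5 * (d * n + 1) \<le> B" "m \<le> B"
proof -
  have "5 * real (d * n + 1) \<le> 5 * real (d * n + 1) / \<epsilon>"
    using \<epsilon>0 \<epsilon>1 by (simp add: le_divide_eq mult_left_le)
  then have "real (5 * (d * n + 1)) \<le> real B" using B_ge_dn by simp
  then show "5 * (d * n + 1) \<le> B" by (simp only: of_nat_le_iff)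
  have "5 / \<epsilon> \<le> 5 * real (d * n + 1) / \<epsilon>" using \<epsilon>0 by (intro divide_right_mono) auto
  then show "m \<le> B" using m_le B_ge_dn by linarith
qed

lemma d_le: "d \<le> d * n" "n \<le> d * n" "k \<le> d * n"
proof -
  show "d \<le> d * n" "n \<le> d * n" using n0 d0 by auto
  then show "k \<le> d * n" using kd by linarith
qed

lemma dn_le: "d * n \<le> B"
  by (rule le_trans[OF _ B_bounds(1)]) simp

lemma B0: "5 \<le> B"
  by (rule le_trans[OF _ B_bounds(1)]) simp

text \<open>The output area may be larger than the input, but \<open>d * k\<close> is at most the
  square of \<open>d * n\<close>. Hence the detour through the square of \<open>B\<close>.\<close>

lemma W_ge: "B\<^sup>2 \<le> W" "B \<le> W" "2 * (k * m) \<le> W" "base \<le> W" "d * k \<le> W" "d * n \<le> W"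
proof -
  have km: "2 \<le> 2 * (k * m)" using k0 m0 by simp
  show B2: "B\<^sup>2 \<le> W" unfolding W_def using B0 km by (intro power_increasing) auto
  show "B \<le> W" using le_trans[OF le_square[of B]] B2 by (simp add: power2_eq_square)
  have "2 * (k * m) < 2 ^ (2 * (k * m))" by (rule less_exp)
  also have "\<dots> \<le> W" unfolding W_def using B0 by (intro power_mono) auto
  finally show "2 * (k * m) \<le> W" by simp
  define q where "q = d * n"
  have "d * k \<le> q * q" using d_le unfolding q_def by (intro mult_mono) auto
  then have "base \<le> (q + 1) * (q + 1)" unfolding base_def q_def[symmetric] by simp
  also have "\<dots> \<le> B * B" using B_bounds(1)[folded q_def] by (intro mult_mono) auto
  finally show base: "base \<le> W" using B2 by (simp add: power2_eq_square)
  then show "d * k \<le> W" "d * n \<le> W" unfolding base_def by simp_all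
qed

sublocale machine inp "d * n" base W
  by standard (use W_ge in \<open>auto simp: base_def\<close>)

sublocale sem inp "d * n" W d n k m B S
proof
  have "d \<le> B" "n \<le> B" "k \<le> B" using d_le dn_le by linarith+
  then show "d \<le> W" "n \<le> W" "k \<le> W" "m \<le> W" using W_ge(2) B_bounds(2) by linarith+
qed (use k0 m0 B0 W_ge in auto)

lemma en_eq: "i < d \<Longrightarrow> l < n \<Longrightarrow> A $$ (i, l) = en i l"
proof -
  assume il: "i < d" "l < n"
  have "(i + 1) * n \<le> d * n" using il by (intro mult_right_mono) auto
  then have "i * n + l + 1 \<le> d * n" using il by simp
  then have "\<not> real (d * n) < real (i * n + l + 1)" by (simp only: of_nat_less_iff not_less)
  then have "en i l = inp (i * n + l + 1)"
    unfolding en_def lookup_def by (simp only: if_False ceiling_of_nat nat_int)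
  also have "\<dots> = A $$ (i, l)"
    using input_state_entry[of i A l k \<epsilon>] il A unfolding inp_def by (simp add: add_ac)
  finally show ?thesis ..
qed

lemma S_total: "S = candidate.total en d n"
  unfolding S_def candidate.total_def sum_flatten en_def by simp

section \<open>Runs of the phases of the program on one instance\<close>

definition St :: "(nat \<Rightarrow> real) \<Rightarrow> nat set \<Rightarrow> state \<Rightarrow> bool" where
  "St \<sigma> V s \<longleftrightarrow> okst s \<sigma> V \<and> fst s 0 = d \<and> fst s 1 = n \<and> fst s 2 = k"

lemma StD:
  assumes "St \<sigma> V s"
  shows "fst s 0 = d" "fst s 1 = n" "fst s (Suc 0) = n" "fst s 2 = k" "fst s 3 = base" "fst s 5 = d * n"
    "a \<le> d * n \<Longrightarrow> snd s a = inp a" "y \<in> V \<Longrightarrow> snd s (base + y) = \<sigma> y"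
  using assms by (auto simp: St_def okst_def)

lemma St_cong: "St \<sigma> V s \<Longrightarrow> V' \<subseteq> V \<Longrightarrow> (\<And>y. y \<in> V' \<Longrightarrow> \<sigma> y = \<sigma>' y) \<Longrightarrow> St \<sigma>' V' s"
  unfolding St_def okst_def by (simp add: subset_iff)

lemma St_frm: "St \<sigma> V s \<Longrightarrow> frm p s s' \<Longrightarrow> V \<subseteq> {..<p} \<Longrightarrow> St \<sigma> V s'"
  unfolding St_def using okst_frm[of s \<sigma> V p s'] by (simp add: frm_def)

lemma St_cell: "St \<sigma> V s \<Longrightarrow> St \<sigma> V ((fst s)(6 := v), snd s)"
  unfolding St_def okst_def by simp

lemma St_set: "St \<sigma> V s \<Longrightarrow> St (\<sigma>(y := v)) (insert y V) (fst s, (snd s)(base + y := v))"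
  unfolding St_def okst_def by (simp add: base_def)

lemma run_set:
  assumes "St \<sigma> V s" "rval e s = v" "rcost e \<le> 10"
  shows "runs (RAssign (reg y) e) s 15 (\<lambda>s'. St (\<sigma>(y := v)) (insert y V) s' \<and> fst s' = fst s)"
  using St_set[OF assms(1)] assms StD[OF assms(1)] by (intro runs_RAssign) auto

lemma run_compile:
  assumes "St \<sigma> V s" "wfe e V p" "0 \<in> V" "V \<subseteq> {..<p}" "\<sigma> 0 \<le> real W"
  shows "runs (compile e p) s (tm W e)
    (\<lambda>s'. St (\<sigma>(p := ev inp (d * n) e \<sigma>)) (insert p V) s' \<and> frm p s s')"
proof (rule runs_mono[OF runs_compile])
  show "okst s \<sigma> V" using assms unfolding St_def by simp
  fix s' assume s': "frm p s s' \<and> snd s' (base + p) = ev inp (d * n) e \<sigma>"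
  then have "St \<sigma> V s'" using St_frm assms by blast
  then show "St (\<sigma>(p := ev inp (d * n) e \<sigma>)) (insert p V) s' \<and> frm p s s'"
    using s' assms(4) unfolding St_def okst_def by (auto simp: subset_iff)
qed (use assms in auto)

text \<open>The products \<open>d * n\<close> and \<open>d * k\<close> are accumulated by
  \<open>d\<close> additions.\<close>

lemma run_prelude:
  "runs prelude (input_state A k \<epsilon>) (40 * W + 20) (\<lambda>s. St \<sigma> {} s)"
  unfolding prelude_def
proof (rule runs_Seq)
  let ?s0 = "input_state A k \<epsilon>"
  let ?I = "\<lambda>i (s :: state). snd s = inp \<and> fst s 0 = d \<and> fst s 1 = n \<and> fst s 2 = k
     \<and> fst s 3 = i * n + i * k + 1 \<and> fst s 5 = i * n \<and> fst s 6 = i"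
  show "runs (NAssign (NConst 3) (NConst 1)) ?s0 3 (?I 0)"
    using A by (intro runs_NAssign) (auto simp: inp_def input_state_def)
  fix s1 assume s1: "?I 0 s1"
  have "runs (While (NLess (NAt (NConst 6)) (NAt (NConst 0)))
     (Seq (NAssign (NConst 5) (NAdd (NAt (NConst 5)) (NAt (NConst 1))))
     (Seq (NAssign (NConst 3) (NAdd (NAt (NConst 3)) (NAdd (NAt (NConst 1)) (NAt (NConst 2)))))
          (NAssign (NConst 6) (NAdd (NAt (NConst 6)) (NConst 1)))))) s1 (40 * W + 10) (?I d)"
  proof (rule runs_While[where I = ?I and T' = 30])
    show "?I 0 s1" by fact
    fix i s assume i: "i < d" "?I i s"
    have "runs (Seq (NAssign (NConst 5) (NAdd (NAt (NConst 5)) (NAt (NConst 1))))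
     (Seq (NAssign (NConst 3) (NAdd (NAt (NConst 3)) (NAdd (NAt (NConst 1)) (NAt (NConst 2)))))
          (NAssign (NConst 6) (NAdd (NAt (NConst 6)) (NConst 1))))) s 30 (?I (Suc i))"
    proof (rule runs_Seq)
      show "runs (NAssign (NConst 5) (NAdd (NAt (NConst 5)) (NAt (NConst 1)))) s 8
         (\<lambda>s'. s' = ((fst s)(5 := fst s 5 + fst s 1), snd s))"
        by (intro runs_NAssign) auto
      fix s' assume s': "s' = ((fst s)(5 := fst s 5 + fst s 1), snd s)"
      show "runs (Seq (NAssign (NConst 3) (NAdd (NAt (NConst 3)) (NAdd (NAt (NConst 1)) (NAt (NConst 2)))))
          (NAssign (NConst 6) (NAdd (NAt (NConst 6)) (NConst 1)))) s' 22 (?I (Suc i))"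
      proof (rule runs_Seq)
        show "runs (NAssign (NConst 3) (NAdd (NAt (NConst 3)) (NAdd (NAt (NConst 1)) (NAt (NConst 2))))) s' 12
         (\<lambda>s''. s'' = ((fst s')(3 := fst s' 3 + (fst s' 1 + fst s' 2)), snd s'))"
          by (intro runs_NAssign) auto
        fix s'' assume "s'' = ((fst s')(3 := fst s' 3 + (fst s' 1 + fst s' 2)), snd s')"
        then show "runs (NAssign (NConst 6) (NAdd (NAt (NConst 6)) (NConst 1))) s'' 10 (?I (Suc i))"
          using s' i(2) by (intro runs_NAssign) simp_all
      qed simp
    qed simp
    then show "tval (NLess (NAt (NConst 6)) (NAt (NConst 0))) s \<and>
      runs (Seq (NAssign (NConst 5) (NAdd (NAt (NConst 5)) (NAt (NConst 1))))
     (Seq (NAssign (NConst 3) (NAdd (NAt (NConst 3)) (NAdd (NAt (NConst 1)) (NAt (NConst 2)))))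
          (NAssign (NConst 6) (NAdd (NAt (NConst 6)) (NConst 1))))) s 30 (?I (Suc i))"
      using i by simp
  next
    have "d \<le> W" using W_ge(6) d_le by linarith
    then show "d * (tcost (NLess (NAt (NConst 6)) (NAt (NConst 0))) + 30)
      + tcost (NLess (NAt (NConst 6)) (NAt (NConst 0))) \<le> 40 * W + 10" by simp
  qed auto
  then show "runs (While (NLess (NAt (NConst 6)) (NAt (NConst 0)))
     (Seq (NAssign (NConst 5) (NAdd (NAt (NConst 5)) (NAt (NConst 1))))
     (Seq (NAssign (NConst 3) (NAdd (NAt (NConst 3)) (NAdd (NAt (NConst 1)) (NAt (NConst 2)))))
          (NAssign (NConst 6) (NAdd (NAt (NConst 6)) (NConst 1)))))) s1 (40 * W + 10) (\<lambda>s. St \<sigma> {} s)"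
  proof (rule runs_mono)
    fix s assume "?I d s"
    then show "St \<sigma> {} s" unfolding St_def okst_def by (simp add: base_def)
  qed simp
qed simp

text \<open>The contents of registers 0 to 7, with the fuel \<open>f\<close>, the value
  \<open>b\<close> of \<open>B\<close> and the squared norm \<open>v\<close> as the only entries
  that change.\<close>

definition rf :: "real \<Rightarrow> real \<Rightarrow> real \<Rightarrow> nat \<Rightarrow> real" where
  "rf f b v y = (if y = 0 then f else if y = 1 then real d else if y = 2 then real n
     else if y = 3 then real k else if y = 4 then real m else if y = 5 then b
     else if y = 6 then v else \<epsilon>)"

lemma inp0: "inp 0 = \<epsilon>"
  by (simp add: inp_def input_state_def)

text \<open>The values are required in every state with the same natural cells and
  \<open>\<epsilon>\<close>, because the registers change while the list is processed.\<close>

lemma run_set_regs: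
  assumes "St \<sigma> {..<r} s"
    and "\<And>i s'. i < length es \<Longrightarrow> fst s' = fst s \<Longrightarrow> snd s' 0 = \<epsilon> \<Longrightarrow> rval (es ! i) s' = \<sigma> (r + i)"
    and "\<And>e. e \<in> set es \<Longrightarrow> rcost e \<le> 10"
  shows "runs (set_regs r es) s (20 * length es + 1) (\<lambda>s'. St \<sigma> {..<r + length es} s')"
  using assms
proof (induction es arbitrary: r s)
  case Nil
  then show ?case by (simp add: runs_Skip)
next
  case (Cons e es)
  have "snd s 0 = \<epsilon>" using StD(7)[OF Cons.prems(1), of 0] inp0 by simp
  then have v: "rval e s = \<sigma> r" using Cons.prems(2)[of 0 s] by simp
  show ?case unfolding set_regs.simps
  proof (rule runs_Seq[OF run_set[OF Cons.prems(1) v]])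
    fix s' assume s': "St (\<sigma>(r := \<sigma> r)) (insert r {..<r}) s' \<and> fst s' = fst s"
    then have "St \<sigma> {..<Suc r} s'" by (simp add: lessThan_Suc)
    moreover have "rval (es ! i) s'' = \<sigma> (Suc r + i)"
      if "i < length es" "fst s'' = fst s'" "snd s'' 0 = \<epsilon>" for i s''
      using Cons.prems(2)[of "Suc i" s''] that s' by simp
    ultimately have "runs (set_regs (Suc r) es) s' (20 * length es + 1) (\<lambda>s'. St \<sigma> {..<Suc r + length es} s')"
      using Cons.prems(3) by (intro Cons.IH) auto
    then show "runs (set_regs (Suc r) es) s' (20 * length es + 1) (\<lambda>s'. St \<sigma> {..<r + length (e # es)} s')"
      by simp
  qed (use Cons.prems(3) in auto)
qed

lemma run_init:
  assumes s: "St (rf (real base) 0 0) {} s"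
  shows "runs init_regs s (40 * W + 200) (\<lambda>s'. St (rf (real base) 0 0) {..<8} s')"
  unfolding init_regs_def
proof (rule runs_Seq)
  have mW: "m \<le> W" using B_bounds(2) W_ge(2) by linarith
  show "runs (ceil_into 6 (RDiv (ROfNat (NConst 4)) (RAt (NConst 0)))) s (40 * W + 20)
    (\<lambda>s'. s' = ((fst s)(6 := m), snd s))"
    unfolding m_def
    by (rule runs_ceil_into) (use mW StD(7)[OF s, of 0] inp0 in \<open>simp_all flip: m_def\<close>)
  fix s1 assume s1: "s1 = ((fst s)(6 := m), snd s)"
  let ?es = "[ROfNat (NAt (NConst 3)), ROfNat (NAt (NConst 0)), ROfNat (NAt (NConst 1)),
        ROfNat (NAt (NConst 2)), ROfNat (NAt (NConst 6)), ROfNat (NConst 0), ROfNat (NConst 0),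
        RAt (NConst 0)]"
  have "runs (set_regs 0 ?es) s1 (20 * length ?es + 1) (\<lambda>s'. St (rf (real base) 0 0) {..<0 + length ?es} s')"
  proof (rule run_set_regs)
    show "St (rf (real base) 0 0) {..<0} s1" using St_cell[OF s] s1 by simp
    fix i and s' :: state assume i: "i < length ?es" and s': "fst s' = fst s1" "snd s' 0 = \<epsilon>"
    have c: "fst s' 0 = d" "fst s' (Suc 0) = n" "fst s' 2 = k" "fst s' 3 = base" "fst s' 6 = m"
      using s' s1 StD(1-5)[OF s] by simp_all
    have "i = 0 \<or> i = 1 \<or> i = 2 \<or> i = 3 \<or> i = 4 \<or> i = 5 \<or> i = 6 \<or> i = 7"
      using i by (simp, arith)
    then show "rval (?es ! i) s' = rf (real base) 0 0 (0 + i)"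
      by (elim disjE) (simp_all add: rf_def c s'(2))
  qed auto
  then show "runs (set_regs 0 ?es) s1 170 (\<lambda>s'. St (rf (real base) 0 0) {..<8} s')"
    by (rule runs_mono) (simp_all add: eval_nat_numeral)
qed simp

lemma run_search:
  assumes s: "St (rf (real base) 0 0) {..<8} s"
  shows "runs search s (tm W (eTotal 20) + tm W (ePower 20) + tm W (eBest 20) + W * 60 + 300)
    (\<lambda>s'. \<exists>X<W. St ((rf (real W) (real B) S)(8 := real X)) {..<9} s' \<and> (\<forall>Y<W. costs X \<le> costs Y))"
    (is "runs search s _ ?Q")
  unfolding search_def
proof (rule runs_Seq[OF run_compile[OF s]])
  have par8: "params_in {..<8}" by (simp add: params_in_def)
  show "wfe (eTotal 20) {..<8} 8" using par8 by simp
  show "rf (real base) 0 0 0 \<le> real W" using W_ge(4) by (simp add: rf_def)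
  have tot: "ev inp (d * n) (eTotal 20) (rf (real base) 0 0) = S"
    unfolding S_def by (rule ev_eTotal[where F = base]) (simp_all add: rf_def base_def)
  fix s1 assume "St ((rf (real base) 0 0)(8 := ev inp (d * n) (eTotal 20) (rf (real base) 0 0))) (insert 8 {..<8}) s1
    \<and> frm 8 s s1"
  then have 1: "St ((rf (real base) 0 0)(8 := S)) (insert 8 {..<8}) s1" using tot by simp
  show "runs (Seq (RAssign (reg 6) (RAt (reg 8)))
     (Seq (ceil_into 6 grid_size)
     (Seq (RAssign (reg 5) (ROfNat (NAt (NConst 6))))
     (Seq (RAssign (reg 0) (ROfNat (NAt (NConst 6))))
     (Seq (compile (ePower 20) 8)
     (Seq (RAssign (reg 0) (RAt (reg 8))) (compile (eBest 20) 8))))))) s1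
     (tm W (ePower 20) + tm W (eBest 20) + W * 60 + 300) ?Q"
  proof (rule runs_Seq[OF run_set[OF 1]])
    show "rval (RAt (reg 8)) s1 = S" using StD(5)[OF 1] StD(8)[OF 1, of 8] by simp
    fix s2 assume 2: "St ((rf (real base) 0 0)(8 := S, 6 := S)) (insert 6 (insert 8 {..<8})) s2 \<and> fst s2 = fst s1"
    \<comment> \<open>Register 8 is released, and the new content of register 6 becomes a parameter
      of \<open>rf\<close>.\<close>
    have 2: "St (rf (real base) 0 S) {..<8} s2"
      by (rule St_cong[OF conjunct1[OF 2]]) (auto simp: rf_def)
    show "runs (Seq (ceil_into 6 grid_size)
     (Seq (RAssign (reg 5) (ROfNat (NAt (NConst 6))))
     (Seq (RAssign (reg 0) (ROfNat (NAt (NConst 6))))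
     (Seq (compile (ePower 20) 8)
     (Seq (RAssign (reg 0) (RAt (reg 8))) (compile (eBest 20) 8)))))) s2
     (tm W (ePower 20) + tm W (eBest 20) + W * 60 + 280) ?Q"
    proof (rule runs_Seq)
      have g: "rval grid_size ((fst s2)(6 := v), snd s2) = 5 * real (d * n + 1) * (S + 1) / \<epsilon>" for v
        using StD(5,6)[OF 2] StD(8)[OF 2, of 6] StD(8)[OF 2, of 7]
        by (simp add: grid_size_def rf_def)
      show "runs (ceil_into 6 grid_size) s2 (W * 60 + 60) (\<lambda>s'. s' = ((fst s2)(6 := B), snd s2))"
        unfolding B_def
      proof (rule runs_ceil_into[OF g])
        have "B * (12 + rcost grid_size) \<le> W * 60"
          using W_ge(2) by (intro mult_mono) (simp_all add: grid_size_def)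
        then show "nat \<lceil>5 * real (d * n + 1) * (S + 1) / \<epsilon>\<rceil> * (12 + rcost grid_size) + 8 + rcost grid_size \<le> W * 60 + 60"
          unfolding B_def[symmetric] by (simp add: grid_size_def)
      qed
      fix s3 assume s3: "s3 = ((fst s2)(6 := B), snd s2)"
      then have 3: "St (rf (real base) 0 S) {..<8} s3" using St_cell[OF 2] by simp
      show "runs (Seq (RAssign (reg 5) (ROfNat (NAt (NConst 6))))
         (Seq (RAssign (reg 0) (ROfNat (NAt (NConst 6))))
         (Seq (compile (ePower 20) 8)
         (Seq (RAssign (reg 0) (RAt (reg 8))) (compile (eBest 20) 8))))) s3
         (tm W (ePower 20) + tm W (eBest 20) + 200) ?Q"
      proof (rule runs_Seq[OF run_set[OF 3]])
        show "rval (ROfNat (NAt (NConst 6))) s3 = real B" using s3 by simp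
        fix s4 assume 4: "St ((rf (real base) 0 S)(5 := real B)) (insert 5 {..<8}) s4 \<and> fst s4 = fst s3"
        show "runs (Seq (RAssign (reg 0) (ROfNat (NAt (NConst 6))))
           (Seq (compile (ePower 20) 8)
           (Seq (RAssign (reg 0) (RAt (reg 8))) (compile (eBest 20) 8)))) s4
           (tm W (ePower 20) + tm W (eBest 20) + 180) ?Q"
        proof (rule runs_Seq[OF run_set[OF conjunct1[OF 4]]])
          show "rval (ROfNat (NAt (NConst 6))) s4 = real B" using s3 4 by simp
          fix s5 assume 5: "St ((rf (real base) 0 S)(5 := real B, 0 := real B)) (insert 0 (insert 5 {..<8})) s5
             \<and> fst s5 = fst s4"
          have 5: "St (rf (real B) (real B) S) {..<8} s5"
            by (rule St_cong[OF conjunct1[OF 5]]) (auto simp: rf_def)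
          show "runs (Seq (compile (ePower 20) 8)
             (Seq (RAssign (reg 0) (RAt (reg 8))) (compile (eBest 20) 8))) s5
             (tm W (ePower 20) + tm W (eBest 20) + 160) ?Q"
          proof (rule runs_Seq[OF run_compile[OF 5]])
            show "wfe (ePower 20) {..<8} 8" using par8 by simp
            show "rf (real B) (real B) S 0 \<le> real W" using W_ge(2) by (simp add: rf_def)
            have "k \<le> B" using d_le(3) dn_le by linarith
            then have pw: "ev inp (d * n) (ePower 20) (rf (real B) (real B) S) = real W"
              unfolding W_def using B_bounds(2) by (intro ev_ePower) (auto simp: rf_def)
            fix s6 assume "St ((rf (real B) (real B) S)(8 := ev inp (d * n) (ePower 20) (rf (real B) (real B) S)))
               (insert 8 {..<8}) s6 \<and> frm 8 s5 s6"
            then have 6: "St ((rf (real B) (real B) S)(8 := real W)) (insert 8 {..<8}) s6" using pw by simp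
            show "runs (Seq (RAssign (reg 0) (RAt (reg 8))) (compile (eBest 20) 8)) s6
              (tm W (eBest 20) + 160) ?Q"
            proof (rule runs_Seq[OF run_set[OF 6]])
              show "rval (RAt (reg 8)) s6 = real W" using StD(5)[OF 6] StD(8)[OF 6, of 8] by simp
              fix s7 assume 7: "St ((rf (real B) (real B) S)(8 := real W, 0 := real W)) (insert 0 (insert 8 {..<8})) s7
                \<and> fst s7 = fst s6"
              have 7: "St (rf (real W) (real B) S) {..<8} s7"
                by (rule St_cong[OF conjunct1[OF 7]]) (auto simp: rf_def)
              have "par (rf (real W) (real B) S)" by (simp add: par_def rf_def)
              then obtain X where X: "X < W" "ev inp (d * n) (eBest 20) (rf (real W) (real B) S) = real X"
                "\<forall>Y<W. costs X \<le> costs Y"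
                using ev_eBest[of "rf (real W) (real B) S" 20] S_total W_ge(2) B0 by auto
              show "runs (compile (eBest 20) 8) s7 (tm W (eBest 20) + 100) ?Q"
              proof (rule runs_mono[OF run_compile[OF 7]])
                show "wfe (eBest 20) {..<8} 8" using par8 by simp
                fix s8 assume "St ((rf (real W) (real B) S)(8 := ev inp (d * n) (eBest 20) (rf (real W) (real B) S)))
                  (insert 8 {..<8}) s8 \<and> frm 8 s7 s8"
                then have "St ((rf (real W) (real B) S)(8 := real X)) {..<9} s8"
                  using X(2) by (auto intro: St_cong)
                then show "?Q s8" using X by blast
              qed (auto simp: rf_def)
            qed simp_all
          qed auto
        qed simp_all
      qed simp_all
    qed simp
  qed simp_all
qed auto

abbreviation outs :: "nat \<Rightarrow> nat \<Rightarrow> nat \<Rightarrow> real" where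
  "outs X \<equiv> candidate.out en d n k m (rows X) (wts X)"

lemma St_write: "St \<sigma> V s \<Longrightarrow> q < d * k \<Longrightarrow> St \<sigma> V (fst s, (snd s)(d * n + 1 + q := v))"
  unfolding St_def okst_def by (simp add: base_def)

lemma run_write_out:
  assumes s: "St ((rf (real W) (real B) S)(8 := real X)) {..<9} s" and X: "X < W"
  shows "runs write_out s (W * (tm W (eOut 20 8 9) + 100) + 100)
    (\<lambda>s'. fst s' 0 = d * n + 1 \<and> (\<forall>q<d * k. snd s' (d * n + 1 + q) = outs X (q div k) (q mod k)))"
    (is "runs write_out s _ ?Q")
  unfolding write_out_def
proof (rule runs_Seq)
  define \<sigma> where "\<sigma> = (rf (real W) (real B) S)(8 := real X)"
  let ?I = "\<lambda>t (s' :: state). St \<sigma> {..<9} s' \<and> fst s' 6 = t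
     \<and> (\<forall>q<t. snd s' (d * n + 1 + q) = outs X (q div k) (q mod k))"
  show "runs (NAssign (NConst 6) (NConst 0)) s 3 (?I 0)"
    using St_cell[OF s] by (intro runs_NAssign) (simp_all add: \<sigma>_def)
  fix s1 assume 1: "?I 0 s1"
  let ?body = "Seq (RAssign (reg 9) (ROfNat (NAt (NConst 6))))
        (Seq (compile (eOut 20 8 9) 10)
        (Seq (RAssign (NAdd (NAdd (NAt (NConst 5)) (NConst 1)) (NAt (NConst 6))) (RAt (reg 10)))
             (NAssign (NConst 6) (NAdd (NAt (NConst 6)) (NConst 1)))))"
  show "runs (Seq (While (RLess (ROfNat (NAt (NConst 6))) (RMul (RAt (reg 1)) (RAt (reg 3)))) ?body)
     (NAssign (NConst 0) (NAdd (NAt (NConst 5)) (NConst 1)))) s1 (W * (tm W (eOut 20 8 9) + 100) + 97) ?Q"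
  proof (rule runs_Seq)
    have test: "tval (RLess (ROfNat (NAt (NConst 6))) (RMul (RAt (reg 1)) (RAt (reg 3)))) s' \<longleftrightarrow> t < d * k"
      if "?I t s'" for t s'
    proof -
      have "fst s' 3 = base" "snd s' (base + 1) = real d" "snd s' (base + 3) = real k"
        using StD(5)[OF conjunct1[OF that]] StD(8)[OF conjunct1[OF that], of 1]
          StD(8)[OF conjunct1[OF that], of 3] by (simp_all add: \<sigma>_def rf_def)
      then show ?thesis using that by (simp flip: of_nat_mult)
    qed
    show "runs (While (RLess (ROfNat (NAt (NConst 6))) (RMul (RAt (reg 1)) (RAt (reg 3)))) ?body) s1
      (W * (tm W (eOut 20 8 9) + 100) + 20) (?I (d * k))"
    proof (rule runs_While[where I = ?I and T' = "tm W (eOut 20 8 9) + 60"])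
      fix t s2 assume t: "t < d * k" and 2: "?I t s2"
      have "runs ?body s2 (tm W (eOut 20 8 9) + 60) (?I (Suc t))"
      proof (rule runs_Seq)
        show "runs (RAssign (reg 9) (ROfNat (NAt (NConst 6)))) s2 15
          (\<lambda>s'. s' = (fst s2, (snd s2)(base + 9 := real t)))"
          using 2 StD(5)[OF conjunct1[OF 2]] by (intro runs_RAssign) auto
        fix s3 assume s3: "s3 = (fst s2, (snd s2)(base + 9 := real t))"
        have 3: "St (\<sigma>(9 := real t)) (insert 9 {..<9}) s3" using St_set[OF conjunct1[OF 2]] s3 by simp
        have o: "ev inp (d * n) (eOut 20 8 9) (\<sigma>(9 := real t)) = outs X (t div k) (t mod k)"
          using X t W_ge(5) by (intro ev_eOut) (auto simp: \<sigma>_def par_def rf_def)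
        show "runs (Seq (compile (eOut 20 8 9) 10)
        (Seq (RAssign (NAdd (NAdd (NAt (NConst 5)) (NConst 1)) (NAt (NConst 6))) (RAt (reg 10)))
             (NAssign (NConst 6) (NAdd (NAt (NConst 6)) (NConst 1))))) s3 (tm W (eOut 20 8 9) + 45) (?I (Suc t))"
        proof (rule runs_Seq[OF run_compile[OF 3]])
          have "params_in (insert 9 {..<9})" by (auto simp: params_in_def)
          then show "wfe (eOut 20 8 9) (insert 9 {..<9}) 10" by simp
          show "(\<sigma>(9 := real t)) 0 \<le> real W" by (simp add: \<sigma>_def rf_def)
          fix s4 assume 4: "St (\<sigma>(9 := real t, 10 := ev inp (d * n) (eOut 20 8 9) (\<sigma>(9 := real t))))
            (insert 10 (insert 9 {..<9})) s4 \<and> frm 10 s3 s4"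
          have r10: "snd s4 (base + 10) = outs X (t div k) (t mod k)"
            using StD(8)[OF conjunct1[OF 4], of 10] o by simp
          have c: "fst s4 3 = base" "fst s4 5 = d * n" using StD(5,6)[OF conjunct1[OF 4]] by auto
          have 6: "fst s4 6 = t" using 4 2 s3 by (simp add: frm_def)
          \<comment> \<open>The output area ends below \<open>base\<close>, so evaluating the next
            entry does not disturb the earlier ones.\<close>
          have old: "snd s4 (d * n + 1 + q) = outs X (q div k) (q mod k)" if "q < t" for q
          proof -
            have lt: "d * n + 1 + q < base" using that t unfolding base_def by simp
            then have "snd s4 (d * n + 1 + q) = snd s3 (d * n + 1 + q)" using 4 unfolding frm_def by simp
            also have "\<dots> = snd s2 (d * n + 1 + q)" using s3 lt by simp
            finally show ?thesis using 2 that by simp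
          qed
          have 5: "St \<sigma> {..<9} s4"
            by (rule St_cong[OF conjunct1[OF 4]]) auto
          show "runs (Seq (RAssign (NAdd (NAdd (NAt (NConst 5)) (NConst 1)) (NAt (NConst 6))) (RAt (reg 10)))
             (NAssign (NConst 6) (NAdd (NAt (NConst 6)) (NConst 1)))) s4 45 (?I (Suc t))"
          proof (rule runs_Seq)
            show "runs (RAssign (NAdd (NAdd (NAt (NConst 5)) (NConst 1)) (NAt (NConst 6))) (RAt (reg 10))) s4 20
              (\<lambda>s'. s' = (fst s4, (snd s4)(d * n + 1 + t := outs X (t div k) (t mod k))))"
              using c 6 r10 by (intro runs_RAssign) auto
            fix s5 assume s5: "s5 = (fst s4, (snd s4)(d * n + 1 + t := outs X (t div k) (t mod k)))"
            have "St \<sigma> {..<9} s5" using St_write[OF 5 t] s5 by simp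
            from St_cell[OF this] show "runs (NAssign (NConst 6) (NAdd (NAt (NConst 6)) (NConst 1))) s5 25 (?I (Suc t))"
              using old s5 6 by (intro runs_NAssign) (auto simp: less_Suc_eq)
          qed simp
        qed auto
      qed simp
      then show "tval (RLess (ROfNat (NAt (NConst 6))) (RMul (RAt (reg 1)) (RAt (reg 3)))) s2 \<and>
        runs ?body s2 (tm W (eOut 20 8 9) + 60) (?I (Suc t))" using test[OF 2] t by blast
    next
      have "d * k * (tm W (eOut 20 8 9) + 75) \<le> W * (tm W (eOut 20 8 9) + 100)"
        using W_ge(5) by (intro mult_mono) auto
      then show "d * k * (tcost (RLess (ROfNat (NAt (NConst 6))) (RMul (RAt (reg 1)) (RAt (reg 3))))
           + (tm W (eOut 20 8 9) + 60))
         + tcost (RLess (ROfNat (NAt (NConst 6))) (RMul (RAt (reg 1)) (RAt (reg 3))))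
        \<le> W * (tm W (eOut 20 8 9) + 100) + 20" by (simp add: algebra_simps)
    next
      fix s2 assume "?I (d * k) s2"
      from test[OF this] show "\<not> tval (RLess (ROfNat (NAt (NConst 6))) (RMul (RAt (reg 1)) (RAt (reg 3)))) s2"
        by simp
    qed (fact 1)
    fix s2 assume 2: "?I (d * k) s2"
    then show "runs (NAssign (NConst 0) (NAdd (NAt (NConst 5)) (NConst 1))) s2 77 ?Q"
      using StD(6)[OF conjunct1[OF 2]] by (intro runs_NAssign) auto
  qed simp
qed simp

lemma run_program:
  "runs program (input_state A k \<epsilon>) (run_time W)
    (\<lambda>s. \<exists>X<W. (\<forall>Y<W. costs X \<le> costs Y) \<and> output_mat d k s = mat d k (\<lambda>(i, j). outs X i j))"
  unfolding program_def
proof (rule runs_Seq[OF run_prelude])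
  fix s1 assume 1: "St (rf (real base) 0 0) {} s1"
  show "runs (Seq init_regs (Seq search write_out)) s1 (run_time W - (40 * W + 20))
    (\<lambda>s. \<exists>X<W. (\<forall>Y<W. costs X \<le> costs Y) \<and> output_mat d k s = mat d k (\<lambda>(i, j). outs X i j))"
  proof (rule runs_Seq[OF run_init[OF 1]])
    fix s2 assume 2: "St (rf (real base) 0 0) {..<8} s2"
    show "runs (Seq search write_out) s2 (run_time W - (80 * W + 220))
      (\<lambda>s. \<exists>X<W. (\<forall>Y<W. costs X \<le> costs Y) \<and> output_mat d k s = mat d k (\<lambda>(i, j). outs X i j))"
    proof (rule runs_Seq[OF run_search[OF 2]])
      fix s3 assume "\<exists>X<W. St ((rf (real W) (real B) S)(8 := real X)) {..<9} s3 \<and> (\<forall>Y<W. costs X \<le> costs Y)"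
      then obtain X where X: "X < W" "St ((rf (real W) (real B) S)(8 := real X)) {..<9} s3"
        "\<forall>Y<W. costs X \<le> costs Y" by blast
      show "runs write_out s3 (W * (tm W (eOut 20 8 9) + 100) + 100)
        (\<lambda>s. \<exists>X<W. (\<forall>Y<W. costs X \<le> costs Y) \<and> output_mat d k s = mat d k (\<lambda>(i, j). outs X i j))"
      proof (rule runs_mono[OF run_write_out[OF X(2,1)] order_refl])
        fix s :: state assume s: "fst s 0 = d * n + 1 \<and> (\<forall>q<d * k. snd s (d * n + 1 + q) = outs X (q div k) (q mod k))"
        have "output_mat d k s = mat d k (\<lambda>(i, j). outs X i j)"
          unfolding output_mat_def
        proof (rule cong_mat, simp, simp)
          fix i j assume ij: "i < d" "j < k"
          have "(i + 1) * k \<le> d * k" using ij by (intro mult_right_mono) auto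
          then have "i * k + j < d * k" using ij by simp
          then have "snd s (d * n + 1 + (i * k + j)) = outs X ((i * k + j) div k) ((i * k + j) mod k)"
            using s by blast
          then show "(case (i, j) of (i, j) \<Rightarrow> snd s (fst s 0 + i * k + j)) = (case (i, j) of (i, j) \<Rightarrow> outs X i j)"
            using s ij by (simp add: add.assoc)
        qed
        then show "\<exists>X<W. (\<forall>Y<W. costs X \<le> costs Y) \<and> output_mat d k s = mat d k (\<lambda>(i, j). outs X i j)"
          using X by blast
      qed
    qed (simp add: run_time_def)
  qed (simp add: run_time_def)
qed (simp add: run_time_def)

end

section \<open>The approximation guarantee and the time bound\<close>

text \<open>The compiled expressions are fixed, so coefficient and degree are independent of the
  instance; only the fuel varies.\<close>

definition poly_bounded :: "(nat \<Rightarrow> nat) \<Rightarrow> bool" where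
  "poly_bounded f \<longleftrightarrow> (\<exists>c D. \<forall>F\<ge>1. f F \<le> c * F ^ D)"

lemma poly_bounded_const: "poly_bounded (\<lambda>_. c)"
  unfolding poly_bounded_def by (intro exI[of _ c] exI[of _ 0]) simp

lemma poly_bounded_id: "poly_bounded (\<lambda>F. F)"
  unfolding poly_bounded_def by (intro exI[of _ 1] exI[of _ 1]) simp

lemma poly_bounded_mult:
  assumes "poly_bounded f" "poly_bounded g"
  shows "poly_bounded (\<lambda>F. f F * g F)"
proof -
  obtain c D c' D' where f: "\<forall>F\<ge>1. f F \<le> c * F ^ D" and g: "\<forall>F\<ge>1. g F \<le> c' * F ^ D'"
    using assms unfolding poly_bounded_def by blast
  have "f F * g F \<le> (c * c') * F ^ (D + D')" if "F \<ge> 1" for F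
  proof -
    have "f F * g F \<le> (c * F ^ D) * (c' * F ^ D')" using f g that by (intro mult_mono) auto
    then show ?thesis by (simp add: power_add mult_ac)
  qed
  then show ?thesis unfolding poly_bounded_def by blast
qed

lemma poly_bounded_add:
  assumes "poly_bounded f" "poly_bounded g"
  shows "poly_bounded (\<lambda>F. f F + g F)"
proof -
  obtain c D c' D' where f: "\<forall>F\<ge>1. f F \<le> c * F ^ D" and g: "\<forall>F\<ge>1. g F \<le> c' * F ^ D'"
    using assms unfolding poly_bounded_def by blast
  have "f F + g F \<le> (c + c') * F ^ (D + D')" if F: "F \<ge> 1" for F
  proof -
    have "c * F ^ D \<le> c * F ^ (D + D')" "c' * F ^ D' \<le> c' * F ^ (D + D')"
      using F by (intro mult_left_mono power_increasing; simp)+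
    moreover have "f F \<le> c * F ^ D" "g F \<le> c' * F ^ D'" using f g F by blast+
    ultimately show ?thesis unfolding distrib_right by linarith
  qed
  then show ?thesis unfolding poly_bounded_def by blast
qed

lemma poly_bounded_tm: "poly_bounded (\<lambda>F. tm F e)"
  by (induction e) (auto intro!: poly_bounded_add poly_bounded_mult poly_bounded_const poly_bounded_id)

lemma poly_bounded_run_time: "poly_bounded run_time"
  unfolding run_time_def[abs_def]
  by (intro poly_bounded_add poly_bounded_mult poly_bounded_const poly_bounded_id poly_bounded_tm)

text \<open>The factor 21 is absorbed into the base if \<open>b \<ge> 2\<close>; otherwise \<open>d = k = 1\<close> and
  \<open>\<epsilon> > 1/2\<close>, so that the whole exponent is bounded.\<close>

lemma time_bound:
  fixes d n k :: nat and \<gamma> \<epsilon> w :: real and D E :: nat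
  assumes "0 < n" "0 < k" "k \<le> d" "1 \<le> \<gamma>" "0 < \<epsilon>" "\<epsilon> < 1"
    and b: "b = real n * real d * \<gamma> / \<epsilon>"
    and w: "0 \<le> w" "w \<le> (21 * b\<^sup>2) ^ E" and E: "real E \<le> 10 * real D * real k / \<epsilon>"
    and C: "C = real c * 84 ^ (20 * D) + 70 * real D + 1"
  shows "real c * w \<le> C * b powr (C * real k ^ 3 / \<epsilon>)"
proof -
  have d: "1 \<le> real d" "1 \<le> real n" "1 \<le> real k" using assms by auto
  have nd: "1 \<le> real n * real d" using mult_mono[of 1 "real n" 1 "real d"] d by simp
  then have ndg: "real n * real d \<le> real n * real d * \<gamma>" using assms by (simp add: mult_le_cancel_left1)
  have b1: "real n * real d / \<epsilon> \<le> b" unfolding b using ndg assms by (intro divide_right_mono) auto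
  have "1 / \<epsilon> \<le> real n * real d / \<epsilon>" using nd assms by (intro divide_right_mono) auto
  then have eb: "1 / \<epsilon> \<le> b" using b1 by linarith
  have "1 \<le> 1 / \<epsilon>" using assms by simp
  then have b_ge: "1 \<le> b" using eb by linarith
  have c0: "0 \<le> real c" by simp
  have C1: "real c \<le> C" "70 * real D \<le> C" "0 \<le> C" "real c * 84 ^ (20 * D) \<le> C"
  proof -
    have "real c * 1 \<le> real c * 84 ^ (20 * D)" by (intro mult_left_mono one_le_power) auto
    moreover have "0 \<le> real c * 84 ^ (20 * D)" by simp
    ultimately show "real c \<le> C" "70 * real D \<le> C" "0 \<le> C" "real c * 84 ^ (20 * D) \<le> C"
      unfolding C by auto
  qed
  show ?thesis
  proof (cases "2 \<le> b")
    case True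
    \<comment> \<open>The constant 21 is below the fifth power of 2.\<close>
    have "21 * b\<^sup>2 \<le> b ^ 7"
    proof -
      have "(2::real) ^ 5 \<le> b ^ 5" using True by (intro power_mono) auto
      then have "21 \<le> b ^ 5" by simp
      then have "21 * b\<^sup>2 \<le> b ^ 5 * b\<^sup>2" by (intro mult_right_mono) auto
      also have "\<dots> = b ^ 7" by (simp add: power_add[symmetric])
      finally show ?thesis .
    qed
    then have "(21 * b\<^sup>2) ^ E \<le> (b ^ 7) ^ E" by (intro power_mono) auto
    also have "\<dots> = b ^ (7 * E)" by (simp add: power_mult)
    also have "\<dots> = b powr (7 * real E)" using b_ge by (simp add: powr_realpow[symmetric])
    also have "\<dots> \<le> b powr (C * real k ^ 3 / \<epsilon>)"
    proof (rule powr_mono)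
      \<comment> \<open>Origin of the 70 in \<open>C\<close>. The exponent is linear in
        \<open>k\<close> and is raised to the cube only here.\<close>
      have "7 * real E \<le> 7 * (10 * real D * real k / \<epsilon>)" using E by (intro mult_left_mono) auto
      also have "\<dots> = 70 * real D * real k / \<epsilon>" by simp
      also have "\<dots> \<le> C * real k ^ 3 / \<epsilon>"
      proof (rule divide_right_mono)
        have "real k ^ 1 \<le> real k ^ 3" using d by (intro power_increasing) auto
        then show "70 * real D * real k \<le> C * real k ^ 3" using C1 by (intro mult_mono) auto
      qed (use assms in simp)
      finally show "7 * real E \<le> C * real k ^ 3 / \<epsilon>" .
    qed (use b_ge in simp)
    finally have "w \<le> b powr (C * real k ^ 3 / \<epsilon>)" using w by linarith
    then show ?thesis using C1 w by (intro mult_mono) auto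
  next
    case False
    then have e2: "1 / \<epsilon> < 2" using eb by linarith
    have "real n * real d \<le> real n * real d / \<epsilon>" using assms nd by (simp add: le_divide_eq mult_left_le)
    then have "real n * real d < 2" using b1 False by linarith
    moreover have "real d \<le> real n * real d" using d by (simp add: mult_le_cancel_right1)
    ultimately have "real d < 2" by linarith
    then have "k = 1" using assms by simp
    then have "real E \<le> 10 * real D * (1 / \<epsilon>)" using E by simp
    also have "\<dots> \<le> 10 * real D * 2" using e2 by (intro mult_left_mono) auto
    finally have "real E \<le> real (20 * D)" by simp
    then have E20: "E \<le> 20 * D" by linarith
    \<comment> \<open>Origin of \<open>84 ^ (20 * D)\<close>: now 21 times the square of
      \<open>b\<close> is at most 84, and \<open>E\<close> is bounded.\<close>
    have "b\<^sup>2 \<le> 2\<^sup>2" using False b_ge by (intro power_mono) auto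
    then have "(21 * b\<^sup>2) ^ E \<le> 84 ^ E" by (intro power_mono) auto
    also have "\<dots> \<le> 84 ^ (20 * D)" using E20 by (intro power_increasing) auto
    finally have "real c * w \<le> real c * 84 ^ (20 * D)" using w by (intro mult_left_mono) auto
    also have "\<dots> \<le> C * 1" using C1 by simp
    also have "\<dots> \<le> C * b powr (C * real k ^ 3 / \<epsilon>)"
      using C1 b_ge assms by (intro mult_left_mono ge_one_powr_ge_zero) (auto intro!: divide_nonneg_nonneg mult_nonneg_nonneg)
    finally show ?thesis .
  qed
qed

context instance_run
begin

lemma good_code:
  assumes int: "\<And>i l. i < d \<Longrightarrow> l < n \<Longrightarrow> A $$ (i, l) \<in> \<int>" and U: "U \<in> nonneg_orthonormal d k"
  shows "\<exists>X<W. costs X \<le> (1 + \<epsilon>) * residual A U"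
proof -
  have total: "(\<Sum>i<d. \<Sum>l<n. (en i l)\<^sup>2) = S" using S_total by (simp add: candidate.total_def)
  have "5 * real d * S / \<epsilon> \<le> 5 * real (d * n + 1) * (S + 1) / \<epsilon>"
  proof (rule divide_right_mono)
    have "real d \<le> real (d * n + 1)" using d_le(1) by linarith
    then show "5 * real d * S \<le> 5 * real (d * n + 1) * (S + 1)" using S0 by (intro mult_mono) auto
  qed (use \<epsilon>0 in simp)
  then have B2: "5 * real d * (\<Sum>i<d. \<Sum>l<n. (en i l)\<^sup>2) / \<epsilon> \<le> real B" unfolding total using B_ge by linarith
  have B1: "1 \<le> B" using B0 by simp
  have int': "en i l \<in> \<int>" if "i < d" "l < n" for i l using int[OF that] en_eq[OF that] by simp
  obtain R w where Rw: "\<forall>j<k. \<forall>s. R j s < d \<and> 1 \<le> w j s \<and> w j s \<le> B"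
    and good: "\<forall>R' w'. (\<forall>j<k. \<forall>s<m. R' j s = R j s \<and> w' j s = w j s) \<longrightarrow>
      candidate.cost en d n k m R' w' \<le> (1 + \<epsilon>) * residual A U"
    using exists_good_candidate[OF A en_eq int' k0 \<epsilon>0 \<epsilon>1 B1 B2 m0 m_ge U] by blast
  \<comment> \<open>Even digits are rows and odd digits are weights minus 1, matching
    \<open>rows\<close> and \<open>wts\<close>.\<close>
  define f where "f t = (if even t then R (t div 2 div m) (t div 2 mod m)
    else w (t div 2 div m) (t div 2 mod m) - 1)" for t
  have "f t < B" if t: "t < 2 * (k * m)" for t
  proof -
    have "t div 2 < k * m" using t by linarith
    then have "t div 2 div m < k" using m0 by (simp add: div_less_iff_less_mult)
    then have *: "R (t div 2 div m) (t div 2 mod m) < d" "1 \<le> w (t div 2 div m) (t div 2 mod m)"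
      "w (t div 2 div m) (t div 2 mod m) \<le> B" using Rw by blast+
    then have "w (t div 2 div m) (t div 2 mod m) - 1 < B" by linarith
    moreover have "d \<le> B" using d_le(1) dn_le by linarith
    ultimately show ?thesis unfolding f_def using * by simp
  qed
  then obtain X where X: "X < W" "\<forall>t<2 * (k * m). dgt B X t = f t"
    using exists_digits[of "2 * (k * m)" f B] unfolding W_def by blast
  have "rows X j s = R j s \<and> wts X j s = w j s" if j: "j < k" and s: "s < m" for j s
  proof -
    have "(j + 1) * m \<le> k * m" using j by (intro mult_right_mono) auto
    then have t: "(j * m + s) * 2 + 1 < 2 * (k * m)" using s by simp
    have "(j * m + s) div m = j" "(j * m + s) mod m = s" using s by simp_all
    moreover have "((j * m + s) * 2 + 1) div 2 = j * m + s" by simp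
    moreover have "1 \<le> w j s" using Rw j by blast
    ultimately show ?thesis using X(2) t unfolding rows_def wts_def f_def by simp
  qed
  then have "costs X \<le> (1 + \<epsilon>) * residual A U" using good by blast
  then show ?thesis using X(1) by blast
qed

lemma program_correct:
  assumes int: "\<And>i l. i < d \<Longrightarrow> l < n \<Longrightarrow> A $$ (i, l) \<in> \<int>"
  shows "\<exists>t s. exec program (input_state A k \<epsilon>) t s \<and> t \<le> run_time W \<and>
    output_mat d k s \<in> nonneg_orthonormal d k \<and> residual A (output_mat d k s) \<le> (1 + \<epsilon>) * OPT A k"
proof -
  obtain t s X where run: "exec program (input_state A k \<epsilon>) t s" "t \<le> run_time W"
    and X: "\<forall>Y<W. costs X \<le> costs Y" and out: "output_mat d k s = mat d k (\<lambda>(i, j). outs X i j)"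
    using run_program unfolding runs_def by blast
  have best: "costs X \<le> (1 + \<epsilon>) * residual A U" if U: "U \<in> nonneg_orthonormal d k" for U
    using good_code[OF int U] X by (meson order_trans)
  interpret candidate en d n k m "rows X" "wts X" .
  \<comment> \<open>A minimiser with a zero column would cost more than \<open>2 * S\<close>, yet it
    costs at most \<open>1 + \<epsilon>\<close> times the residual of any feasible matrix, which is
    at most \<open>S\<close>.\<close>
  have pos: "0 < colsq j" if j: "j < k" for j
  proof (rule ccontr)
    assume "\<not> 0 < colsq j"
    then have le: "2 * S + 1 \<le> cost" using cost_ge(2)[OF k0 j] S_total by simp
    obtain U where U: "U \<in> nonneg_orthonormal d k" using nonneg_orthonormal_nonempty[OF kd] by blast
    have "residual A U \<le> (\<Sum>i<d. \<Sum>l<n. (A $$ (i, l))\<^sup>2)" by (rule residual_le_total[OF A U k0])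
    also have "\<dots> = S" unfolding S_total candidate.total_def using en_eq by (intro sum.cong refl) simp
    finally have "(1 + \<epsilon>) * residual A U \<le> (1 + \<epsilon>) * S" using \<epsilon>0 by (intro mult_left_mono) auto
    moreover have "(1 + \<epsilon>) * S \<le> 2 * S" using S0 \<epsilon>1 by (intro mult_right_mono) auto
    ultimately show False using le best[OF U] by linarith
  qed
  have "residual A (mat d k (\<lambda>(i, j). out i j)) \<le> cost" by (rule out_residual[OF k0 pos A en_eq])
  then have "residual A (mat d k (\<lambda>(i, j). out i j)) \<le> (1 + \<epsilon>) * OPT A k"
    using best by (intro le_OPT[OF A kd \<epsilon>0]) (meson order_trans)
  then show ?thesis using run out out_feasible[OF k0 pos] by (intro exI[of _ t] exI[of _ s]) simp
qed

text \<open>Since \<open>q\<close> and \<open>q * \<gamma>\<^sup>2\<close> are at least 1, the two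
  increments in \<open>B\<close> cost a factor 2 each, turning 5 into 20; the ceiling adds the last
  unit of 21. The square of the base comes from the bound \<open>q * \<gamma>\<^sup>2\<close> on the
  squared norm.\<close>

lemma W_le:
  assumes \<gamma>: "1 \<le> \<gamma>" "\<And>i l. i < d \<Longrightarrow> l < n \<Longrightarrow> \<bar>A $$ (i, l)\<bar> \<le> \<gamma>"
  shows "real W \<le> (21 * (real n * real d * \<gamma> / \<epsilon>)\<^sup>2) ^ (2 * (k * m))"
proof -
  define q where "q = real n * real d"
  have q1: "1 \<le> q" unfolding q_def using n0 d0 mult_mono[of 1 "real n" 1 "real d"] by simp
  have "S \<le> (\<Sum>i<d. \<Sum>l<n. \<gamma>\<^sup>2)"
    unfolding S_total candidate.total_def
  proof (intro sum_mono)
    fix i l assume "i \<in> {..<d}" "l \<in> {..<n}"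
    then have "\<bar>en i l\<bar> \<le> \<bar>\<gamma>\<bar>" using \<gamma> en_eq[of i l] by force
    then show "(en i l)\<^sup>2 \<le> \<gamma>\<^sup>2" by (simp only: abs_le_square_iff)
  qed
  then have S: "S \<le> q * \<gamma>\<^sup>2" unfolding q_def by (simp add: mult_ac)
  have g1: "1 \<le> \<gamma>\<^sup>2" using \<gamma>(1) by (rule one_le_power)
  have qg: "1 \<le> q * \<gamma>\<^sup>2" using mult_mono[of 1 q 1 "\<gamma>\<^sup>2"] q1 g1 by simp
  have "real B \<le> 5 * (q + 1) * (S + 1) / \<epsilon> + 1"
  proof -
    define x where "x = 5 * (q + 1) * (S + 1) / \<epsilon>"
    have "0 \<le> x" unfolding x_def using q1 S0 \<epsilon>0 by simp
    moreover have "real (d * n + 1) = q + 1" unfolding q_def by (simp add: mult_ac)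
    then have "B = nat \<lceil>x\<rceil>" unfolding B_def x_def by (simp only:)
    ultimately have "real B \<le> x + 1" by linarith
    then show ?thesis unfolding x_def .
  qed
  also have "\<dots> \<le> 5 * (2 * q) * (2 * (q * \<gamma>\<^sup>2)) / \<epsilon> + 1"
    using q1 S qg S0 \<epsilon>0 by (intro add_right_mono divide_right_mono mult_mono) auto
  also have "\<dots> = 20 * ((q * \<gamma>)\<^sup>2 / \<epsilon>) + 1" by (simp add: power2_eq_square mult_ac)
  also have "\<dots> \<le> 21 * ((q * \<gamma>)\<^sup>2 / \<epsilon>\<^sup>2)"
  proof -
    have e2: "\<epsilon>\<^sup>2 \<le> \<epsilon>" using \<epsilon>0 \<epsilon>1 by (simp add: power2_eq_square mult_left_le)
    have 1: "(q * \<gamma>)\<^sup>2 / \<epsilon> \<le> (q * \<gamma>)\<^sup>2 / \<epsilon>\<^sup>2" using e2 \<epsilon>0 by (intro divide_left_mono) auto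
    have "1 \<le> q * \<gamma>" using mult_mono[of 1 q 1 \<gamma>] q1 \<gamma>(1) by simp
    then have "1 \<le> (q * \<gamma>)\<^sup>2" by (rule one_le_power)
    moreover have "\<epsilon>\<^sup>2 \<le> 1" using e2 \<epsilon>1 by linarith
    ultimately have "1 \<le> (q * \<gamma>)\<^sup>2 / \<epsilon>\<^sup>2" using \<epsilon>0 by (simp add: le_divide_eq)
    then show ?thesis using 1 by linarith
  qed
  also have "\<dots> = 21 * (real n * real d * \<gamma> / \<epsilon>)\<^sup>2" unfolding q_def by (simp add: power_divide)
  finally have "real B \<le> 21 * (real n * real d * \<gamma> / \<epsilon>)\<^sup>2" .
  then show ?thesis unfolding W_def of_nat_power by (rule power_mono) simp
qed

end

theorem theorem26:
  shows "\<exists>(P :: com) (C :: real).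
    \<forall>(d :: nat) (n :: nat) (k :: nat) (\<gamma> :: real) (\<epsilon> :: real) (A :: real mat).
      0 < n \<longrightarrow> 0 < k \<longrightarrow> k \<le> d \<longrightarrow> 1 \<le> \<gamma> \<longrightarrow> 0 < \<epsilon> \<longrightarrow> \<epsilon> < 1 \<longrightarrow>
      A \<in> carrier_mat d n \<longrightarrow>
      (\<forall>i<d. \<forall>j<n. A $$ (i, j) \<in> \<int> \<and> \<bar>A $$ (i, j)\<bar> \<le> \<gamma>) \<longrightarrow>
      (\<exists>t s. exec P (input_state A k \<epsilon>) t s \<and>
         output_mat d k s \<in> nonneg_orthonormal d k \<and>
         residual A (output_mat d k s) \<le> (1 + \<epsilon>) * OPT A k \<and>
         real t \<le> C * (real n * real d * \<gamma> / \<epsilon>) powr (C * real k ^ 3 / \<epsilon>))"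
proof -
  obtain c D where cD: "\<forall>F\<ge>1. run_time F \<le> c * F ^ D"
    using poly_bounded_run_time unfolding poly_bounded_def by blast
  \<comment> \<open>One constant serves as leading factor and as coefficient of the
    exponent.\<close>
  define C where "C = real c * 84 ^ (20 * D) + 70 * real D + 1"
  show ?thesis
  proof (intro exI[of _ program] exI[of _ C] allI impI)
    fix d n k :: nat and \<gamma> \<epsilon> :: real and A :: "real mat"
    assume *: "0 < n" "0 < k" "k \<le> d" "1 \<le> \<gamma>" "0 < \<epsilon>" "\<epsilon> < 1" and A: "A \<in> carrier_mat d n"
      and entries: "\<forall>i<d. \<forall>j<n. A $$ (i, j) \<in> \<int> \<and> \<bar>A $$ (i, j)\<bar> \<le> \<gamma>"
    interpret instance_run A d n k \<epsilon> by unfold_locales (use * A in auto)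
    obtain t s where run: "exec program (input_state A k \<epsilon>) t s" "t \<le> run_time W"
      and out: "output_mat d k s \<in> nonneg_orthonormal d k" "residual A (output_mat d k s) \<le> (1 + \<epsilon>) * OPT A k"
      using program_correct entries by blast
    have "1 \<le> W" using W_ge(2) B0 by linarith
    then have "t \<le> c * W ^ D" using cD run(2) by (meson le_trans)
    then have "real t \<le> real c * real W ^ D" by (metis of_nat_le_iff of_nat_mult of_nat_power)
    also have "\<dots> \<le> C * (real n * real d * \<gamma> / \<epsilon>) powr (C * real k ^ 3 / \<epsilon>)"
    proof (rule time_bound[OF * refl _ _ _ C_def])
      have "real W ^ D \<le> ((21 * (real n * real d * \<gamma> / \<epsilon>)\<^sup>2) ^ (2 * (k * m))) ^ D"
        using W_le[of \<gamma>] * entries by (intro power_mono) auto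
      then show "real W ^ D \<le> (21 * (real n * real d * \<gamma> / \<epsilon>)\<^sup>2) ^ (2 * (k * m) * D)"
        by (simp only: power_mult)
      have "real (2 * (k * m) * D) = 2 * real D * real k * real m" by simp
      also have "\<dots> \<le> 2 * real D * real k * (5 / \<epsilon>)" using m_le by (intro mult_left_mono) auto
      finally show "real (2 * (k * m) * D) \<le> 10 * real D * real k / \<epsilon>" by simp
    qed simp
    finally show "\<exists>t s. exec program (input_state A k \<epsilon>) t s \<and>
         output_mat d k s \<in> nonneg_orthonormal d k \<and>
         residual A (output_mat d k s) \<le> (1 + \<epsilon>) * OPT A k \<and>
         real t \<le> C * (real n * real d * \<gamma> / \<epsilon>) powr (C * real k ^ 3 / \<epsilon>)"
      using run(1) out by blast
  qed
qed

end
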